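(* Let $G$ be a connected Lie group with Lie algebra $\mathfrak g$, endowed with a left invariant flat torsionless connection $\nabla$ and a left invariant Riemannian metric $\langle\cdot,\cdot\rangle$. Let $(TG,J_1,g_1)$ be the canonical Hermitian structure associated to $(G,\nabla,\langle\cdot,\cdot\rangle)$, let $\nabla^1$ be the associated canonical affine connection on $TG$, and let $(J_0,g_0,\nabla^0)$ be the left invariant structure on the Lie group $G\times\mathfrak g$ (all described in the context). Then the identification $\Theta:TG\to G\times\mathfrak g$, $\Theta(X_p)=(p,T_pL_{p^{-1}}X_p)$ for $X_p\in T_pG$ (with $L_q$ the left translation by $q$), sends $(J_1,g_1,\nabla^1)$ to $(J_0,g_0,\nabla^0)$; that is, for all vector fields $X,Y$ on the manifold $TG$, $$g_1(X,Y)=g_0(\Theta_*X,\Theta_*Y)\circ\Theta,\qquad \Theta_*(J_1X)=J_0\,\Theta_*X,\qquad \Theta_*(\nabla^1_XY)=\nabla^0_{\Theta_*X}\Theta_*Y.$$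
   Context: Canonical structure on a tangent bundle. Let $(M,\nabla,\langle\cdot,\cdot\rangle)$ be a manifold with a flat torsionless connection $\nabla$ and a Riemannian metric, and let $\pi_1:TM\to M$ be the projection. For a vector field $X$ on $M$, $X^h$ denotes its horizontal lift to $TM$ with respect to $\nabla$ and $X^v$ its vertical lift. Define on $TM$: the connection $\nabla^1$ (flat and torsionless) by $\nabla^1_{X^h}Y^h=(\nabla_XY)^h$, $\nabla^1_{X^h}Y^v=(\nabla_XY)^v$, $\nabla^1_{X^v}Y^h=\nabla^1_{X^v}Y^v=0$; the complex structure $J_1$ by $J_1X^h=X^v$, $J_1X^v=-X^h$; the metric $g_1$ by $g_1(X^h,Y^h)=g_1(X^v,Y^v)=\langle X,Y\rangle\circ\pi_1$, $g_1(X^h,Y^v)=0$. Structure on $G\times\mathfrak g$. For $a\in\mathfrak g=T_eG$, $a^-$ is the left invariant vector field with value $a$ at $e$. The connection defines a product on $\mathfrak g$ by $a\bullet b=(\nabla_{a^-}b^-)(e)$; it is left symmetric and satisfies $a\bullet b-b\bullet a=[a,b]$, so that $\mathrm L:\mathfrak g\to\mathrm{End}(\mathfrak g)$, $\mathrm L_ab=a\bullet b$, is a Lie algebra representation. Let $\rho:G\to\mathrm{GL}(\mathfrak g)$ be the homomorphism of groups such that $d_e\rho=\mathrm L$. The manifold $G\times\mathfrak g$ is given the Lie group product $(p,a)\cdot(q,b)=(pq,\;b+\rho(q^{-1})(a))$, whose Lie algebra is $\Phi(\mathfrak g)=\mathfrak g\times\mathfrak g$ with bracket $[(a,b),(c,d)]_\Phi=([a,c],a\bullet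 d-c\bullet b)$. For $(a,b)\in\Phi(\mathfrak g)$ let $(a,b)^-$ be the corresponding left invariant vector field on $G\times\mathfrak g$. The left invariant triple $(J_0,g_0,\nabla^0)$ is determined by $J_0(a,b)^-=(-b,a)^-$, $g_0((a,b)^-,(c,d)^-)=\langle a,c\rangle+\langle b,d\rangle$, $\nabla^0_{(a,b)^-}(c,d)^-=(a\bullet c,a\bullet d)^-$. *)

theory Defs
  imports "HOL-Analysis.Analysis" "HOL-Algebra.Group"
begin

section \<open>Smooth manifolds\<close>

primrec Ck_on :: "nat \<Rightarrow> 'e::real_normed_vector set \<Rightarrow> ('e \<Rightarrow> 'f::real_normed_vector) \<Rightarrow> bool" where
  "Ck_on 0 S f \<longleftrightarrow> continuous_on S f"
| "Ck_on (Suc k) S f \<longleftrightarrow>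
     (\<forall>x\<in>S. f differentiable (at x)) \<and> (\<forall>v. Ck_on k S (\<lambda>x. frechet_derivative f (at x) v))"

text \<open>Only used for open \<open>S\<close>.\<close>

definition smooth_on :: "'e::real_normed_vector set \<Rightarrow> ('e \<Rightarrow> 'f::real_normed_vector) \<Rightarrow> bool" where
  "smooth_on S f \<longleftrightarrow> (\<forall>k. Ck_on k S f)"

text \<open>A chart is a pair of its domain and a coordinate map, whose values outside the domain are
  irrelevant. A manifold is represented by an atlas (not necessarily maximal); its underlying set
  and its topology are recovered from the atlas.\<close>

type_synonym ('a, 'e) chart = "'a set \<times> ('a \<Rightarrow> 'e)"
type_synonym ('a, 'e) atlas = "('a, 'e) chart set"

definition mcarrier :: "('a, 'e) atlas \<Rightarrow> 'a set" where
  "mcarrier A = (\<Union>c\<in>A. fst c)"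

definition mopen :: "('a, 'e::topological_space) atlas \<Rightarrow> 'a set \<Rightarrow> bool" where
  "mopen A W \<longleftrightarrow> W \<subseteq> mcarrier A \<and> (\<forall>(U, \<phi>)\<in>A. open (\<phi> ` (W \<inter> U)))"

definition mtop :: "('a, 'e::topological_space) atlas \<Rightarrow> 'a topology" where
  "mtop A = topology (mopen A)"

lemma istopology_mopen:
  assumes "\<And>U \<phi>. (U, \<phi>) \<in> A \<Longrightarrow> inj_on \<phi> U"
  shows "istopology (mopen A)"
  unfolding istopology_def
proof (intro conjI allI impI)
  fix S T assume S: "mopen A S" and T: "mopen A T"
  have "open (\<phi> ` (S \<inter> T \<inter> U))" if c: "(U, \<phi>) \<in> A" for U \<phi>
  proof -
    have "\<phi> ` ((S \<inter> U) \<inter> (T \<inter> U)) = \<phi> ` (S \<inter> U) \<inter> \<phi> ` (T \<inter> U)"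
      by (rule inj_on_image_Int[OF assms[OF c]]) auto
    moreover have "S \<inter> T \<inter> U = (S \<inter> U) \<inter> (T \<inter> U)" by auto
    ultimately show ?thesis
      using S T c by (fastforce simp: mopen_def)
  qed
  then show "mopen A (S \<inter> T)"
    using S by (auto simp: mopen_def)
next
  fix K assume K: "\<forall>S\<in>K. mopen A S"
  have "open (\<phi> ` (\<Union>K \<inter> U))" if c: "(U, \<phi>) \<in> A" for U \<phi>
  proof -
    have "\<phi> ` (\<Union>K \<inter> U) = (\<Union>S\<in>K. \<phi> ` (S \<inter> U))" by auto
    moreover have "open (\<phi> ` (S \<inter> U))" if "S \<in> K" for S
      using K that c by (fastforce simp: mopen_def)
    ultimately show ?thesis by auto
  qed
  then show "mopen A (\<Union>K)"
    using K by (auto simp: mopen_def)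
qed

definition smooth_atlas :: "('a, 'e::euclidean_space) atlas \<Rightarrow> bool" where
  "smooth_atlas A \<longleftrightarrow>
     (\<forall>(U, \<phi>)\<in>A. inj_on \<phi> U \<and> open (\<phi> ` U)) \<and>
     (\<forall>(U, \<phi>)\<in>A. \<forall>(V, \<psi>)\<in>A.
        open (\<phi> ` (U \<inter> V)) \<and> smooth_on (\<phi> ` (U \<inter> V)) (\<psi> \<circ> inv_into U \<phi>))"

definition smooth_manifold :: "('a, 'e::euclidean_space) atlas \<Rightarrow> bool" where
  "smooth_manifold A \<longleftrightarrow>
     smooth_atlas A \<and> Hausdorff_space (mtop A) \<and> second_countable (mtop A)"

definition smooth_map ::
  "('a, 'e::euclidean_space) atlas \<Rightarrow> ('b, 'f::euclidean_space) atlas \<Rightarrow> ('a \<Rightarrow> 'b) \<Rightarrow> bool" where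
  "smooth_map A B f \<longleftrightarrow>
     continuous_map (mtop A) (mtop B) f \<and>
     (\<forall>(U, \<phi>)\<in>A. \<forall>(V, \<psi>)\<in>B. smooth_on (\<phi> ` (U \<inter> f -` V)) (\<psi> \<circ> f \<circ> inv_into U \<phi>))"

definition real_atlas :: "(real, real) atlas" where
  "real_atlas = {(UNIV, id)}"

definition smooth_fun :: "('a, 'e::euclidean_space) atlas \<Rightarrow> ('a \<Rightarrow> real) \<Rightarrow> bool" where
  "smooth_fun A f \<longleftrightarrow> smooth_map A real_atlas f"

definition prod_atlas :: "('a, 'e) atlas \<Rightarrow> ('b, 'f) atlas \<Rightarrow> ('a \<times> 'b, 'e \<times> 'f) atlas" where
  "prod_atlas A B = {(U \<times> V, map_prod \<phi> \<psi>) | U \<phi> V \<psi>. (U, \<phi>) \<in> A \<and> (V, \<psi>) \<in> B}"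


section \<open>Tangent vectors and the tangent bundle\<close>

text \<open>A tangent vector is a base point together with the family of its components in all charts
  around that point, subject to the usual transformation law. Components with respect to the
  other charts are set to 0, so that equality of tangent vectors is equality in HOL.\<close>

type_synonym ('a, 'e) tvec = "'a \<times> (('a, 'e) chart \<Rightarrow> 'e)"
type_synonym ('a, 'e) vfield = "'a \<Rightarrow> ('a, 'e) tvec"

definition chart_around :: "('a, 'e) atlas \<Rightarrow> 'a \<Rightarrow> ('a, 'e) chart \<Rightarrow> bool" where
  "chart_around A p c \<longleftrightarrow> c \<in> A \<and> p \<in> fst c"

definition tspace :: "('a, 'e::euclidean_space) atlas \<Rightarrow> 'a \<Rightarrow> ('a, 'e) tvec set" where
  "tspace A p =
     {(p, v) | v.
        (\<forall>c d. chart_around A p c \<and> chart_around A p d \<longrightarrow>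
           v d = frechet_derivative (snd d \<circ> inv_into (fst c) (snd c)) (at (snd c p)) (v c)) \<and>
        (\<forall>c. \<not> chart_around A p c \<longrightarrow> v c = 0)}"

definition tbundle :: "('a, 'e::euclidean_space) atlas \<Rightarrow> ('a, 'e) tvec set" where
  "tbundle A = (\<Union>p\<in>mcarrier A. tspace A p)"

definition tbundle_atlas ::
  "('a, 'e::euclidean_space) atlas \<Rightarrow> (('a, 'e) tvec, 'e \<times> 'e) atlas" where
  "tbundle_atlas A =
     {({u \<in> tbundle A. fst u \<in> U}, \<lambda>u. (\<phi> (fst u), snd u (U, \<phi>))) | U \<phi>. (U, \<phi>) \<in> A}"

definition tzero :: "'a \<Rightarrow> ('a, 'e::real_vector) tvec" where
  "tzero p = (p, \<lambda>c. 0)"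

text \<open>Sums are only meant for vectors with the same base point.\<close>

definition tadd :: "('a, 'e::real_vector) tvec \<Rightarrow> ('a, 'e) tvec \<Rightarrow> ('a, 'e) tvec" where
  "tadd v w = (fst v, \<lambda>c. snd v c + snd w c)"

definition tscale :: "real \<Rightarrow> ('a, 'e::real_vector) tvec \<Rightarrow> ('a, 'e) tvec" where
  "tscale r v = (fst v, \<lambda>c. r *\<^sub>R snd v c)"

definition tminus :: "('a, 'e::real_vector) tvec \<Rightarrow> ('a, 'e) tvec \<Rightarrow> ('a, 'e) tvec" where
  "tminus v w = tadd v (tscale (-1) w)"

text \<open>The tangent map \<open>T f\<close>; it does not depend on the chart chosen around the base point.\<close>

definition tmap ::
  "('a, 'e::euclidean_space) atlas \<Rightarrow> ('b, 'f::euclidean_space) atlas \<Rightarrow> ('a \<Rightarrow> 'b) \<Rightarrow>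
   ('a, 'e) tvec \<Rightarrow> ('b, 'f) tvec" where
  "tmap A B f v =
     (let p = fst v; c = (SOME c. chart_around A p c)
      in (f p, \<lambda>d. if chart_around B (f p) d
                   then frechet_derivative (snd d \<circ> f \<circ> inv_into (fst c) (snd c))
                          (at (snd c p)) (snd v c)
                   else 0))"

text \<open>The velocity at time 0 of a curve.\<close>

definition velocity :: "('a, 'e::euclidean_space) atlas \<Rightarrow> (real \<Rightarrow> 'a) \<Rightarrow> ('a, 'e) tvec" where
  "velocity A \<gamma> =
     (\<gamma> 0, \<lambda>c. if chart_around A (\<gamma> 0) c then vector_derivative (snd c \<circ> \<gamma>) (at 0) else 0)"

definition linear_on_tspace ::
  "('a, 'e::euclidean_space) atlas \<Rightarrow> 'a \<Rightarrow> (('a, 'e) tvec \<Rightarrow> ('b, 'f::real_vector) tvec) \<Rightarrow> bool"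
  where
  "linear_on_tspace A p L \<longleftrightarrow>
     (\<forall>v\<in>tspace A p. \<forall>w\<in>tspace A p. L (tadd v w) = tadd (L v) (L w)) \<and>
     (\<forall>r. \<forall>v\<in>tspace A p. L (tscale r v) = tscale r (L v))"

text \<open>Linear isomorphisms from \<open>T\<^sub>pM\<close> onto the model space. They are the charts of the
  standard manifold structure of the vector space \<open>T\<^sub>pM\<close>.\<close>

definition tspace_iso ::
  "('a, 'e::euclidean_space) atlas \<Rightarrow> 'a \<Rightarrow> (('a, 'e) tvec \<Rightarrow> 'e) \<Rightarrow> bool" where
  "tspace_iso A p \<phi> \<longleftrightarrow>
     bij_betw \<phi> (tspace A p) UNIV \<and>
     (\<forall>v\<in>tspace A p. \<forall>w\<in>tspace A p. \<phi> (tadd v w) = \<phi> v + \<phi> w) \<and>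
     (\<forall>r. \<forall>v\<in>tspace A p. \<phi> (tscale r v) = r *\<^sub>R \<phi> v)"

definition tspace_atlas ::
  "('a, 'e::euclidean_space) atlas \<Rightarrow> 'a \<Rightarrow> (('a, 'e) tvec, 'e) atlas" where
  "tspace_atlas A p = {(tspace A p, \<phi>) | \<phi>. tspace_iso A p \<phi>}"

definition GL_tspace ::
  "('a, 'e::euclidean_space) atlas \<Rightarrow> 'a \<Rightarrow> (('a, 'e) tvec \<Rightarrow> ('a, 'e) tvec) monoid" where
  "GL_tspace A p =
     \<lparr>carrier = {F \<in> extensional (tspace A p).
                  bij_betw F (tspace A p) (tspace A p) \<and> linear_on_tspace A p F},
      mult = compose (tspace A p),
      one = (\<lambda>v\<in>tspace A p. v)\<rparr>"

text \<open>The manifold structure of \<open>GL(T\<^sub>pM)\<close> as an open subset of \<open>End(T\<^sub>pM)\<close>: the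
  coordinates of an automorphism are its matrix entries.\<close>

definition GL_atlas ::
  "('a, real^'n) atlas \<Rightarrow> 'a \<Rightarrow> (('a, real^'n) tvec \<Rightarrow> ('a, real^'n) tvec, real^'n^'n) atlas" where
  "GL_atlas A p =
     {(carrier (GL_tspace A p), \<lambda>F. matrix (\<phi> \<circ> F \<circ> inv_into (tspace A p) \<phi>)) | \<phi>.
        tspace_iso A p \<phi>}"


section \<open>Vector fields, tensor fields and affine connections\<close>

definition vfields :: "('a, 'e::euclidean_space) atlas \<Rightarrow> ('a, 'e) vfield set" where
  "vfields A =
     {X \<in> extensional (mcarrier A).
        (\<forall>p\<in>mcarrier A. X p \<in> tspace A p) \<and> smooth_map A (tbundle_atlas A) X}"

definition vf_zero :: "('a, 'e::euclidean_space) atlas \<Rightarrow> ('a, 'e) vfield" where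
  "vf_zero A = (\<lambda>p\<in>mcarrier A. tzero p)"

definition vf_add ::
  "('a, 'e::euclidean_space) atlas \<Rightarrow> ('a, 'e) vfield \<Rightarrow> ('a, 'e) vfield \<Rightarrow> ('a, 'e) vfield" where
  "vf_add A X Y = (\<lambda>p\<in>mcarrier A. tadd (X p) (Y p))"

definition vf_minus ::
  "('a, 'e::euclidean_space) atlas \<Rightarrow> ('a, 'e) vfield \<Rightarrow> ('a, 'e) vfield \<Rightarrow> ('a, 'e) vfield" where
  "vf_minus A X Y = (\<lambda>p\<in>mcarrier A. tminus (X p) (Y p))"

definition vf_scale ::
  "('a, 'e::euclidean_space) atlas \<Rightarrow> ('a \<Rightarrow> real) \<Rightarrow> ('a, 'e) vfield \<Rightarrow> ('a, 'e) vfield" where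
  "vf_scale A f X = (\<lambda>p\<in>mcarrier A. tscale (f p) (X p))"

text \<open>The function \<open>X(f)\<close>.\<close>

definition vf_deriv ::
  "('a, 'e::euclidean_space) atlas \<Rightarrow> ('a, 'e) vfield \<Rightarrow> ('a \<Rightarrow> real) \<Rightarrow> 'a \<Rightarrow> real" where
  "vf_deriv A X f p = snd (tmap A real_atlas f (X p)) (UNIV, id)"

definition vf_local ::
  "('a, 'e) chart \<Rightarrow> ('a, 'e) vfield \<Rightarrow> 'e \<Rightarrow> 'e" where
  "vf_local c X x = snd (X (inv_into (fst c) (snd c) x)) c"

text \<open>In local coordinates, \<open>[X,Y] = DY(X) - DX(Y)\<close>.\<close>

definition vf_bracket ::
  "('a, 'e::euclidean_space) atlas \<Rightarrow> ('a, 'e) vfield \<Rightarrow> ('a, 'e) vfield \<Rightarrow> ('a, 'e) vfield" where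
  "vf_bracket A X Y =
     (\<lambda>p\<in>mcarrier A. (p, \<lambda>c.
        if chart_around A p c
        then frechet_derivative (vf_local c Y) (at (snd c p)) (snd (X p) c)
           - frechet_derivative (vf_local c X) (at (snd c p)) (snd (Y p) c)
        else 0))"

text \<open>Push-forward of a vector field by a diffeomorphism.\<close>

definition push ::
  "('a, 'e::euclidean_space) atlas \<Rightarrow> ('b, 'f::euclidean_space) atlas \<Rightarrow> ('a \<Rightarrow> 'b) \<Rightarrow>
   ('a, 'e) vfield \<Rightarrow> ('b, 'f) vfield" where
  "push A B F X = (\<lambda>q\<in>mcarrier B. tmap A B F (X (inv_into (mcarrier A) F q)))"

definition riemannian_metric ::
  "('a, 'e::euclidean_space) atlas \<Rightarrow> (('a, 'e) tvec \<Rightarrow> ('a, 'e) tvec \<Rightarrow> real) \<Rightarrow> bool" where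
  "riemannian_metric A g \<longleftrightarrow>
     (\<forall>p\<in>mcarrier A.
        (\<forall>u\<in>tspace A p. \<forall>v\<in>tspace A p. \<forall>w\<in>tspace A p. g (tadd u v) w = g u w + g v w) \<and>
        (\<forall>r. \<forall>v\<in>tspace A p. \<forall>w\<in>tspace A p. g (tscale r v) w = r * g v w) \<and>
        (\<forall>v\<in>tspace A p. \<forall>w\<in>tspace A p. g v w = g w v) \<and>
        (\<forall>v\<in>tspace A p. v \<noteq> tzero p \<longrightarrow> g v v > 0)) \<and>
     (\<forall>X\<in>vfields A. \<forall>Y\<in>vfields A. smooth_fun A (\<lambda>p. g (X p) (Y p)))"

definition vf_apply ::
  "('a, 'e::euclidean_space) atlas \<Rightarrow> (('a, 'e) tvec \<Rightarrow> ('a, 'e) tvec) \<Rightarrow>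
   ('a, 'e) vfield \<Rightarrow> ('a, 'e) vfield" where
  "vf_apply A J X = (\<lambda>p\<in>mcarrier A. J (X p))"

definition endo_field ::
  "('a, 'e::euclidean_space) atlas \<Rightarrow> (('a, 'e) tvec \<Rightarrow> ('a, 'e) tvec) \<Rightarrow> bool" where
  "endo_field A J \<longleftrightarrow>
     (\<forall>p\<in>mcarrier A. J ` tspace A p \<subseteq> tspace A p \<and> linear_on_tspace A p J) \<and>
     (\<forall>X\<in>vfields A. vf_apply A J X \<in> vfields A)"

definition affine_connection ::
  "('a, 'e::euclidean_space) atlas \<Rightarrow>
   (('a, 'e) vfield \<Rightarrow> ('a, 'e) vfield \<Rightarrow> ('a, 'e) vfield) \<Rightarrow> bool" where
  "affine_connection A D \<longleftrightarrow>
     (\<forall>X\<in>vfields A. \<forall>Y\<in>vfields A. D X Y \<in> vfields A) \<and>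
     (\<forall>X\<in>vfields A. \<forall>X'\<in>vfields A. \<forall>Y\<in>vfields A.
        D (vf_add A X X') Y = vf_add A (D X Y) (D X' Y)) \<and>
     (\<forall>f. \<forall>X\<in>vfields A. \<forall>Y\<in>vfields A. smooth_fun A f \<longrightarrow>
        D (vf_scale A f X) Y = vf_scale A f (D X Y)) \<and>
     (\<forall>X\<in>vfields A. \<forall>Y\<in>vfields A. \<forall>Y'\<in>vfields A.
        D X (vf_add A Y Y') = vf_add A (D X Y) (D X Y')) \<and>
     (\<forall>f. \<forall>X\<in>vfields A. \<forall>Y\<in>vfields A. smooth_fun A f \<longrightarrow>
        D X (vf_scale A f Y) = vf_add A (vf_scale A (vf_deriv A X f) Y) (vf_scale A f (D X Y)))"

definition torsionless ::
  "('a, 'e::euclidean_space) atlas \<Rightarrow>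
   (('a, 'e) vfield \<Rightarrow> ('a, 'e) vfield \<Rightarrow> ('a, 'e) vfield) \<Rightarrow> bool" where
  "torsionless A D \<longleftrightarrow>
     (\<forall>X\<in>vfields A. \<forall>Y\<in>vfields A. vf_minus A (D X Y) (D Y X) = vf_bracket A X Y)"

definition flat ::
  "('a, 'e::euclidean_space) atlas \<Rightarrow>
   (('a, 'e) vfield \<Rightarrow> ('a, 'e) vfield \<Rightarrow> ('a, 'e) vfield) \<Rightarrow> bool" where
  "flat A D \<longleftrightarrow>
     (\<forall>X\<in>vfields A. \<forall>Y\<in>vfields A. \<forall>Z\<in>vfields A.
        vf_minus A (vf_minus A (D X (D Y Z)) (D Y (D X Z))) (D (vf_bracket A X Y) Z) = vf_zero A)"


section \<open>The canonical structure on a tangent bundle\<close>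

text \<open>The image of \<open>w \<in> T\<^sub>pM\<close> under the canonical isomorphism of \<open>T\<^sub>pM\<close> onto the vertical
  subspace of \<open>T\<^sub>u(TM)\<close>, for \<open>u \<in> T\<^sub>pM\<close>.\<close>

definition vert ::
  "('a, 'e::euclidean_space) atlas \<Rightarrow> ('a, 'e) tvec \<Rightarrow> ('a, 'e) tvec \<Rightarrow>
   (('a, 'e) tvec, 'e \<times> 'e) tvec" where
  "vert A u w = velocity (tbundle_atlas A) (\<lambda>t. tadd u (tscale t w))"

definition vlift ::
  "('a, 'e::euclidean_space) atlas \<Rightarrow> ('a, 'e) vfield \<Rightarrow> (('a, 'e) tvec, 'e \<times> 'e) vfield" where
  "vlift A X = (\<lambda>u\<in>tbundle A. vert A u (X (fst u)))"

text \<open>The horizontal subspace of a connection is the kernel of its connection map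
  \<open>K : TTM \<rightarrow> TM\<close>, which is linear on fibres and determined by \<open>K (T\<^sub>pY (X\<^sub>p)) = (D X Y)\<^sub>p\<close> and
  \<open>K (vert u w) = w\<close>. Thus \<open>\<xi> \<in> T\<^sub>u(TM)\<close> projecting to \<open>X\<^sub>p\<close> is horizontal iff
  \<open>\<xi> = T\<^sub>pY (X\<^sub>p) - vert u (D X Y)\<^sub>p\<close> for the vector fields \<open>Y\<close> with \<open>Y\<^sub>p = u\<close>.\<close>

definition horizontal ::
  "('a, 'e::euclidean_space) atlas \<Rightarrow>
   (('a, 'e) vfield \<Rightarrow> ('a, 'e) vfield \<Rightarrow> ('a, 'e) vfield) \<Rightarrow>
   (('a, 'e) tvec, 'e \<times> 'e) tvec \<Rightarrow> bool" where
  "horizontal A D \<xi> \<longleftrightarrow>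
     (let u = fst \<xi>; p = fst u in
      \<forall>X\<in>vfields A. \<forall>Y\<in>vfields A.
        X p = tmap (tbundle_atlas A) A fst \<xi> \<and> Y p = u \<longrightarrow>
        \<xi> = tminus (tmap A (tbundle_atlas A) Y (X p)) (vert A u (D X Y p)))"

definition hlift ::
  "('a, 'e::euclidean_space) atlas \<Rightarrow>
   (('a, 'e) vfield \<Rightarrow> ('a, 'e) vfield \<Rightarrow> ('a, 'e) vfield) \<Rightarrow>
   ('a, 'e) vfield \<Rightarrow> (('a, 'e) tvec, 'e \<times> 'e) vfield" where
  "hlift A D X =
     (\<lambda>u\<in>tbundle A. THE \<xi>. \<xi> \<in> tspace (tbundle_atlas A) u \<and> horizontal A D \<xi> \<and>
                          tmap (tbundle_atlas A) A fst \<xi> = X (fst u))"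

definition canonical_complex_structure ::
  "('a, 'e::euclidean_space) atlas \<Rightarrow>
   (('a, 'e) vfield \<Rightarrow> ('a, 'e) vfield \<Rightarrow> ('a, 'e) vfield) \<Rightarrow>
   ((('a, 'e) tvec, 'e \<times> 'e) tvec \<Rightarrow> (('a, 'e) tvec, 'e \<times> 'e) tvec) \<Rightarrow> bool" where
  "canonical_complex_structure A D J \<longleftrightarrow>
     endo_field (tbundle_atlas A) J \<and>
     (\<forall>X\<in>vfields A.
        vf_apply (tbundle_atlas A) J (hlift A D X) = vlift A X \<and>
        vf_apply (tbundle_atlas A) J (vlift A X) =
          vf_scale (tbundle_atlas A) (\<lambda>_. -1) (hlift A D X))"

definition canonical_metric ::
  "('a, 'e::euclidean_space) atlas \<Rightarrow>
   (('a, 'e) vfield \<Rightarrow> ('a, 'e) vfield \<Rightarrow> ('a, 'e) vfield) \<Rightarrow>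
   (('a, 'e) tvec \<Rightarrow> ('a, 'e) tvec \<Rightarrow> real) \<Rightarrow>
   ((('a, 'e) tvec, 'e \<times> 'e) tvec \<Rightarrow> (('a, 'e) tvec, 'e \<times> 'e) tvec \<Rightarrow> real) \<Rightarrow> bool" where
  "canonical_metric A D g g1 \<longleftrightarrow>
     riemannian_metric (tbundle_atlas A) g1 \<and>
     (\<forall>X\<in>vfields A. \<forall>Y\<in>vfields A. \<forall>u\<in>tbundle A.
        g1 (hlift A D X u) (hlift A D Y u) = g (X (fst u)) (Y (fst u)) \<and>
        g1 (vlift A X u) (vlift A Y u) = g (X (fst u)) (Y (fst u)) \<and>
        g1 (hlift A D X u) (vlift A Y u) = 0)"

definition canonical_connection ::
  "('a, 'e::euclidean_space) atlas \<Rightarrow>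
   (('a, 'e) vfield \<Rightarrow> ('a, 'e) vfield \<Rightarrow> ('a, 'e) vfield) \<Rightarrow>
   ((('a, 'e) tvec, 'e \<times> 'e) vfield \<Rightarrow> (('a, 'e) tvec, 'e \<times> 'e) vfield \<Rightarrow>
    (('a, 'e) tvec, 'e \<times> 'e) vfield) \<Rightarrow> bool" where
  "canonical_connection A D D1 \<longleftrightarrow>
     affine_connection (tbundle_atlas A) D1 \<and>
     (\<forall>X\<in>vfields A. \<forall>Y\<in>vfields A.
        D1 (hlift A D X) (hlift A D Y) = hlift A D (D X Y) \<and>
        D1 (hlift A D X) (vlift A Y) = vlift A (D X Y) \<and>
        D1 (vlift A X) (hlift A D Y) = vf_zero (tbundle_atlas A) \<and>
        D1 (vlift A X) (vlift A Y) = vf_zero (tbundle_atlas A))"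


section \<open>Lie groups\<close>

definition lie_group :: "('a, 'm) monoid_scheme \<Rightarrow> ('a, 'e::euclidean_space) atlas \<Rightarrow> bool" where
  "lie_group G A \<longleftrightarrow>
     group G \<and> smooth_manifold A \<and> carrier G = mcarrier A \<and>
     smooth_map (prod_atlas A A) A (\<lambda>(p, q). p \<otimes>\<^bsub>G\<^esub> q) \<and>
     smooth_map A A (\<lambda>p. inv\<^bsub>G\<^esub> p)"

definition ltrans :: "('a, 'm) monoid_scheme \<Rightarrow> 'a \<Rightarrow> 'a \<Rightarrow> 'a" where
  "ltrans G q = (\<lambda>p. q \<otimes>\<^bsub>G\<^esub> p)"

definition lie_alg ::
  "('a, 'm) monoid_scheme \<Rightarrow> ('a, 'e::euclidean_space) atlas \<Rightarrow> ('a, 'e) tvec set" where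
  "lie_alg G A = tspace A \<one>\<^bsub>G\<^esub>"

definition linv_field ::
  "('a, 'm) monoid_scheme \<Rightarrow> ('a, 'e::euclidean_space) atlas \<Rightarrow> ('a, 'e) tvec \<Rightarrow> ('a, 'e) vfield"
  where
  "linv_field G A a = (\<lambda>p\<in>mcarrier A. tmap A A (ltrans G p) a)"

definition left_invariant_connection ::
  "('a, 'm) monoid_scheme \<Rightarrow> ('a, 'e::euclidean_space) atlas \<Rightarrow>
   (('a, 'e) vfield \<Rightarrow> ('a, 'e) vfield \<Rightarrow> ('a, 'e) vfield) \<Rightarrow> bool" where
  "left_invariant_connection G A D \<longleftrightarrow>
     (\<forall>q\<in>carrier G. \<forall>X\<in>vfields A. \<forall>Y\<in>vfields A.
        push A A (ltrans G q) (D X Y) =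
        D (push A A (ltrans G q) X) (push A A (ltrans G q) Y))"

definition left_invariant_metric ::
  "('a, 'm) monoid_scheme \<Rightarrow> ('a, 'e::euclidean_space) atlas \<Rightarrow>
   (('a, 'e) tvec \<Rightarrow> ('a, 'e) tvec \<Rightarrow> real) \<Rightarrow> bool" where
  "left_invariant_metric G A g \<longleftrightarrow>
     (\<forall>q\<in>carrier G. \<forall>p\<in>carrier G. \<forall>v\<in>tspace A p. \<forall>w\<in>tspace A p.
        g (tmap A A (ltrans G q) v) (tmap A A (ltrans G q) w) = g v w)"

text \<open>The product \<open>a \<bullet> b\<close> on the Lie algebra.\<close>

definition lie_prod ::
  "('a, 'm) monoid_scheme \<Rightarrow> ('a, 'e::euclidean_space) atlas \<Rightarrow>
   (('a, 'e) vfield \<Rightarrow> ('a, 'e) vfield \<Rightarrow> ('a, 'e) vfield) \<Rightarrow>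
   ('a, 'e) tvec \<Rightarrow> ('a, 'e) tvec \<Rightarrow> ('a, 'e) tvec" where
  "lie_prod G A D a b = D (linv_field G A a) (linv_field G A b) \<one>\<^bsub>G\<^esub>"

text \<open>\<open>\<rho>\<close> is a homomorphism of Lie groups from \<open>G\<close> to \<open>GL(T\<^sub>eG)\<close> with \<open>d\<^sub>e\<rho> = L\<close>, where
  \<open>L\<^sub>a b = a \<bullet> b\<close>. An endomorphism \<open>F\<close> is viewed as an element of the tangent space of
  \<open>GL(T\<^sub>eG)\<close> at the identity as the velocity of \<open>t \<mapsto> Id + t F\<close>.\<close>

definition integrates_left_mult ::
  "('a, 'm) monoid_scheme \<Rightarrow> ('a, real^'n) atlas \<Rightarrow>
   (('a, real^'n) vfield \<Rightarrow> ('a, real^'n) vfield \<Rightarrow> ('a, real^'n) vfield) \<Rightarrow>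
   ('a \<Rightarrow> ('a, real^'n) tvec \<Rightarrow> ('a, real^'n) tvec) \<Rightarrow> bool" where
  "integrates_left_mult G A D \<rho> \<longleftrightarrow>
     \<rho> \<in> hom G (GL_tspace A \<one>\<^bsub>G\<^esub>) \<and>
     smooth_map A (GL_atlas A \<one>\<^bsub>G\<^esub>) \<rho> \<and>
     (\<forall>a\<in>lie_alg G A.
        tmap A (GL_atlas A \<one>\<^bsub>G\<^esub>) \<rho> a =
        velocity (GL_atlas A \<one>\<^bsub>G\<^esub>)
          (\<lambda>t. \<lambda>b\<in>lie_alg G A. tadd b (tscale t (lie_prod G A D a b))))"


section \<open>The Lie group \<open>G \<times> T\<^sub>eG\<close>\<close>

definition semi_group ::
  "('a, 'm) monoid_scheme \<Rightarrow> ('a, 'e::euclidean_space) atlas \<Rightarrow>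
   ('a \<Rightarrow> ('a, 'e) tvec \<Rightarrow> ('a, 'e) tvec) \<Rightarrow> ('a \<times> ('a, 'e) tvec) monoid" where
  "semi_group G A \<rho> =
     \<lparr>carrier = carrier G \<times> lie_alg G A,
      mult = (\<lambda>(p, a) (q, b). (p \<otimes>\<^bsub>G\<^esub> q, tadd b (\<rho> (inv\<^bsub>G\<^esub> q) a))),
      one = (\<one>\<^bsub>G\<^esub>, tzero \<one>\<^bsub>G\<^esub>)\<rparr>"

definition semi_atlas ::
  "('a, 'm) monoid_scheme \<Rightarrow> ('a, 'e::euclidean_space) atlas \<Rightarrow>
   ('a \<times> ('a, 'e) tvec, 'e \<times> 'e) atlas" where
  "semi_atlas G A = prod_atlas A (tspace_atlas A \<one>\<^bsub>G\<^esub>)"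

text \<open>The pair \<open>(a, b)\<close> as an element of \<open>T\<^sub>eG \<times> T\<^sub>0(T\<^sub>eG)\<close>, the tangent space of
  \<open>G \<times> T\<^sub>eG\<close> at its neutral element.\<close>

definition phi_vec ::
  "('a, 'm) monoid_scheme \<Rightarrow> ('a, 'e::euclidean_space) atlas \<Rightarrow>
   ('a, 'e) tvec \<Rightarrow> ('a, 'e) tvec \<Rightarrow> ('a \<times> ('a, 'e) tvec, 'e \<times> 'e) tvec" where
  "phi_vec G A a b =
     tadd (tmap A (semi_atlas G A) (\<lambda>q. (q, tzero \<one>\<^bsub>G\<^esub>)) a)
          (velocity (semi_atlas G A) (\<lambda>t. (\<one>\<^bsub>G\<^esub>, tscale t b)))"

definition phi_field ::
  "('a, 'm) monoid_scheme \<Rightarrow> ('a, 'e::euclidean_space) atlas \<Rightarrow>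
   ('a \<Rightarrow> ('a, 'e) tvec \<Rightarrow> ('a, 'e) tvec) \<Rightarrow>
   ('a, 'e) tvec \<Rightarrow> ('a, 'e) tvec \<Rightarrow> ('a \<times> ('a, 'e) tvec, 'e \<times> 'e) vfield" where
  "phi_field G A \<rho> a b = linv_field (semi_group G A \<rho>) (semi_atlas G A) (phi_vec G A a b)"

definition left_invariant_J0 ::
  "('a, 'm) monoid_scheme \<Rightarrow> ('a, 'e::euclidean_space) atlas \<Rightarrow>
   ('a \<Rightarrow> ('a, 'e) tvec \<Rightarrow> ('a, 'e) tvec) \<Rightarrow>
   (('a \<times> ('a, 'e) tvec, 'e \<times> 'e) tvec \<Rightarrow> ('a \<times> ('a, 'e) tvec, 'e \<times> 'e) tvec) \<Rightarrow> bool" where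
  "left_invariant_J0 G A \<rho> J0 \<longleftrightarrow>
     endo_field (semi_atlas G A) J0 \<and>
     (\<forall>a\<in>lie_alg G A. \<forall>b\<in>lie_alg G A.
        vf_apply (semi_atlas G A) J0 (phi_field G A \<rho> a b) =
        phi_field G A \<rho> (tscale (-1) b) a)"

definition left_invariant_g0 ::
  "('a, 'm) monoid_scheme \<Rightarrow> ('a, 'e::euclidean_space) atlas \<Rightarrow>
   ('a \<Rightarrow> ('a, 'e) tvec \<Rightarrow> ('a, 'e) tvec) \<Rightarrow>
   (('a, 'e) tvec \<Rightarrow> ('a, 'e) tvec \<Rightarrow> real) \<Rightarrow>
   (('a \<times> ('a, 'e) tvec, 'e \<times> 'e) tvec \<Rightarrow> ('a \<times> ('a, 'e) tvec, 'e \<times> 'e) tvec \<Rightarrow> real) \<Rightarrow>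
   bool" where
  "left_invariant_g0 G A \<rho> g g0 \<longleftrightarrow>
     riemannian_metric (semi_atlas G A) g0 \<and>
     (\<forall>a\<in>lie_alg G A. \<forall>b\<in>lie_alg G A. \<forall>c\<in>lie_alg G A. \<forall>d\<in>lie_alg G A.
      \<forall>x\<in>mcarrier (semi_atlas G A).
        g0 (phi_field G A \<rho> a b x) (phi_field G A \<rho> c d x) = g a c + g b d)"

definition left_invariant_D0 ::
  "('a, 'm) monoid_scheme \<Rightarrow> ('a, 'e::euclidean_space) atlas \<Rightarrow>
   ('a \<Rightarrow> ('a, 'e) tvec \<Rightarrow> ('a, 'e) tvec) \<Rightarrow>
   (('a, 'e) vfield \<Rightarrow> ('a, 'e) vfield \<Rightarrow> ('a, 'e) vfield) \<Rightarrow>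
   (('a \<times> ('a, 'e) tvec, 'e \<times> 'e) vfield \<Rightarrow> ('a \<times> ('a, 'e) tvec, 'e \<times> 'e) vfield \<Rightarrow>
    ('a \<times> ('a, 'e) tvec, 'e \<times> 'e) vfield) \<Rightarrow> bool" where
  "left_invariant_D0 G A \<rho> D D0 \<longleftrightarrow>
     affine_connection (semi_atlas G A) D0 \<and>
     (\<forall>a\<in>lie_alg G A. \<forall>b\<in>lie_alg G A. \<forall>c\<in>lie_alg G A. \<forall>d\<in>lie_alg G A.
        D0 (phi_field G A \<rho> a b) (phi_field G A \<rho> c d) =
        phi_field G A \<rho> (lie_prod G A D a c) (lie_prod G A D a d))"

definition Theta ::
  "('a, 'm) monoid_scheme \<Rightarrow> ('a, 'e::euclidean_space) atlas \<Rightarrow>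
   ('a, 'e) tvec \<Rightarrow> 'a \<times> ('a, 'e) tvec" where
  "Theta G A v = (fst v, tmap A A (ltrans G (inv\<^bsub>G\<^esub> (fst v))) v)"

definition Theta_push ::
  "('a, 'm) monoid_scheme \<Rightarrow> ('a, 'e::euclidean_space) atlas \<Rightarrow>
   (('a, 'e) tvec, 'e \<times> 'e) vfield \<Rightarrow> ('a \<times> ('a, 'e) tvec, 'e \<times> 'e) vfield" where
  "Theta_push G A X = push (tbundle_atlas A) (semi_atlas G A) (Theta G A) X"

end

theory Submission
  imports Defs
begin

text \<open>In the trivialisation \<open>\<Theta>\<close>, the left invariant field \<open>x\<^sup>-\<close> is the constant section \<open>p \<mapsto> (p, x)\<close>, and
  \<open>D a\<^sup>- x\<^sup>- = (a \<bullet> x)\<^sup>-\<close>. Hence the horizontal lift of \<open>a\<^sup>-\<close> at \<open>x\<^sup>-(p)\<close> is mapped to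
  \<open>(a\<^sup>-(p), - a \<bullet> x)\<close> and the vertical lift of \<open>b\<^sup>-\<close> to \<open>(0, b)\<close>. On the other hand, differentiating
  \<open>(p, x) \<cdot> (q, y) = (p q, y + \<rho>(q\<inverse>) x)\<close> at the neutral element shows that \<open>(a, b)\<^sup>-\<close> has the value
  \<open>(a\<^sup>-(p), b - a \<bullet> x)\<close> at \<open>(p, x)\<close>. So \<open>\<Theta>\<close> maps the global frame of lifts of left invariant fields
  to the left invariant frame, on which both structures are given by the same formulas; they are
  tensorial (respectively satisfy the same Leibniz rule), hence agree everywhere.\<close>

section \<open>Calculus of smooth maps\<close>

text \<open>Connections and push-forwards act on globally defined smooth fields, and
  \<open>horizontal\<close> tests a vector against all such fields through given values. Passing
  from global fields to pointwise data normally takes bump functions; here the global left invariant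
  frame takes their place. It supplies a field through every tangent vector, and every field is a
  combination of the frame with smooth coefficients, so that an operation linear over smooth
  functions is determined at a point by its argument there. This yields existence and uniqueness of
  horizontal lifts. Smoothness of the coefficients comes from the metrics: the Gram matrices of the
  left invariant fields under \<open>g\<close> and of their lifts under \<open>g1\<close> are
  constant, so the coefficients are constant combinations of inner products, which are smooth by the
  definition of a Riemannian metric. The same induction over sums and smooth multiples then works on
  G and on TG. Stated as a rule about predicates, it covers both arguments of a connection, the
  tensorial one and the one obeying the Leibniz rule.\<close>

lemma frechet_derivative_cong_open:
  assumes "open S" "x \<in> S" "\<And>y. y \<in> S \<Longrightarrow> f y = g y"
  shows "frechet_derivative f (at x) = frechet_derivative g (at x)"
proof -
  have "(f has_derivative f') (at x) \<longleftrightarrow> (g has_derivative f') (at x)" for f'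
    using assms has_derivative_transform_within_open[of f f' x UNIV S g]
      has_derivative_transform_within_open[of g f' x UNIV S f] by auto
  \<comment> \<open>\<open>frechet_derivative\<close> is a choice from the predicate
    \<open>has_derivative\<close>; equal predicates give equal choices, so differentiability is not
    assumed.\<close>
  then show ?thesis by (simp add: frechet_derivative_def)
qed

lemma differentiable_cong_open:
  assumes "open S" "x \<in> S" "\<And>y. y \<in> S \<Longrightarrow> f y = g y"
  shows "f differentiable (at x) \<longleftrightarrow> g differentiable (at x)"
  using assms has_derivative_transform_within_open[of f _ x UNIV S g]
      has_derivative_transform_within_open[of g _ x UNIV S f]
  unfolding differentiable_def by metis

lemma Ck_on_cong:
  assumes "open S" "\<And>x. x \<in> S \<Longrightarrow> f x = g x"
  shows "Ck_on k S f \<longleftrightarrow> Ck_on k S g"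
  using assms(2)
proof (induction k arbitrary: f g)
  case 0
  then show ?case by (simp cong: continuous_on_cong)
next
  case (Suc k)
  have "Ck_on k S (\<lambda>x. frechet_derivative f (at x) v) \<longleftrightarrow>
        Ck_on k S (\<lambda>x. frechet_derivative g (at x) v)" for v
    by (rule Suc.IH) (use frechet_derivative_cong_open[OF assms(1)] Suc.prems in metis)
  moreover have "(\<forall>x\<in>S. f differentiable (at x)) \<longleftrightarrow> (\<forall>x\<in>S. g differentiable (at x))"
    using differentiable_cong_open[OF assms(1)] Suc.prems by metis
  ultimately show ?case by simp
qed

lemma Ck_on_subset: "Ck_on k S f \<Longrightarrow> T \<subseteq> S \<Longrightarrow> Ck_on k T f"
proof (induction k arbitrary: f)
  case 0 then show ?case by (auto intro: continuous_on_subset)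
next
  case (Suc k) then show ?case by (simp add: subset_iff)
qed

lemma Ck_on_SucD: "Ck_on (Suc k) S f \<Longrightarrow> Ck_on k S f"
proof (induction k arbitrary: f)
  case 0
  then show ?case
    by (auto intro!: continuous_at_imp_continuous_on differentiable_imp_continuous_within)
next
  case (Suc k) then show ?case by (meson Ck_on.simps(2))
qed

lemma Ck_on_local:
  assumes "\<And>x. x \<in> S \<Longrightarrow> \<exists>T. open T \<and> x \<in> T \<and> Ck_on k T f"
  shows "Ck_on k S f"
  using assms
proof (induction k arbitrary: f)
  case 0
  have "isCont f x" if "x \<in> S" for x
    using 0[OF that] continuous_on_eq_continuous_at by (metis Ck_on.simps(1))
  then show ?case by (simp add: continuous_at_imp_continuous_on)
next
  case (Suc k)
  have "f differentiable (at x)" if "x \<in> S" for x using Suc.prems[OF that] by auto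
  moreover have "Ck_on k S (\<lambda>x. frechet_derivative f (at x) v)" for v
  proof (rule Suc.IH)
    fix x assume "x \<in> S"
    from Suc.prems[OF this] obtain T where "open T" "x \<in> T" "Ck_on (Suc k) T f" by blast
    then show "\<exists>T. open T \<and> x \<in> T \<and> Ck_on k T (\<lambda>x. frechet_derivative f (at x) v)" by auto
  qed
  ultimately show ?case by simp
qed

text \<open>Uniqueness of derivatives lets any explicit family \<open>f'\<close> stand for
  \<open>frechet_derivative f\<close>. The closure proofs below therefore only have to exhibit a
  formula for the derivative.\<close>

lemma Ck_on_SucI:
  assumes "open S" "\<And>x. x \<in> S \<Longrightarrow> (f has_derivative f' x) (at x)"
    and "\<And>v. Ck_on k S (\<lambda>x. f' x v)"
  shows "Ck_on (Suc k) S f"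
proof -
  have "frechet_derivative f (at x) = f' x" if "x \<in> S" for x
    using assms(2)[OF that] frechet_derivative_at by metis
  then have "Ck_on k S (\<lambda>x. frechet_derivative f (at x) v)" for v
    using assms(3)[of v] Ck_on_cong[OF assms(1), of "\<lambda>x. frechet_derivative f (at x) v"] by simp
  then show ?thesis using assms(2) by (auto simp: differentiable_def)
qed

lemma Ck_on_Suc_has_derivative:
  "Ck_on (Suc k) S f \<Longrightarrow> x \<in> S \<Longrightarrow> (f has_derivative frechet_derivative f (at x)) (at x)"
  by (simp add: frechet_derivative_works)

section \<open>Closure of C^k functions under linear, bilinear and composite operations\<close>

lemma Ck_on_const: "open S \<Longrightarrow> Ck_on k S (\<lambda>x. c)"
proof (induction k arbitrary: c)
  case (Suc k)
  show ?case
    by (rule Ck_on_SucI[OF Suc.prems, where f' = "\<lambda>x v. 0"]) (simp_all add: Suc)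
qed simp

lemma Ck_on_bounded_linear:
  assumes "open S" "bounded_linear L"
  shows "Ck_on k S L"
proof (cases k)
  case 0
  then show ?thesis using assms(2) by (simp add: linear_continuous_on)
next
  case (Suc j)
  show ?thesis unfolding Suc
    by (rule Ck_on_SucI[OF assms(1), where f' = "\<lambda>x. L"])
      (use assms in \<open>auto intro: bounded_linear_imp_has_derivative Ck_on_const\<close>)
qed

lemma Ck_on_add:
  assumes "open S"
  shows "Ck_on k S f \<Longrightarrow> Ck_on k S g \<Longrightarrow> Ck_on k S (\<lambda>x. f x + g x)"
proof (induction k arbitrary: f g)
  case 0 then show ?case by (auto intro: continuous_intros)
next
  case (Suc k)
  show ?case
  proof (rule Ck_on_SucI[OF assms])
    fix x assume "x \<in> S"
    then show "((\<lambda>x. f x + g x) has_derivative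
        (\<lambda>v. frechet_derivative f (at x) v + frechet_derivative g (at x) v)) (at x)"
      by (intro has_derivative_add Ck_on_Suc_has_derivative[OF Suc.prems(1)]
          Ck_on_Suc_has_derivative[OF Suc.prems(2)])
  next
    fix v
    show "Ck_on k S (\<lambda>x. frechet_derivative f (at x) v + frechet_derivative g (at x) v)"
      by (rule Suc.IH) (use Suc.prems in simp_all)
  qed
qed

text \<open>The product rule gives terms that pair a function with a derivative of the other one.
  The function is C^(k+1) and is lowered to C^k, so the induction hypothesis for arbitrary pairs
  applies.\<close>

lemma Ck_on_bilinear:
  assumes "open S" "bounded_bilinear b"
  shows "Ck_on k S f \<Longrightarrow> Ck_on k S g \<Longrightarrow> Ck_on k S (\<lambda>x. b (f x) (g x))"
proof (induction k arbitrary: f g)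
  case 0 then show ?case by (auto intro: bounded_bilinear.continuous_on[OF assms(2)])
next
  case (Suc k)
  show ?case
  proof (rule Ck_on_SucI[OF assms(1)])
    fix x assume "x \<in> S"
    then show "((\<lambda>x. b (f x) (g x)) has_derivative
       (\<lambda>v. b (f x) (frechet_derivative g (at x) v) + b (frechet_derivative f (at x) v) (g x))) (at x)"
      using Suc.prems by (intro bounded_bilinear.FDERIV[OF assms(2)] Ck_on_Suc_has_derivative)
  next
    fix v
    show "Ck_on k S (\<lambda>x. b (f x) (frechet_derivative g (at x) v) + b (frechet_derivative f (at x) v) (g x))"
      by (intro Ck_on_add[OF assms(1)] Suc.IH Ck_on_SucD[OF Suc.prems(1)] Ck_on_SucD[OF Suc.prems(2)])
        (use Suc.prems in simp_all)
  qed
qed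

lemma Ck_on_sum:
  assumes "open S" "\<And>i. i \<in> I \<Longrightarrow> Ck_on k S (f i)"
  shows "Ck_on k S (\<lambda>x. \<Sum>i\<in>I. f i x)"
  using assms(2)
proof (induction I rule: infinite_finite_induct)
  case (insert i I)
  then show ?case by (simp add: Ck_on_add[OF assms(1)])
qed (simp_all add: Ck_on_const[OF assms(1)])

lemma linear_Basis_expansion:
  fixes L :: "'e::euclidean_space \<Rightarrow> 'f::real_vector"
  assumes "linear L"
  shows "L v = (\<Sum>b\<in>Basis. (v \<bullet> b) *\<^sub>R L b)"
proof -
  have "L v = L (\<Sum>b\<in>Basis. (v \<bullet> b) *\<^sub>R b)" by (simp add: euclidean_representation)
  also have "\<dots> = (\<Sum>b\<in>Basis. (v \<bullet> b) *\<^sub>R L b)"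
    using assms by (simp add: linear_sum linear_cmul)
  finally show ?thesis .
qed

text \<open>The definition of \<open>Ck_on\<close> controls the derivative in fixed directions only,
  whereas the chain rule differentiates \<open>g\<close> in the direction f'(x) v, which moves with
  x. Expanding that direction in \<open>Basis\<close> restores fixed directions with C^k
  coefficients; this is where the intermediate space has to be Euclidean.\<close>

lemma Ck_on_compose:
  fixes f :: "'e::real_normed_vector \<Rightarrow> 'f::euclidean_space" and g :: "'f \<Rightarrow> 'h::real_normed_vector"
  assumes "open S" "open T"
  shows "Ck_on k S f \<Longrightarrow> Ck_on k T g \<Longrightarrow> f ` S \<subseteq> T \<Longrightarrow> Ck_on k S (\<lambda>x. g (f x))"
proof (induction k arbitrary: f g)
  case 0 then show ?case by (auto intro: continuous_on_compose2)
next
  case (Suc k)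
  have fx: "f x \<in> T" if "x \<in> S" for x using Suc.prems(3) that by auto
  let ?g' = "\<lambda>y. frechet_derivative g (at y)" and ?f' = "\<lambda>x. frechet_derivative f (at x)"
  have lin: "linear (?g' y)" if "y \<in> T" for y
    using Ck_on_Suc_has_derivative[OF Suc.prems(2) that] by (simp add: has_derivative_linear)
  show ?case
  proof (rule Ck_on_SucI[OF assms(1)])
    fix x assume x: "x \<in> S"
    have "((\<lambda>x. g (f x)) has_derivative (\<lambda>v. ?g' (f x) (?f' x v))) (at x)"
      using has_derivative_compose[OF Ck_on_Suc_has_derivative[OF Suc.prems(1) x]
        Ck_on_Suc_has_derivative[OF Suc.prems(2) fx[OF x]]] .
    then show "((\<lambda>x. g (f x)) has_derivative
        (\<lambda>v. \<Sum>b\<in>Basis. (?f' x v \<bullet> b) *\<^sub>R ?g' (f x) b)) (at x)"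
      by (simp add: linear_Basis_expansion[OF lin[OF fx[OF x]], symmetric])
  next
    fix v
    have g': "Ck_on k S (\<lambda>x. ?g' (f x) b)" for b
      by (rule Suc.IH[OF Ck_on_SucD[OF Suc.prems(1)] _ Suc.prems(3)]) (use Suc.prems(2) in simp)
    have "Ck_on k S (\<lambda>x. ?f' x v)" using Suc.prems(1) by simp
    then have f': "Ck_on k S (\<lambda>x. ?f' x v \<bullet> b)" for b
      using Ck_on_bilinear[OF assms(1) bounded_bilinear_inner _ Ck_on_const[OF assms(1)]] by blast
    show "Ck_on k S (\<lambda>x. \<Sum>b\<in>Basis. (?f' x v \<bullet> b) *\<^sub>R ?g' (f x) b)"
      by (intro Ck_on_sum[OF assms(1)] Ck_on_bilinear[OF assms(1) bounded_bilinear_scaleR] f' g')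
  qed
qed

lemma Ck_on_Pair:
  assumes "open S"
  shows "Ck_on k S f \<Longrightarrow> Ck_on k S g \<Longrightarrow> Ck_on k S (\<lambda>x. (f x, g x))"
proof (induction k arbitrary: f g)
  case 0 then show ?case by (auto intro: continuous_on_Pair)
next
  case (Suc k)
  show ?case
  proof (rule Ck_on_SucI[OF assms])
    fix x assume "x \<in> S"
    then show "((\<lambda>x. (f x, g x)) has_derivative
        (\<lambda>v. (frechet_derivative f (at x) v, frechet_derivative g (at x) v))) (at x)"
      by (intro has_derivative_Pair Ck_on_Suc_has_derivative[OF Suc.prems(1)]
          Ck_on_Suc_has_derivative[OF Suc.prems(2)])
  next
    fix v
    show "Ck_on k S (\<lambda>x. (frechet_derivative f (at x) v, frechet_derivative g (at x) v))"
      by (rule Suc.IH) (use Suc.prems in simp_all)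
  qed
qed

section \<open>Smooth functions on open sets\<close>

lemma smooth_on_cong:
  "open S \<Longrightarrow> (\<And>x. x \<in> S \<Longrightarrow> f x = g x) \<Longrightarrow> smooth_on S f \<longleftrightarrow> smooth_on S g"
  by (simp add: smooth_on_def Ck_on_cong[of S f g])

lemma smooth_on_eq:
  "open S \<Longrightarrow> smooth_on S g \<Longrightarrow> (\<And>x. x \<in> S \<Longrightarrow> f x = g x) \<Longrightarrow> smooth_on S f"
  using smooth_on_cong[of S f g] by simp

lemma smooth_on_subset: "smooth_on S f \<Longrightarrow> T \<subseteq> S \<Longrightarrow> smooth_on T f"
  by (auto simp: smooth_on_def intro: Ck_on_subset)

lemma smooth_on_local:
  "(\<And>x. x \<in> S \<Longrightarrow> \<exists>T. open T \<and> x \<in> T \<and> smooth_on T f) \<Longrightarrow> smooth_on S f"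
  unfolding smooth_on_def by (intro allI Ck_on_local) blast

lemma smooth_on_const: "open S \<Longrightarrow> smooth_on S (\<lambda>x. c)"
  by (simp add: smooth_on_def Ck_on_const)

lemma smooth_on_bounded_linear: "open S \<Longrightarrow> bounded_linear L \<Longrightarrow> smooth_on S L"
  by (simp add: smooth_on_def Ck_on_bounded_linear)

lemma smooth_on_id: "open S \<Longrightarrow> smooth_on S (\<lambda>x. x)"
  by (simp add: smooth_on_bounded_linear bounded_linear_ident)

lemma smooth_on_add:
  "open S \<Longrightarrow> smooth_on S f \<Longrightarrow> smooth_on S g \<Longrightarrow> smooth_on S (\<lambda>x. f x + g x)"
  by (simp add: smooth_on_def Ck_on_add)

lemma smooth_on_bilinear:
  "open S \<Longrightarrow> bounded_bilinear b \<Longrightarrow> smooth_on S f \<Longrightarrow> smooth_on S g \<Longrightarrow> smooth_on S (\<lambda>x. b (f x) (g x))"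
  by (simp add: smooth_on_def Ck_on_bilinear)

lemma smooth_on_sum:
  "open S \<Longrightarrow> (\<And>i. i \<in> I \<Longrightarrow> smooth_on S (f i)) \<Longrightarrow> smooth_on S (\<lambda>x. \<Sum>i\<in>I. f i x)"
  by (simp add: smooth_on_def Ck_on_sum)

lemma smooth_on_compose:
  fixes f :: "'e::real_normed_vector \<Rightarrow> 'f::euclidean_space" and g :: "'f \<Rightarrow> 'h::real_normed_vector"
  shows "open S \<Longrightarrow> open T \<Longrightarrow> smooth_on S f \<Longrightarrow> smooth_on T g \<Longrightarrow> f ` S \<subseteq> T \<Longrightarrow>
    smooth_on S (\<lambda>x. g (f x))"
  by (simp add: smooth_on_def Ck_on_compose)

lemma smooth_on_Pair:
  "open S \<Longrightarrow> smooth_on S f \<Longrightarrow> smooth_on S g \<Longrightarrow> smooth_on S (\<lambda>x. (f x, g x))"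
  by (simp add: smooth_on_def Ck_on_Pair)

lemma smooth_on_has_derivative:
  "smooth_on S f \<Longrightarrow> x \<in> S \<Longrightarrow> (f has_derivative frechet_derivative f (at x)) (at x)"
  using Ck_on_Suc_has_derivative unfolding smooth_on_def by blast

lemma smooth_on_continuous_on: "smooth_on S f \<Longrightarrow> continuous_on S f"
  unfolding smooth_on_def using Ck_on.simps(1) by blast

lemma smooth_on_frechet_derivative_const:
  "smooth_on S f \<Longrightarrow> smooth_on S (\<lambda>x. frechet_derivative f (at x) v)"
  unfolding smooth_on_def by (metis Ck_on.simps(2))

text \<open>Base point and direction may both vary, by the same expansion of the direction in
  \<open>Basis\<close>. This is the form needed for charts of the tangent bundle and for tangent
  maps.\<close>

lemma smooth_on_frechet_derivative:
  fixes f :: "'e::euclidean_space \<Rightarrow> 'f::real_normed_vector" and h :: "'d::euclidean_space \<Rightarrow> 'e"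
  assumes "open S" "smooth_on S f" "open T" "smooth_on T h" "smooth_on T k" "h ` T \<subseteq> S"
  shows "smooth_on T (\<lambda>x. frechet_derivative f (at (h x)) (k x))"
proof -
  have eq: "frechet_derivative f (at (h x)) (k x) =
      (\<Sum>b\<in>Basis. (k x \<bullet> b) *\<^sub>R frechet_derivative f (at (h x)) b)" if "x \<in> T" for x
    using linear_Basis_expansion[OF has_derivative_linear[OF smooth_on_has_derivative[OF assms(2)]]]
      that assms(6) by blast
  have "smooth_on T (\<lambda>x. \<Sum>b\<in>Basis. (k x \<bullet> b) *\<^sub>R frechet_derivative f (at (h x)) b)"
    by (intro smooth_on_sum smooth_on_bilinear[OF _ bounded_bilinear_scaleR] assms
        smooth_on_bilinear[OF _ bounded_bilinear_inner] smooth_on_const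
        smooth_on_compose[OF assms(3,1,4) _ assms(6)] smooth_on_frechet_derivative_const)
  then show ?thesis by (rule smooth_on_eq[OF assms(3)]) (rule eq)
qed

section \<open>Smoothness at a point\<close>

abbreviation cinv :: "('a, 'e) chart \<Rightarrow> 'e \<Rightarrow> 'a" where
  "cinv c \<equiv> inv_into (fst c) (snd c)"

abbreviation cran :: "('a, 'e) chart \<Rightarrow> 'e set" where
  "cran c \<equiv> snd c ` fst c"

section \<open>Charts and the topology of an atlas\<close>

lemma smooth_atlas_inj: "smooth_atlas A \<Longrightarrow> c \<in> A \<Longrightarrow> inj_on (snd c) (fst c)"
  by (cases c) (auto simp: smooth_atlas_def)

lemma smooth_atlas_open_cran: "smooth_atlas A \<Longrightarrow> c \<in> A \<Longrightarrow> open (cran c)"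
  by (cases c) (auto simp: smooth_atlas_def)

lemma smooth_atlas_transition:
  assumes "smooth_atlas A" "c \<in> A" "d \<in> A"
  shows "open (snd c ` (fst c \<inter> fst d))"
    and "smooth_on (snd c ` (fst c \<inter> fst d)) (\<lambda>x. snd d (cinv c x))"
  using assms by (cases c; cases d; fastforce simp: smooth_atlas_def comp_def)+

lemma smooth_atlasI:
  assumes "\<And>c. c \<in> A \<Longrightarrow> inj_on (snd c) (fst c)"
    and "\<And>c. c \<in> A \<Longrightarrow> open (cran c)"
    and "\<And>c d. c \<in> A \<Longrightarrow> d \<in> A \<Longrightarrow> open (snd c ` (fst c \<inter> fst d))"
    and "\<And>c d. c \<in> A \<Longrightarrow> d \<in> A \<Longrightarrow> smooth_on (snd c ` (fst c \<inter> fst d)) (\<lambda>x. snd d (cinv c x))"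
  shows "smooth_atlas A"
  unfolding smooth_atlas_def comp_def using assms by fastforce

lemma cinv_chart: "smooth_atlas A \<Longrightarrow> c \<in> A \<Longrightarrow> p \<in> fst c \<Longrightarrow> cinv c (snd c p) = p"
  by (simp add: smooth_atlas_inj inv_into_f_f)

lemma chart_cinv: "x \<in> cran c \<Longrightarrow> snd c (cinv c x) = x"
  by (rule f_inv_into_f)

lemma cinv_in: "x \<in> cran c \<Longrightarrow> cinv c x \<in> fst c"
  by (rule inv_into_into)

lemma chart_aroundD: "chart_around A p c \<Longrightarrow> c \<in> A" "chart_around A p c \<Longrightarrow> p \<in> fst c"
  "chart_around A p c \<Longrightarrow> snd c p \<in> cran c" "chart_around A p c \<Longrightarrow> p \<in> mcarrier A"
  by (auto simp: chart_around_def mcarrier_def)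

lemma chart_around_cinv: "c \<in> A \<Longrightarrow> x \<in> cran c \<Longrightarrow> chart_around A (cinv c x) c"
  by (simp add: chart_around_def cinv_in)

lemma obtain_chart:
  assumes "p \<in> mcarrier A"
  obtains c where "chart_around A p c"
  using assms by (auto simp: mcarrier_def chart_around_def)

lemma openin_mtop: "smooth_atlas A \<Longrightarrow> openin (mtop A) W \<longleftrightarrow> mopen A W"
  unfolding mtop_def
  by (subst topology_inverse'[OF istopology_mopen]) (use smooth_atlas_inj in fastforce)+

lemma mopen_iff:
  "mopen A W \<longleftrightarrow> W \<subseteq> mcarrier A \<and> (\<forall>c\<in>A. open (snd c ` (W \<inter> fst c)))"
  by (fastforce simp: mopen_def)

lemma mopen_chart: "smooth_atlas A \<Longrightarrow> c \<in> A \<Longrightarrow> mopen A (fst c)"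
  unfolding mopen_iff using smooth_atlas_transition(1)[of A _ c]
  by (auto simp: mcarrier_def Int_commute)

lemma mopen_mcarrier: "smooth_atlas A \<Longrightarrow> mopen A (mcarrier A)"
proof -
  assume A: "smooth_atlas A"
  have "mcarrier A \<inter> fst c = fst c" if "c \<in> A" for c using that by (auto simp: mcarrier_def)
  then show ?thesis unfolding mopen_iff using smooth_atlas_open_cran[OF A] by simp
qed

lemma topspace_mtop: "smooth_atlas A \<Longrightarrow> topspace (mtop A) = mcarrier A"
  using openin_mtop[of A] mopen_mcarrier[of A] openin_subset[of "mtop A"] openin_topspace[of "mtop A"]
  unfolding mopen_iff by blast

text \<open>One pair of charts is enough for a local notion. Requiring \<open>f\<close> to carry the
  points over the open set \<open>W\<close> into the domain of \<open>d\<close> builds the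
  continuity of \<open>f\<close> near the point into the definition, where \<open>smooth_map\<close>
  asks for it separately.\<close>

definition smooth_at ::
  "('a, 'e::euclidean_space) atlas \<Rightarrow> ('b, 'f::euclidean_space) atlas \<Rightarrow> ('a \<Rightarrow> 'b) \<Rightarrow> 'a \<Rightarrow> bool" where
  "smooth_at A B f p \<longleftrightarrow>
     (\<exists>c d W. chart_around A p c \<and> chart_around B (f p) d \<and> open W \<and> snd c p \<in> W \<and> W \<subseteq> cran c \<and>
        (\<forall>x\<in>W. f (cinv c x) \<in> fst d) \<and> smooth_on W (\<lambda>x. snd d (f (cinv c x))))"

lemma smooth_atI:
  assumes "chart_around A p c" "chart_around B q d" "open W" "snd c p \<in> W" "W \<subseteq> cran c" "f p = q"
    "\<And>x. x \<in> W \<Longrightarrow> f (cinv c x) \<in> fst d" "smooth_on W (\<lambda>x. snd d (f (cinv c x)))"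
  shows "smooth_at A B f p"
  using assms unfolding smooth_at_def by blast

lemma smooth_at_mcarrier: "smooth_at A B f p \<Longrightarrow> p \<in> mcarrier A" "smooth_at A B f p \<Longrightarrow> f p \<in> mcarrier B"
  unfolding smooth_at_def by (blast dest: chart_aroundD(4))+

text \<open>The pair of charts can be exchanged for any other one: the new local expression is the
  old one composed with a transition map on either side.\<close>

lemma smooth_at_charts:
  assumes A: "smooth_atlas A" and B: "smooth_atlas B" and f: "smooth_at A B f p"
    and c': "chart_around A p c'" and d': "chart_around B (f p) d'"
  obtains W where "open W" "snd c' p \<in> W" "W \<subseteq> cran c'" "\<And>x. x \<in> W \<Longrightarrow> f (cinv c' x) \<in> fst d'"
    "smooth_on W (\<lambda>x. snd d' (f (cinv c' x)))"
proof -
  obtain c d W where c: "chart_around A p c" and d: "chart_around B (f p) d"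
    and W: "open W" "snd c p \<in> W" "W \<subseteq> cran c" "\<And>x. x \<in> W \<Longrightarrow> f (cinv c x) \<in> fst d"
    and sm: "smooth_on W (\<lambda>x. snd d (f (cinv c x)))"
    using f unfolding smooth_at_def by blast
  note cA = chart_aroundD[OF c] chart_aroundD[OF d] chart_aroundD[OF c'] chart_aroundD[OF d']
  let ?S = "snd c' ` (fst c' \<inter> fst c)" and ?T = "snd d ` (fst d \<inter> fst d')"
  let ?t = "\<lambda>x. snd c (cinv c' x)" and ?h = "\<lambda>x. snd d (f (cinv c x))"
  note tS = smooth_atlas_transition[OF A cA(9) cA(1)] and tT = smooth_atlas_transition[OF B cA(5) cA(13)]
  \<comment> \<open>\<open>W2\<close> keeps the values of \<open>f\<close> in the overlap of
    \<open>d\<close> and \<open>d'\<close>, and \<open>W3\<close> is its preimage under the change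
    from \<open>c'\<close> to \<open>c\<close>. Both are open because they are preimages under
    continuous maps.\<close>
  define W2 where "W2 = W \<inter> ?h -` ?T"
  define W3 where "W3 = ?S \<inter> ?t -` W2"
  have o2: "open W2" unfolding W2_def
    by (rule continuous_open_preimage[OF smooth_on_continuous_on[OF sm] W(1) tT(1)])
  have o3: "open W3" unfolding W3_def
    by (rule continuous_open_preimage[OF smooth_on_continuous_on[OF tS(2)] tS(1) o2])
  have eq: "cinv c (?t x) = cinv c' x" if "x \<in> ?S" for x
    using that cinv_chart[OF A] cA by auto
  have in3: "f (cinv c' x) \<in> fst d'" if "x \<in> W3" for x
  proof -
    have "f (cinv c' x) \<in> fst d" "snd d (f (cinv c' x)) \<in> ?T"
      using that eq[of x] W(4)[of "?t x"] by (auto simp: W3_def W2_def)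
    then show ?thesis
      using smooth_atlas_inj[OF B cA(5)] by (auto dest: inj_onD)
  qed
  show ?thesis
  proof
    show "open W3" by (rule o3)
    show "snd c' p \<in> W3"
      using cA W(2) cinv_chart[OF A] by (auto simp: W3_def W2_def)
    show "W3 \<subseteq> cran c'" by (auto simp: W3_def)
    show "f (cinv c' x) \<in> fst d'" if "x \<in> W3" for x by (rule in3[OF that])
    have "smooth_on W3 (\<lambda>x. snd d' (cinv d (?h (?t x))))"
    proof (rule smooth_on_compose[OF o3 tT(1) _ tT(2)])
      show "smooth_on W3 (\<lambda>x. ?h (?t x))"
        by (rule smooth_on_compose[OF o3 o2])
          (auto simp: W3_def W2_def intro: smooth_on_subset[OF tS(2)] smooth_on_subset[OF sm])
      show "(\<lambda>x. ?h (?t x)) ` W3 \<subseteq> ?T" by (auto simp: W3_def W2_def)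
    qed
    then show "smooth_on W3 (\<lambda>x. snd d' (f (cinv c' x)))"
    proof (rule smooth_on_eq[OF o3])
      fix x assume "x \<in> W3"
      then show "snd d' (f (cinv c' x)) = snd d' (cinv d (?h (?t x)))"
        using eq[of x] W(4)[of "?t x"] cinv_chart[OF B cA(5)] by (auto simp: W3_def W2_def)
    qed
  qed
qed

text \<open>Continuity is what makes the coordinate image of \<open>fst c\<close> intersected with
  the preimage of \<open>fst d\<close> open; on it the definition of \<open>smooth_map\<close> gives
  a smooth local expression.\<close>

lemma smooth_map_imp_smooth_at:
  assumes A: "smooth_atlas A" and B: "smooth_atlas B" and f: "smooth_map A B f" and p: "p \<in> mcarrier A"
  shows "smooth_at A B f p"
proof -
  have cont: "continuous_map (mtop A) (mtop B) f" using f by (simp add: smooth_map_def)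
  then have "f p \<in> mcarrier B"
    using p topspace_mtop[OF A] topspace_mtop[OF B] by (auto simp: continuous_map_def)
  then obtain d where d: "chart_around B (f p) d" by (rule obtain_chart)
  obtain c where c: "chart_around A p c" using p by (rule obtain_chart)
  note cA = chart_aroundD[OF c] chart_aroundD[OF d]
  let ?W = "snd c ` (fst c \<inter> f -` fst d)"
  have "openin (mtop A) {x \<in> topspace (mtop A). f x \<in> fst d}"
    using cont openin_mtop[OF B] mopen_chart[OF B cA(5)] by (simp add: continuous_map_def)
  then have "open (snd c ` ({x \<in> mcarrier A. f x \<in> fst d} \<inter> fst c))"
    using cA(1) by (simp add: openin_mtop[OF A] topspace_mtop[OF A] mopen_iff)
  moreover have "{x \<in> mcarrier A. f x \<in> fst d} \<inter> fst c = fst c \<inter> f -` fst d"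
    using cA(1) by (auto simp: mcarrier_def)
  ultimately have o: "open ?W" by simp
  show ?thesis
  proof (rule smooth_atI[OF c d o])
    show "snd c p \<in> ?W" using cA by auto
    show "f (cinv c x) \<in> fst d" if "x \<in> ?W" for x using that cinv_chart[OF A cA(1)] by auto
    show "smooth_on ?W (\<lambda>x. snd d (f (cinv c x)))"
      using f cA(1,5) unfolding smooth_map_def by (cases c; cases d) (fastforce simp: comp_def)
  qed auto
qed

text \<open>Continuity is recovered locally: near a point of a preimage, the local expression is
  continuous, and injectivity of the target chart turns a condition on coordinates back into one on
  points.\<close>

lemma smooth_mapI:
  assumes A: "smooth_atlas A" and B: "smooth_atlas B"
    and f: "\<And>p. p \<in> mcarrier A \<Longrightarrow> smooth_at A B f p"
  shows "smooth_map A B f"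
proof -
  have fB: "f p \<in> mcarrier B" if "p \<in> mcarrier A" for p
    using smooth_at_mcarrier(2)[OF f[OF that]] .
  have "openin (mtop A) {x \<in> topspace (mtop A). f x \<in> T}" if "openin (mtop B) T" for T
  proof -
    have T: "mopen B T" using that by (simp add: openin_mtop[OF B])
    have "open (snd c ` ({x \<in> mcarrier A. f x \<in> T} \<inter> fst c))" (is "open ?R") if c: "c \<in> A" for c
    proof (subst open_subopen, intro ballI)
      fix y assume "y \<in> ?R"
      then obtain p where p: "p \<in> mcarrier A" "f p \<in> T" "p \<in> fst c" "y = snd c p" by auto
      obtain d where d: "chart_around B (f p) d" using fB[OF p(1)] by (rule obtain_chart)
      note dB = chart_aroundD[OF d]
      have cp: "chart_around A p c" using p c by (simp add: chart_around_def)
      obtain W where W: "open W" "snd c p \<in> W" "W \<subseteq> cran c" "\<And>x. x \<in> W \<Longrightarrow> f (cinv c x) \<in> fst d"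
        and sm: "smooth_on W (\<lambda>x. snd d (f (cinv c x)))"
        using smooth_at_charts[OF A B f[OF p(1)] cp d] by blast
      let ?V = "W \<inter> (\<lambda>x. snd d (f (cinv c x))) -` (snd d ` (T \<inter> fst d))"
      have "open ?V"
        by (rule continuous_open_preimage[OF smooth_on_continuous_on[OF sm] W(1)])
          (use T dB(1) in \<open>simp add: mopen_iff\<close>)
      moreover have "y \<in> ?V" using p W(2) dB(2) cinv_chart[OF A c p(3)] by auto
      moreover have "?V \<subseteq> ?R"
      proof
        fix x assume x: "x \<in> ?V"
        then have "f (cinv c x) \<in> T"
          using W(4)[of x] smooth_atlas_inj[OF B dB(1)] by (auto dest: inj_onD)
        moreover have "x \<in> cran c" using x W(3) by auto
        ultimately show "x \<in> ?R"
          using cinv_in[of x c] chart_cinv[of x c] c by (auto simp: mcarrier_def image_iff intro!: bexI[of _ "cinv c x"])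
      qed
      ultimately show "\<exists>V. open V \<and> y \<in> V \<and> V \<subseteq> ?R" by blast
    qed
    then show ?thesis by (auto simp: openin_mtop[OF A] topspace_mtop[OF A] mopen_iff)
  qed
  then have "continuous_map (mtop A) (mtop B) f"
    using fB by (auto simp: continuous_map_def topspace_mtop[OF A] topspace_mtop[OF B])
  moreover have "smooth_on (snd c ` (fst c \<inter> f -` fst d)) (\<lambda>x. snd d (f (cinv c x)))"
    if c: "c \<in> A" and d: "d \<in> B" for c d
  proof (rule smooth_on_local)
    fix y assume "y \<in> snd c ` (fst c \<inter> f -` fst d)"
    then obtain p where p: "p \<in> fst c" "f p \<in> fst d" "y = snd c p" by auto
    then have "chart_around A p c" "chart_around B (f p) d" "p \<in> mcarrier A"
      using c d by (auto simp: chart_around_def mcarrier_def)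
    then show "\<exists>T. open T \<and> y \<in> T \<and> smooth_on T (\<lambda>x. snd d (f (cinv c x)))"
      using smooth_at_charts[OF A B f] p(3) by metis
  qed
  ultimately show ?thesis by (fastforce simp: smooth_map_def comp_def)
qed

lemma smooth_at_compose:
  assumes A: "smooth_atlas A" and B: "smooth_atlas B" and C: "smooth_atlas C"
    and f: "smooth_at A B f p" and g: "smooth_at B C g (f p)"
  shows "smooth_at A C (\<lambda>x. g (f x)) p"
proof -
  obtain c where c: "chart_around A p c" using smooth_at_mcarrier(1)[OF f] by (rule obtain_chart)
  obtain d where d: "chart_around B (f p) d" using smooth_at_mcarrier(2)[OF f] by (rule obtain_chart)
  obtain e where e: "chart_around C (g (f p)) e" using smooth_at_mcarrier(2)[OF g] by (rule obtain_chart)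
  note cA = chart_aroundD[OF c] chart_aroundD[OF d] chart_aroundD[OF e]
  obtain W where W: "open W" "snd c p \<in> W" "W \<subseteq> cran c" "\<And>x. x \<in> W \<Longrightarrow> f (cinv c x) \<in> fst d"
    and sm: "smooth_on W (\<lambda>x. snd d (f (cinv c x)))"
    using smooth_at_charts[OF A B f c d] by blast
  obtain V where V: "open V" "snd d (f p) \<in> V" "V \<subseteq> cran d" "\<And>x. x \<in> V \<Longrightarrow> g (cinv d x) \<in> fst e"
    and smV: "smooth_on V (\<lambda>x. snd e (g (cinv d x)))"
    using smooth_at_charts[OF B C g d e] by blast
  let ?W = "W \<inter> (\<lambda>x. snd d (f (cinv c x))) -` V"
  have o: "open ?W"
    by (rule continuous_open_preimage[OF smooth_on_continuous_on[OF sm] W(1) V(1)])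
  have eq: "cinv d (snd d (f (cinv c x))) = f (cinv c x)" if "x \<in> W" for x
    using cinv_chart[OF B cA(5)] W(4)[OF that] .
  show ?thesis
  proof (rule smooth_atI[OF c e o])
    show "snd c p \<in> ?W" using W(2) V(2) cinv_chart[OF A cA(1,2)] by simp
    show "g (f (cinv c x)) \<in> fst e" if "x \<in> ?W" for x using V(4) eq that by fastforce
    have "smooth_on ?W (\<lambda>x. snd e (g (cinv d (snd d (f (cinv c x))))))"
      by (rule smooth_on_compose[OF o V(1) _ smV]) (auto intro: smooth_on_subset[OF sm])
    then show "smooth_on ?W (\<lambda>x. snd e (g (f (cinv c x))))"
      by (rule smooth_on_eq[OF o]) (simp add: eq)
  qed (use W(3) in auto)
qed

lemma smooth_at_cong:
  assumes "\<And>x. x \<in> mcarrier A \<Longrightarrow> f x = g x" and g: "smooth_at A B g p"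
  shows "smooth_at A B f p"
proof -
  obtain c d W where c: "chart_around A p c" and d: "chart_around B (g p) d"
    and W: "open W" "snd c p \<in> W" "W \<subseteq> cran c" "\<And>x. x \<in> W \<Longrightarrow> g (cinv c x) \<in> fst d"
    and sm: "smooth_on W (\<lambda>x. snd d (g (cinv c x)))"
    using g unfolding smooth_at_def by blast
  have eq: "f (cinv c x) = g (cinv c x)" if "x \<in> W" for x
    using assms(1) that W(3) chart_aroundD(1,4)[OF chart_around_cinv[of c A x]] chart_aroundD(1)[OF c]
    by blast
  show ?thesis
    by (rule smooth_atI[OF c d W(1,2,3)])
      (use W(4) eq assms(1) chart_aroundD(4)[OF c] in \<open>auto intro: smooth_on_eq[OF W(1) sm]\<close>)
qed

lemma smooth_at_id:
  assumes A: "smooth_atlas A" and p: "p \<in> mcarrier A"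
  shows "smooth_at A A (\<lambda>x. x) p"
proof -
  obtain c where c: "chart_around A p c" using p by (rule obtain_chart)
  note cA = chart_aroundD[OF c]
  have o: "open (cran c)" by (rule smooth_atlas_open_cran[OF A cA(1)])
  show ?thesis
    by (rule smooth_atI[OF c c o])
      (use cA in \<open>auto intro: cinv_in smooth_on_eq[OF o smooth_on_id[OF o] chart_cinv]\<close>)
qed

lemma smooth_at_const:
  assumes A: "smooth_atlas A" and p: "p \<in> mcarrier A" and q: "q \<in> mcarrier B"
  shows "smooth_at A B (\<lambda>x. q) p"
proof -
  obtain c where c: "chart_around A p c" using p by (rule obtain_chart)
  obtain d where d: "chart_around B q d" using q by (rule obtain_chart)
  note cA = chart_aroundD[OF c] chart_aroundD[OF d]
  have o: "open (cran c)" by (rule smooth_atlas_open_cran[OF A cA(1)])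
  show ?thesis by (rule smooth_atI[OF c d o]) (use cA o in \<open>auto intro: smooth_on_const\<close>)
qed

subsection \<open>Vector spaces and products\<close>

text \<open>A Euclidean space as a manifold with one global chart, so that coordinates, components
  and curves all fall under \<open>smooth_at\<close>. At type \<open>real\<close> it is
  \<open>real_atlas\<close>.\<close>

abbreviation vspace_atlas :: "('e, 'e) atlas" where
  "vspace_atlas \<equiv> {(UNIV, id)}"

lemma cinv_vspace [simp]: "inv_into UNIV id x = x"
  by (metis id_apply inv_id)

lemma smooth_atlas_vspace: "smooth_atlas (vspace_atlas :: ('e::euclidean_space, 'e) atlas)"
  by (rule smooth_atlasI) (auto intro: smooth_on_id)

lemma mcarrier_vspace [simp]: "mcarrier vspace_atlas = UNIV"
  by (simp add: mcarrier_def)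

lemma chart_around_vspace [simp]: "chart_around vspace_atlas x c \<longleftrightarrow> c = (UNIV, id)"
  by (auto simp: chart_around_def)

lemma smooth_at_vspace_charts:
  fixes f :: "'a \<Rightarrow> 'f::euclidean_space"
  assumes A: "smooth_atlas A" and f: "smooth_at A vspace_atlas f p" and c: "chart_around A p c"
  obtains W where "open W" "snd c p \<in> W" "W \<subseteq> cran c" "smooth_on W (\<lambda>x. f (cinv c x))"
  using smooth_at_charts[OF A smooth_atlas_vspace f c, of "(UNIV, id)"] by auto

lemma smooth_at_vspaceI:
  fixes f :: "'a \<Rightarrow> 'f::euclidean_space"
  assumes "chart_around A p c" "open W" "snd c p \<in> W" "W \<subseteq> cran c" "smooth_on W (\<lambda>x. f (cinv c x))"
  shows "smooth_at A vspace_atlas f p"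
  by (rule smooth_atI[OF assms(1) _ assms(2-4), where d = "(UNIV, id)" and q = "f p"]) (use assms(5) in auto)

lemma smooth_at_euclidean:
  fixes f :: "'e::euclidean_space \<Rightarrow> 'f::euclidean_space"
  shows "smooth_at vspace_atlas vspace_atlas f x \<longleftrightarrow> (\<exists>W. open W \<and> x \<in> W \<and> smooth_on W f)"
  by (simp add: smooth_at_def)

lemma smooth_at_chart:
  assumes A: "smooth_atlas A" and c: "chart_around A p c"
  shows "smooth_at A vspace_atlas (snd c) p"
proof -
  have o: "open (cran c)" by (rule smooth_atlas_open_cran[OF A chart_aroundD(1)[OF c]])
  show ?thesis
    by (rule smooth_at_vspaceI[OF c o])
      (use chart_aroundD[OF c] in \<open>auto intro: smooth_on_eq[OF o smooth_on_id[OF o] chart_cinv]\<close>)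
qed

lemma smooth_at_cinv:
  assumes A: "smooth_atlas A" and c: "c \<in> A" and x: "x \<in> cran c"
  shows "smooth_at vspace_atlas A (cinv c) x"
proof -
  have o: "open (cran c)" by (rule smooth_atlas_open_cran[OF A c])
  show ?thesis
    by (rule smooth_atI[OF _ chart_around_cinv[OF c x] o, where c = "(UNIV, id)"])
      (use x in \<open>auto intro: cinv_in smooth_on_eq[OF o smooth_on_id[OF o] chart_cinv]\<close>)
qed

lemma smooth_at_add:
  fixes f g :: "'a \<Rightarrow> 'f::euclidean_space"
  assumes A: "smooth_atlas A" and f: "smooth_at A vspace_atlas f p" and g: "smooth_at A vspace_atlas g p"
  shows "smooth_at A vspace_atlas (\<lambda>x. f x + g x) p"
proof -
  obtain c where c: "chart_around A p c" using smooth_at_mcarrier(1)[OF f] by (rule obtain_chart)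
  obtain W where W: "open W" "snd c p \<in> W" "W \<subseteq> cran c" "smooth_on W (\<lambda>x. f (cinv c x))"
    by (rule smooth_at_vspace_charts[OF A f c])
  obtain V where V: "open V" "snd c p \<in> V" "V \<subseteq> cran c" "smooth_on V (\<lambda>x. g (cinv c x))"
    by (rule smooth_at_vspace_charts[OF A g c])
  show ?thesis
    by (rule smooth_at_vspaceI[OF c open_Int[OF W(1) V(1)]])
      (use W V in \<open>auto intro!: smooth_on_add intro: smooth_on_subset\<close>)
qed

lemma smooth_at_bilinear:
  fixes f :: "'a \<Rightarrow> 'f::euclidean_space" and g :: "'a \<Rightarrow> 'g::euclidean_space"
    and b :: "'f \<Rightarrow> 'g \<Rightarrow> 'h::euclidean_space"
  assumes A: "smooth_atlas A" and f: "smooth_at A vspace_atlas f p" and g: "smooth_at A vspace_atlas g p"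
    and b: "bounded_bilinear b"
  shows "smooth_at A vspace_atlas (\<lambda>x. b (f x) (g x)) p"
proof -
  obtain c where c: "chart_around A p c" using smooth_at_mcarrier(1)[OF f] by (rule obtain_chart)
  obtain W where W: "open W" "snd c p \<in> W" "W \<subseteq> cran c" "smooth_on W (\<lambda>x. f (cinv c x))"
    by (rule smooth_at_vspace_charts[OF A f c])
  obtain V where V: "open V" "snd c p \<in> V" "V \<subseteq> cran c" "smooth_on V (\<lambda>x. g (cinv c x))"
    by (rule smooth_at_vspace_charts[OF A g c])
  show ?thesis
    by (rule smooth_at_vspaceI[OF c open_Int[OF W(1) V(1)]])
      (use W V in \<open>auto intro!: smooth_on_bilinear[OF _ b] intro: smooth_on_subset\<close>)
qed

definition chart_prod :: "('a, 'e) chart \<Rightarrow> ('b, 'f) chart \<Rightarrow> ('a \<times> 'b, 'e \<times> 'f) chart" where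
  "chart_prod c d = (fst c \<times> fst d, map_prod (snd c) (snd d))"

lemma prod_atlas_eq: "prod_atlas A B = {chart_prod c d | c d. c \<in> A \<and> d \<in> B}"
  by (force simp: prod_atlas_def chart_prod_def)

lemma chart_prod_in: "c \<in> A \<Longrightarrow> d \<in> B \<Longrightarrow> chart_prod c d \<in> prod_atlas A B"
  unfolding prod_atlas_eq by blast

lemma chart_around_prod:
  assumes "chart_around A p c" "chart_around B q d"
  shows "chart_around (prod_atlas A B) (p, q) (chart_prod c d)"
  using assms by (simp add: chart_around_def chart_prod_in) (simp add: chart_prod_def)

lemma mcarrier_prod: "mcarrier (prod_atlas A B) = mcarrier A \<times> mcarrier B"
proof (intro equalityI subsetI)
  fix x assume "x \<in> mcarrier (prod_atlas A B)"
  then obtain c d where "c \<in> A" "d \<in> B" "x \<in> fst (chart_prod c d)"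
    unfolding mcarrier_def prod_atlas_eq by blast
  then show "x \<in> mcarrier A \<times> mcarrier B"
    unfolding mcarrier_def chart_prod_def by (cases x) fastforce
next
  fix x assume "x \<in> mcarrier A \<times> mcarrier B"
  then obtain c d where "chart_around A (fst x) c" "chart_around B (snd x) d"
    by (metis SigmaE obtain_chart fst_conv snd_conv)
  then show "x \<in> mcarrier (prod_atlas A B)"
    using chart_aroundD(4)[OF chart_around_prod] by fastforce
qed

lemma cran_chart_prod: "cran (chart_prod c d) = cran c \<times> cran d"
  by (auto simp: chart_prod_def map_prod_def image_iff)

lemma cinv_chart_prod:
  assumes "smooth_atlas A" "smooth_atlas B" "c \<in> A" "d \<in> B" "x \<in> cran c" "y \<in> cran d"
  shows "cinv (chart_prod c d) (x, y) = (cinv c x, cinv d y)"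
proof (rule inv_into_f_eq)
  show "inj_on (snd (chart_prod c d)) (fst (chart_prod c d))"
    using smooth_atlas_inj[OF assms(1,3)] smooth_atlas_inj[OF assms(2,4)]
    by (auto simp: chart_prod_def map_prod_inj_on)
  show "(cinv c x, cinv d y) \<in> fst (chart_prod c d)"
    using assms(5,6) by (simp add: chart_prod_def cinv_in)
  show "snd (chart_prod c d) (cinv c x, cinv d y) = (x, y)"
    using assms(5,6) by (simp add: chart_prod_def chart_cinv)
qed

lemma smooth_on_fst: "open S \<Longrightarrow> smooth_on S fst"
  and smooth_on_snd: "open S \<Longrightarrow> smooth_on S snd"
  by (simp_all add: smooth_on_bounded_linear bounded_linear_fst bounded_linear_snd)

lemma smooth_atlas_prod:
  assumes A: "smooth_atlas A" and B: "smooth_atlas B"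
  shows "smooth_atlas (prod_atlas A B)"
proof (rule smooth_atlasI)
  fix e assume "e \<in> prod_atlas A B"
  then obtain c d where e: "e = chart_prod c d" "c \<in> A" "d \<in> B" by (auto simp: prod_atlas_eq)
  show "inj_on (snd e) (fst e)"
    using smooth_atlas_inj[OF A e(2)] smooth_atlas_inj[OF B e(3)]
    by (auto simp: e(1) chart_prod_def map_prod_inj_on)
  show "open (cran e)"
    unfolding e(1) cran_chart_prod
    using smooth_atlas_open_cran[OF A e(2)] smooth_atlas_open_cran[OF B e(3)] by (rule open_Times)
next
  fix e e' assume "e \<in> prod_atlas A B" "e' \<in> prod_atlas A B"
  then obtain c d c' d' where e: "e = chart_prod c d" "c \<in> A" "d \<in> B"
    and e': "e' = chart_prod c' d'" "c' \<in> A" "d' \<in> B" by (auto simp: prod_atlas_eq)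
  note tA = smooth_atlas_transition[OF A e(2) e'(2)] and tB = smooth_atlas_transition[OF B e(3) e'(3)]
  let ?S = "snd c ` (fst c \<inter> fst c')" and ?T = "snd d ` (fst d \<inter> fst d')"
  have im: "snd e ` (fst e \<inter> fst e') = ?S \<times> ?T"
    by (auto simp: e e' chart_prod_def map_prod_def image_iff)
  have o: "open (?S \<times> ?T)" using tA(1) tB(1) by (rule open_Times)
  then show "open (snd e ` (fst e \<inter> fst e'))" by (simp add: im)
  have "smooth_on (?S \<times> ?T) (\<lambda>x. (snd c' (cinv c (fst x)), snd d' (cinv d (snd x))))"
    by (intro smooth_on_Pair[OF o] smooth_on_compose[OF o tA(1) smooth_on_fst[OF o] tA(2)]
        smooth_on_compose[OF o tB(1) smooth_on_snd[OF o] tB(2)]) auto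
  then show "smooth_on (snd e ` (fst e \<inter> fst e')) (\<lambda>x. snd e' (cinv e x))"
    unfolding im
  proof (rule smooth_on_eq[OF o])
    fix x assume "x \<in> ?S \<times> ?T"
    then show "snd e' (cinv e x) = (snd c' (cinv c (fst x)), snd d' (cinv d (snd x)))"
      using cinv_chart_prod[OF A B e(2,3), of "fst x" "snd x"]
      by (auto simp: e(1) e'(1) chart_prod_def)
  qed
qed

lemma smooth_at_Pair:
  assumes A: "smooth_atlas A" and B: "smooth_atlas B" and C: "smooth_atlas C"
    and f: "smooth_at A B f p" and g: "smooth_at A C g p"
  shows "smooth_at A (prod_atlas B C) (\<lambda>x. (f x, g x)) p"
proof -
  obtain c where c: "chart_around A p c" using smooth_at_mcarrier(1)[OF f] by (rule obtain_chart)
  obtain d where d: "chart_around B (f p) d" using smooth_at_mcarrier(2)[OF f] by (rule obtain_chart)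
  obtain e where e: "chart_around C (g p) e" using smooth_at_mcarrier(2)[OF g] by (rule obtain_chart)
  obtain W where W: "open W" "snd c p \<in> W" "W \<subseteq> cran c" "\<And>x. x \<in> W \<Longrightarrow> f (cinv c x) \<in> fst d"
    "smooth_on W (\<lambda>x. snd d (f (cinv c x)))"
    using smooth_at_charts[OF A B f c d] by blast
  obtain V where V: "open V" "snd c p \<in> V" "V \<subseteq> cran c" "\<And>x. x \<in> V \<Longrightarrow> g (cinv c x) \<in> fst e"
    "smooth_on V (\<lambda>x. snd e (g (cinv c x)))"
    using smooth_at_charts[OF A C g c e] by blast
  have o: "open (W \<inter> V)" using W(1) V(1) by (rule open_Int)
  show ?thesis
  proof (rule smooth_atI[OF c chart_around_prod[OF d e] o])
    show "smooth_on (W \<inter> V) (\<lambda>x. snd (chart_prod d e) (f (cinv c x), g (cinv c x)))"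
      using smooth_on_Pair[OF o smooth_on_subset[OF W(5)] smooth_on_subset[OF V(5)]]
      by (simp add: chart_prod_def)
  qed (use W V in \<open>auto simp: chart_prod_def\<close>)
qed

lemma smooth_at_fst:
  assumes A: "smooth_atlas A" and B: "smooth_atlas B" and p: "p \<in> mcarrier A" and q: "q \<in> mcarrier B"
  shows "smooth_at (prod_atlas A B) A fst (p, q)"
    and "smooth_at (prod_atlas A B) B snd (p, q)"
proof -
  obtain c where c: "chart_around A p c" using p by (rule obtain_chart)
  obtain d where d: "chart_around B q d" using q by (rule obtain_chart)
  note cA = chart_aroundD[OF c] chart_aroundD[OF d]
  have o: "open (cran c \<times> cran d)"
    using smooth_atlas_open_cran[OF A cA(1)] smooth_atlas_open_cran[OF B cA(5)] by (rule open_Times)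
  have eq: "cinv (chart_prod c d) x = (cinv c (fst x), cinv d (snd x))" if "x \<in> cran c \<times> cran d" for x
    using cinv_chart_prod[OF A B cA(1,5), of "fst x" "snd x"] that by auto
  note mem = chart_aroundD(3)[OF chart_around_prod[OF c d], unfolded cran_chart_prod]
  show "smooth_at (prod_atlas A B) A fst (p, q)"
    by (rule smooth_atI[OF chart_around_prod[OF c d] c o mem])
      (use c in \<open>auto simp: eq cran_chart_prod cinv_in chart_cinv intro!: smooth_on_eq[OF o smooth_on_fst[OF o]]\<close>)
  show "smooth_at (prod_atlas A B) B snd (p, q)"
    by (rule smooth_atI[OF chart_around_prod[OF c d] d o mem])
      (use d in \<open>auto simp: eq cran_chart_prod cinv_in chart_cinv intro!: smooth_on_eq[OF o smooth_on_snd[OF o]]\<close>)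
qed

section \<open>Tangent vectors\<close>

lemma smooth_at_has_derivative:
  "smooth_at vspace_atlas vspace_atlas f x \<Longrightarrow> (f has_derivative frechet_derivative f (at x)) (at x)"
  unfolding smooth_at_euclidean using smooth_on_has_derivative by blast

lemma frechet_derivative_chain:
  assumes "(f has_derivative frechet_derivative f (at x)) (at x)"
    and "(g has_derivative frechet_derivative g (at (f x))) (at (f x))"
  shows "frechet_derivative (\<lambda>x. g (f x)) (at x) v =
    frechet_derivative g (at (f x)) (frechet_derivative f (at x) v)"
proof -
  have "((\<lambda>x. g (f x)) has_derivative
      (\<lambda>v. frechet_derivative g (at (f x)) (frechet_derivative f (at x) v))) (at x)"
    using has_derivative_compose[OF assms] .
  from frechet_derivative_at[OF this] show ?thesis by metis
qed

lemma smooth_at_local_rep: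
  assumes A: "smooth_atlas A" and B: "smooth_atlas B" and C: "smooth_atlas C"
    and f: "smooth_at A B f p" and c: "chart_around A p c"
    and h: "smooth_at B C h (f p)"
  shows "smooth_at vspace_atlas C (\<lambda>x. h (f (cinv c x))) (snd c p)"
proof -
  note cA = chart_aroundD[OF c]
  have "smooth_at A C (\<lambda>x. h (f x)) (cinv c (snd c p))"
    using smooth_at_compose[OF A B C f h] by (simp add: cinv_chart[OF A cA(1,2)])
  from smooth_at_compose[OF smooth_atlas_vspace A C smooth_at_cinv[OF A cA(1,3)] this]
  show ?thesis .
qed

lemma smooth_at_rep:
  assumes A: "smooth_atlas A" and B: "smooth_atlas B"
    and f: "smooth_at A B f p" and c: "chart_around A p c" and d: "chart_around B (f p) d"
  shows "smooth_at vspace_atlas vspace_atlas (\<lambda>x. snd d (f (cinv c x))) (snd c p)"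
  by (rule smooth_at_local_rep[OF A B smooth_atlas_vspace f c smooth_at_chart[OF B d]])

text \<open>The chain rule with a chart \<open>d\<close> inserted between \<open>f\<close> and
  \<open>h\<close>. With \<open>f\<close> the identity it gives the transformation law of components
  and the independence of \<open>tmap\<close> from the source chart; for general \<open>f\<close> it
  gives the transformation law in the target and functoriality.\<close>

lemma local_rep_chain:
  fixes h :: "'b \<Rightarrow> 'h::euclidean_space"
  assumes A: "smooth_atlas A" and B: "smooth_atlas B"
    and f: "smooth_at A B f p" and c: "chart_around A p c" and d: "chart_around B (f p) d"
    and h: "smooth_at B vspace_atlas h (f p)"
  shows "frechet_derivative (\<lambda>x. h (f (cinv c x))) (at (snd c p)) v =
    frechet_derivative (\<lambda>y. h (cinv d y)) (at (snd d (f p)))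
      (frechet_derivative (\<lambda>x. snd d (f (cinv c x))) (at (snd c p)) v)"
proof -
  note cA = chart_aroundD[OF c] chart_aroundD[OF d]
  obtain W where W: "open W" "snd c p \<in> W" "W \<subseteq> cran c" "\<And>x. x \<in> W \<Longrightarrow> f (cinv c x) \<in> fst d"
    "smooth_on W (\<lambda>x. snd d (f (cinv c x)))"
    using smooth_at_charts[OF A B f c d] by blast
  have p: "cinv c (snd c p) = p" by (rule cinv_chart[OF A cA(1,2)])
  \<comment> \<open>Passing through the coordinates of \<open>d\<close> and back changes nothing on
    \<open>W\<close>, where \<open>f\<close> stays in the chart domain, and a derivative sees only a
    neighbourhood.\<close>
  have "frechet_derivative (\<lambda>x. h (f (cinv c x))) (at (snd c p)) =
      frechet_derivative (\<lambda>x. h (cinv d (snd d (f (cinv c x))))) (at (snd c p))"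
    by (rule frechet_derivative_cong_open[OF W(1,2)]) (simp add: cinv_chart[OF B cA(5) W(4)])
  moreover have "frechet_derivative (\<lambda>x. h (cinv d (snd d (f (cinv c x))))) (at (snd c p)) v =
    frechet_derivative (\<lambda>y. h (cinv d y)) (at (snd d (f (cinv c (snd c p)))))
      (frechet_derivative (\<lambda>x. snd d (f (cinv c x))) (at (snd c p)) v)"
  proof (rule frechet_derivative_chain[of "\<lambda>x. snd d (f (cinv c x))" _ "\<lambda>y. h (cinv d y)"])
    show "((\<lambda>x. snd d (f (cinv c x))) has_derivative
        frechet_derivative (\<lambda>x. snd d (f (cinv c x))) (at (snd c p))) (at (snd c p))"
      by (rule smooth_at_has_derivative[OF smooth_at_rep[OF A B f c d]])
    show "((\<lambda>y. h (cinv d y)) has_derivative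
        frechet_derivative (\<lambda>y. h (cinv d y)) (at (snd d (f (cinv c (snd c p))))))
        (at (snd d (f (cinv c (snd c p)))))"
      unfolding p
      by (rule smooth_at_has_derivative[OF smooth_at_local_rep[OF B B smooth_atlas_vspace
            smooth_at_id[OF B cA(8)] d h]])
  qed
  ultimately show ?thesis by (simp add: p)
qed

lemma frechet_derivative_chart_self:
  assumes A: "smooth_atlas A" and c: "chart_around A p c"
  shows "frechet_derivative (\<lambda>x. snd c (cinv c x)) (at (snd c p)) v = v"
proof -
  note cA = chart_aroundD[OF c]
  have "frechet_derivative (\<lambda>x. snd c (cinv c x)) (at (snd c p)) = frechet_derivative (\<lambda>x. x) (at (snd c p))"
    by (rule frechet_derivative_cong_open[OF smooth_atlas_open_cran[OF A cA(1)] cA(3) chart_cinv])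
  also have "\<dots> = (\<lambda>x. x)" by (metis frechet_derivative_at has_derivative_ident)
  finally show ?thesis by simp
qed

section \<open>Tangent spaces in coordinates\<close>

lemma tspace_iff:
  "v \<in> tspace A p \<longleftrightarrow> fst v = p \<and>
     (\<forall>c d. chart_around A p c \<and> chart_around A p d \<longrightarrow>
        snd v d = frechet_derivative (\<lambda>x. snd d (cinv c x)) (at (snd c p)) (snd v c)) \<and>
     (\<forall>c. \<not> chart_around A p c \<longrightarrow> snd v c = 0)"
proof -
  have "(\<exists>w. v = (p, w) \<and> P w) \<longleftrightarrow> fst v = p \<and> P (snd v)" for P by (cases v) auto
  then show ?thesis unfolding tspace_def mem_Collect_eq comp_def by (rule trans) (rule refl)
qed

lemma tspaceD:
  assumes "v \<in> tspace A p"
  shows "fst v = p"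
    and "chart_around A p c \<Longrightarrow> chart_around A p d \<Longrightarrow>
      snd v d = frechet_derivative (\<lambda>x. snd d (cinv c x)) (at (snd c p)) (snd v c)"
    and "\<not> chart_around A p c \<Longrightarrow> snd v c = 0"
  using assms unfolding tspace_iff by blast+

lemma tspaceI:
  assumes "fst v = p"
    and "\<And>c d. chart_around A p c \<Longrightarrow> chart_around A p d \<Longrightarrow>
      snd v d = frechet_derivative (\<lambda>x. snd d (cinv c x)) (at (snd c p)) (snd v c)"
    and "\<And>c. \<not> chart_around A p c \<Longrightarrow> snd v c = 0"
  shows "v \<in> tspace A p"
  unfolding tspace_iff using assms by blast

text \<open>The transformation law determines all components around the point from one of them, and
  the others are 0 by convention. Equalities of tangent vectors are thus checked in a single chart
  throughout.\<close>

lemma tspace_eqI: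
  assumes v: "v \<in> tspace A p" and w: "w \<in> tspace A p" and c: "chart_around A p c" and "snd v c = snd w c"
  shows "v = w"
proof (rule prod_eqI)
  show "fst v = fst w" using tspaceD(1)[OF v] tspaceD(1)[OF w] by simp
  have "snd v d = snd w d" for d
  proof (cases "chart_around A p d")
    case True
    then show ?thesis using tspaceD(2)[OF v c True] tspaceD(2)[OF w c True] assms(4) by simp
  next
    case False
    then show ?thesis using tspaceD(3)[OF v False] tspaceD(3)[OF w False] by simp
  qed
  then show "snd v = snd w" by blast
qed

lemma linear_transition:
  assumes A: "smooth_atlas A" and c: "chart_around A p c" and d: "chart_around A p d"
  shows "linear (frechet_derivative (\<lambda>x. snd d (cinv c x)) (at (snd c p)))"
  by (rule has_derivative_linear[OF smooth_at_has_derivative[OF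
        smooth_at_rep[OF A A smooth_at_id[OF A chart_aroundD(4)[OF c]] c d]]])

text \<open>Inverse of the component map in \<open>c\<close>, for \<open>c\<close> around
  \<open>p\<close>: the other components are forced by the transformation law.\<close>

definition mkvec :: "('a, 'e::euclidean_space) atlas \<Rightarrow> ('a, 'e) chart \<Rightarrow> 'a \<Rightarrow> 'e \<Rightarrow> ('a, 'e) tvec" where
  "mkvec A c p w = (p, \<lambda>d. if chart_around A p d
     then frechet_derivative (\<lambda>x. snd d (cinv c x)) (at (snd c p)) w else 0)"

lemma fst_mkvec [simp]: "fst (mkvec A c p w) = p"
  by (simp add: mkvec_def)

lemma snd_mkvec: "smooth_atlas A \<Longrightarrow> chart_around A p c \<Longrightarrow> snd (mkvec A c p w) c = w"
  by (simp add: mkvec_def frechet_derivative_chart_self)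

lemma mkvec_in_tspace:
  assumes A: "smooth_atlas A" and c: "chart_around A p c"
  shows "mkvec A c p w \<in> tspace A p"
proof (rule tspaceI)
  fix d e assume d: "chart_around A p d" and e: "chart_around A p e"
  note p = chart_aroundD(4)[OF c]
  show "snd (mkvec A c p w) e =
      frechet_derivative (\<lambda>x. snd e (cinv d x)) (at (snd d p)) (snd (mkvec A c p w) d)"
    using local_rep_chain[OF A A smooth_at_id[OF A p] c d smooth_at_chart[OF A e]] d e
    by (simp add: mkvec_def)
qed (simp_all add: mkvec_def)

lemma mkvec_snd:
  assumes A: "smooth_atlas A" and v: "v \<in> tspace A p" and c: "chart_around A p c"
  shows "mkvec A c p (snd v c) = v"
  by (rule tspace_eqI[OF mkvec_in_tspace[OF A c] v c snd_mkvec[OF A c]])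

lemma fst_tadd [simp]: "fst (tadd v w) = fst v"
  and snd_tadd [simp]: "snd (tadd v w) c = snd v c + snd w c"
  and fst_tscale [simp]: "fst (tscale r v) = fst v"
  and snd_tscale [simp]: "snd (tscale r v) c = r *\<^sub>R snd v c"
  and fst_tminus [simp]: "fst (tminus v w) = fst v"
  and snd_tminus [simp]: "snd (tminus v w) c = snd v c - snd w c"
  and fst_tzero [simp]: "fst (tzero p) = p"
  and snd_tzero [simp]: "snd (tzero p) c = 0"
  by (simp_all add: tadd_def tscale_def tminus_def tzero_def)

lemma tvec_eqI: "fst v = fst w \<Longrightarrow> (\<And>c. snd v c = snd w c) \<Longrightarrow> v = w"
  by (rule prod_eqI) auto

lemma tadd_in_tspace:
  assumes A: "smooth_atlas A" and v: "v \<in> tspace A p" and w: "w \<in> tspace A p"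
  shows "tadd v w \<in> tspace A p"
proof (rule tspaceI)
  fix c d assume c: "chart_around A p c" and d: "chart_around A p d"
  then show "snd (tadd v w) d = frechet_derivative (\<lambda>x. snd d (cinv c x)) (at (snd c p)) (snd (tadd v w) c)"
    using tspaceD(2)[OF v c d] tspaceD(2)[OF w c d] linear_add[OF linear_transition[OF A c d]] by simp
qed (use tspaceD[OF v] tspaceD[OF w] in auto)

lemma tscale_in_tspace:
  assumes A: "smooth_atlas A" and v: "v \<in> tspace A p"
  shows "tscale r v \<in> tspace A p"
proof (rule tspaceI)
  fix c d assume c: "chart_around A p c" and d: "chart_around A p d"
  then show "snd (tscale r v) d = frechet_derivative (\<lambda>x. snd d (cinv c x)) (at (snd c p)) (snd (tscale r v) c)"
    using tspaceD(2)[OF v c d] linear_cmul[OF linear_transition[OF A c d]] by simp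
qed (use tspaceD[OF v] in auto)

lemma tminus_in_tspace:
  "smooth_atlas A \<Longrightarrow> v \<in> tspace A p \<Longrightarrow> w \<in> tspace A p \<Longrightarrow> tminus v w \<in> tspace A p"
  unfolding tminus_def by (intro tadd_in_tspace tscale_in_tspace)

lemma tzero_in_tspace:
  assumes A: "smooth_atlas A"
  shows "tzero p \<in> tspace A p"
proof (rule tspaceI)
  fix c d assume "chart_around A p c" "chart_around A p d"
  then show "snd (tzero p) d = frechet_derivative (\<lambda>x. snd d (cinv c x)) (at (snd c p)) (snd (tzero p) c)"
    using linear_0[OF linear_transition[OF A]] by simp
qed simp_all

subsection \<open>Tangent maps\<close>

lemma fst_tmap [simp]: "fst (tmap A B f v) = f (fst v)"
  by (simp add: tmap_def Let_def)

text \<open>The chart chosen inside \<open>tmap\<close> may be replaced by any chart around the base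
  point, because the components of \<open>v\<close> transform by exactly the derivative that the
  chain rule produces.\<close>

lemma snd_tmap:
  assumes A: "smooth_atlas A" and B: "smooth_atlas B" and f: "smooth_at A B f p"
    and v: "v \<in> tspace A p" and c: "chart_around A p c" and d: "chart_around B (f p) d"
  shows "snd (tmap A B f v) d = frechet_derivative (\<lambda>x. snd d (f (cinv c x))) (at (snd c p)) (snd v c)"
proof -
  define c0 where "c0 = (SOME c. chart_around A p c)"
  have c0: "chart_around A p c0" unfolding c0_def using c by (rule someI)
  note p = chart_aroundD(4)[OF c]
  have "snd (tmap A B f v) d = frechet_derivative (\<lambda>x. snd d (f (cinv c0 x))) (at (snd c0 p)) (snd v c0)"
    using d tspaceD(1)[OF v] by (simp add: tmap_def Let_def c0_def comp_def)
  also have "\<dots> = frechet_derivative (\<lambda>x. snd d (f (cinv c x))) (at (snd c p)) (snd v c)"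
    unfolding tspaceD(2)[OF v c c0]
    using local_rep_chain[OF A A smooth_at_id[OF A p] c c0
      smooth_at_compose[OF A B smooth_atlas_vspace f smooth_at_chart[OF B d]]] by simp
  finally show ?thesis .
qed

lemma snd_tmap_not: "\<not> chart_around B (f (fst v)) d \<Longrightarrow> snd (tmap A B f v) d = 0"
  by (simp add: tmap_def Let_def)

lemma tmap_in_tspace:
  assumes A: "smooth_atlas A" and B: "smooth_atlas B" and f: "smooth_at A B f p" and v: "v \<in> tspace A p"
  shows "tmap A B f v \<in> tspace B (f p)"
proof (rule tspaceI)
  obtain c where c: "chart_around A p c" using smooth_at_mcarrier(1)[OF f] by (rule obtain_chart)
  fix d e assume d: "chart_around B (f p) d" and e: "chart_around B (f p) e"
  show "snd (tmap A B f v) e =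
      frechet_derivative (\<lambda>x. snd e (cinv d x)) (at (snd d (f p))) (snd (tmap A B f v) d)"
    unfolding snd_tmap[OF A B f v c d] snd_tmap[OF A B f v c e]
    by (rule local_rep_chain[OF A B f c d smooth_at_chart[OF B e]])
qed (use tspaceD(1)[OF v] snd_tmap_not[of B f v] in auto)

lemma tmap_compose:
  assumes A: "smooth_atlas A" and B: "smooth_atlas B" and C: "smooth_atlas C"
    and f: "smooth_at A B f p" and g: "smooth_at B C g (f p)" and v: "v \<in> tspace A p"
  shows "tmap B C g (tmap A B f v) = tmap A C (\<lambda>x. g (f x)) v"
proof -
  obtain c where c: "chart_around A p c" using smooth_at_mcarrier(1)[OF f] by (rule obtain_chart)
  obtain d where d: "chart_around B (f p) d" using smooth_at_mcarrier(2)[OF f] by (rule obtain_chart)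
  obtain e where e: "chart_around C (g (f p)) e" using smooth_at_mcarrier(2)[OF g] by (rule obtain_chart)
  note gf = smooth_at_compose[OF A B C f g] and Tf = tmap_in_tspace[OF A B f v]
  show ?thesis
  proof (rule tspace_eqI[OF tmap_in_tspace[OF B C g Tf] tmap_in_tspace[OF A C gf v] e])
    show "snd (tmap B C g (tmap A B f v)) e = snd (tmap A C (\<lambda>x. g (f x)) v) e"
      unfolding snd_tmap[OF B C g Tf d e] snd_tmap[OF A C gf v c e] snd_tmap[OF A B f v c d]
      using local_rep_chain[OF A B f c d smooth_at_compose[OF B C smooth_atlas_vspace g smooth_at_chart[OF C e]]]
      by simp
  qed
qed

lemma tmap_cong:
  assumes A: "smooth_atlas A" and B: "smooth_atlas B" and g: "smooth_at A B g p"
    and eq: "\<And>x. x \<in> mcarrier A \<Longrightarrow> f x = g x" and v: "v \<in> tspace A p"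
  shows "tmap A B f v = tmap A B g v"
proof -
  have f: "smooth_at A B f p" by (rule smooth_at_cong[OF eq g])
  have fg: "f p = g p" by (rule eq[OF smooth_at_mcarrier(1)[OF f]])
  obtain c where c: "chart_around A p c" using smooth_at_mcarrier(1)[OF f] by (rule obtain_chart)
  obtain d where d: "chart_around B (f p) d" using smooth_at_mcarrier(2)[OF f] by (rule obtain_chart)
  note d' = d[unfolded fg] and cA = chart_aroundD[OF c]
  show ?thesis
  proof (rule tspace_eqI[OF tmap_in_tspace[OF A B f v] tmap_in_tspace[OF A B g v, folded fg] d])
    have "f (cinv c x) = g (cinv c x)" if "x \<in> cran c" for x
      using eq[OF chart_aroundD(4)[OF chart_around_cinv[OF cA(1) that]]] .
    then show "snd (tmap A B f v) d = snd (tmap A B g v) d"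
      unfolding snd_tmap[OF A B f v c d] snd_tmap[OF A B g v c d']
      by (subst frechet_derivative_cong_open[OF smooth_atlas_open_cran[OF A cA(1)] cA(3),
            of _ "\<lambda>x. snd d (g (cinv c x))"]) simp_all
  qed
qed

lemma tmap_id:
  assumes A: "smooth_atlas A" and p: "p \<in> mcarrier A" and v: "v \<in> tspace A p"
  shows "tmap A A (\<lambda>x. x) v = v"
proof -
  obtain c where c: "chart_around A p c" using p by (rule obtain_chart)
  note id = smooth_at_id[OF A p]
  show ?thesis
    by (rule tspace_eqI[OF tmap_in_tspace[OF A A id v] v c])
      (simp add: snd_tmap[OF A A id v c c] frechet_derivative_chart_self[OF A c])
qed

lemma tmap_tadd:
  assumes A: "smooth_atlas A" and B: "smooth_atlas B" and f: "smooth_at A B f p"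
    and v: "v \<in> tspace A p" and w: "w \<in> tspace A p"
  shows "tmap A B f (tadd v w) = tadd (tmap A B f v) (tmap A B f w)"
proof -
  obtain c where c: "chart_around A p c" using smooth_at_mcarrier(1)[OF f] by (rule obtain_chart)
  obtain d where d: "chart_around B (f p) d" using smooth_at_mcarrier(2)[OF f] by (rule obtain_chart)
  note vw = tadd_in_tspace[OF A v w]
  note lin = has_derivative_linear[OF smooth_at_has_derivative[OF smooth_at_rep[OF A B f c d]]]
  show ?thesis
    by (rule tspace_eqI[OF tmap_in_tspace[OF A B f vw]
          tadd_in_tspace[OF B tmap_in_tspace[OF A B f v] tmap_in_tspace[OF A B f w]] d])
      (simp add: snd_tmap[OF A B f v c d] snd_tmap[OF A B f w c d] snd_tmap[OF A B f vw c d] linear_add[OF lin])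
qed

lemma tmap_tscale:
  assumes A: "smooth_atlas A" and B: "smooth_atlas B" and f: "smooth_at A B f p"
    and v: "v \<in> tspace A p"
  shows "tmap A B f (tscale r v) = tscale r (tmap A B f v)"
proof -
  obtain c where c: "chart_around A p c" using smooth_at_mcarrier(1)[OF f] by (rule obtain_chart)
  obtain d where d: "chart_around B (f p) d" using smooth_at_mcarrier(2)[OF f] by (rule obtain_chart)
  note vw = tscale_in_tspace[OF A v]
  note lin = has_derivative_linear[OF smooth_at_has_derivative[OF smooth_at_rep[OF A B f c d]]]
  show ?thesis
    by (rule tspace_eqI[OF tmap_in_tspace[OF A B f vw]
          tscale_in_tspace[OF B tmap_in_tspace[OF A B f v]] d])
      (simp add: snd_tmap[OF A B f v c d] snd_tmap[OF A B f vw c d] linear_cmul[OF lin])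
qed

lemma tmap_tminus:
  assumes A: "smooth_atlas A" and B: "smooth_atlas B" and f: "smooth_at A B f p"
    and v: "v \<in> tspace A p" and w: "w \<in> tspace A p"
  shows "tmap A B f (tminus v w) = tminus (tmap A B f v) (tmap A B f w)"
  unfolding tminus_def
  using tmap_tadd[OF A B f v tscale_in_tspace[OF A w]] tmap_tscale[OF A B f w] by simp

lemma tscale_0: "tscale 0 v = tzero (fst v)"
  by (rule tvec_eqI) simp_all

subsection \<open>Velocities\<close>

text \<open>The tangent vector d/dt of the real line at 0. With it a velocity becomes the image of a
  vector under a tangent map, and velocities inherit the functoriality of
  \<open>tmap\<close>.\<close>

definition unit_vec :: "(real, real) tvec" where
  "unit_vec = (0, \<lambda>c. if c = (UNIV, id) then 1 else 0)"

lemma unit_vec_in_tspace: "unit_vec \<in> tspace vspace_atlas 0"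
proof (rule tspaceI)
  fix c d assume "chart_around vspace_atlas (0::real) c" "chart_around vspace_atlas (0::real) d"
  then show "snd unit_vec d = frechet_derivative (\<lambda>x. snd d (cinv c x)) (at (snd c 0)) (snd unit_vec c)"
    using frechet_derivative_at[OF has_derivative_ident, of "0::real"]
    by (auto simp: unit_vec_def)
qed (auto simp: unit_vec_def)

lemma vector_derivative_eq_frechet:
  assumes "(f has_derivative f') (at t)"
  shows "vector_derivative f (at t) = f' 1"
proof -
  have "f' h = h *\<^sub>R f' 1" for h
    using linear_cmul[OF has_derivative_linear[OF assms], of h 1] by simp
  then have "f' = (\<lambda>h. h *\<^sub>R f' 1)" by (rule ext)
  then have "(f has_vector_derivative f' 1) (at t)"
    unfolding has_vector_derivative_def using assms by metis
  then show ?thesis by (rule vector_derivative_at)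
qed

lemma velocity_eq_tmap:
  assumes A: "smooth_atlas A" and g: "smooth_at vspace_atlas A \<gamma> 0"
  shows "velocity A \<gamma> = tmap vspace_atlas A \<gamma> unit_vec"
proof (rule tvec_eqI)
  show "fst (velocity A \<gamma>) = fst (tmap vspace_atlas A \<gamma> unit_vec)"
    by (simp add: velocity_def unit_vec_def)
  fix c
  show "snd (velocity A \<gamma>) c = snd (tmap vspace_atlas A \<gamma> unit_vec) c"
  proof (cases "chart_around A (\<gamma> 0) c")
    case True
    have c: "chart_around vspace_atlas (0::real) (UNIV, id)" by simp
    have "vector_derivative (\<lambda>t. snd c (\<gamma> t)) (at 0) = frechet_derivative (\<lambda>t. snd c (\<gamma> t)) (at 0) 1"
      using smooth_at_rep[OF smooth_atlas_vspace A g c True]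
      by (intro vector_derivative_eq_frechet smooth_at_has_derivative) simp
    then show ?thesis
      using True snd_tmap[OF smooth_atlas_vspace A g unit_vec_in_tspace c True]
      by (simp add: velocity_def comp_def unit_vec_def)
  next
    case False
    then show ?thesis using snd_tmap_not[of A \<gamma> unit_vec c] by (simp add: velocity_def unit_vec_def)
  qed
qed

lemma velocity_in_tspace:
  assumes A: "smooth_atlas A" and g: "smooth_at vspace_atlas A \<gamma> 0"
  shows "velocity A \<gamma> \<in> tspace A (\<gamma> 0)"
  unfolding velocity_eq_tmap[OF A g] by (rule tmap_in_tspace[OF smooth_atlas_vspace A g unit_vec_in_tspace])

lemma snd_velocity: "chart_around A (\<gamma> 0) c \<Longrightarrow> snd (velocity A \<gamma>) c = vector_derivative (\<lambda>t. snd c (\<gamma> t)) (at 0)"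
  by (simp add: velocity_def comp_def)

lemma tmap_velocity:
  assumes A: "smooth_atlas A" and B: "smooth_atlas B"
    and g: "smooth_at vspace_atlas A \<gamma> 0" and f: "smooth_at A B f (\<gamma> 0)"
  shows "tmap A B f (velocity A \<gamma>) = velocity B (\<lambda>t. f (\<gamma> t))"
  unfolding velocity_eq_tmap[OF A g]
    velocity_eq_tmap[OF B smooth_at_compose[OF smooth_atlas_vspace A B g f]]
  by (rule tmap_compose[OF smooth_atlas_vspace A B g f unit_vec_in_tspace])

subsection \<open>The tangent bundle\<close>

definition tchart :: "('a, 'e::euclidean_space) atlas \<Rightarrow> ('a, 'e) chart \<Rightarrow> (('a, 'e) tvec, 'e \<times> 'e) chart" where
  "tchart A c = ({u \<in> tbundle A. fst u \<in> fst c}, \<lambda>u. (snd c (fst u), snd u c))"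

lemma snd_tchart [simp]: "snd (tchart A c) u = (snd c (fst u), snd u c)"
  by (simp add: tchart_def)

lemma fst_tchart [simp]: "u \<in> fst (tchart A c) \<longleftrightarrow> u \<in> tbundle A \<and> fst u \<in> fst c"
  by (simp add: tchart_def)

lemma tbundle_atlas_eq: "tbundle_atlas A = tchart A ` A"
  by (force simp: tbundle_atlas_def tchart_def)

lemma tbundle_iff: "u \<in> tbundle A \<longleftrightarrow> fst u \<in> mcarrier A \<and> u \<in> tspace A (fst u)"
  unfolding tbundle_def using tspaceD(1) by fastforce

lemma tspace_tbundle: "u \<in> tspace A p \<Longrightarrow> p \<in> mcarrier A \<Longrightarrow> u \<in> tbundle A"
  using tspaceD(1)[of u A p] by (simp add: tbundle_iff)

lemma chart_around_tchart: "u \<in> tbundle A \<Longrightarrow> chart_around A (fst u) c \<Longrightarrow> chart_around (tbundle_atlas A) u (tchart A c)"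
  by (simp add: chart_around_def tbundle_atlas_eq)

lemma mcarrier_tbundle [simp]: "mcarrier (tbundle_atlas A) = tbundle A"
proof -
  have "u \<in> mcarrier (tbundle_atlas A)" if "u \<in> tbundle A" for u
    using that obtain_chart[of "fst u" A] chart_aroundD(4)[OF chart_around_tchart[OF that]]
    by (metis tbundle_iff)
  moreover have "u \<in> tbundle A" if "u \<in> mcarrier (tbundle_atlas A)" for u
    using that by (auto simp: mcarrier_def tbundle_atlas_eq)
  ultimately show ?thesis by blast
qed

lemma mkvec_in_tbundle:
  "smooth_atlas A \<Longrightarrow> c \<in> A \<Longrightarrow> x \<in> cran c \<Longrightarrow> mkvec A c (cinv c x) w \<in> tbundle A"
  by (rule tspace_tbundle[OF mkvec_in_tspace[OF _ chart_around_cinv] chart_aroundD(4)[OF chart_around_cinv]])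

lemma inj_on_tchart:
  assumes A: "smooth_atlas A" and c: "c \<in> A"
  shows "inj_on (snd (tchart A c)) (fst (tchart A c))"
proof (rule inj_onI)
  fix u v assume u: "u \<in> fst (tchart A c)" and v: "v \<in> fst (tchart A c)"
    and eq: "snd (tchart A c) u = snd (tchart A c) v"
  then have p: "fst u = fst v" using smooth_atlas_inj[OF A c] by (auto dest: inj_onD)
  show "u = v"
    by (rule tspace_eqI[of _ A "fst u" _ c]) (use u v eq p c in \<open>auto simp: tbundle_iff chart_around_def\<close>)
qed

lemma cran_tchart:
  assumes A: "smooth_atlas A" and c: "c \<in> A"
  shows "snd (tchart A c) ` (fst (tchart A c) \<inter> {u. fst u \<in> V}) = (snd c ` (fst c \<inter> V)) \<times> UNIV"
proof (intro equalityI subsetI)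
  fix y assume "y \<in> (snd c ` (fst c \<inter> V)) \<times> (UNIV :: 'b set)"
  then obtain p w where p: "y = (snd c p, w)" "p \<in> fst c" "p \<in> V" by auto
  then have cp: "chart_around A p c" using c by (simp add: chart_around_def)
  have "mkvec A c p w \<in> tbundle A"
    by (rule tspace_tbundle[OF mkvec_in_tspace[OF A cp] chart_aroundD(4)[OF cp]])
  then show "y \<in> snd (tchart A c) ` (fst (tchart A c) \<inter> {u. fst u \<in> V})"
    using p snd_mkvec[OF A cp] by (intro image_eqI[of _ _ "mkvec A c p w"]) auto
qed auto

lemma cinv_tchart:
  assumes A: "smooth_atlas A" and c: "c \<in> A" and x: "x \<in> cran c"
  shows "cinv (tchart A c) (x, w) = mkvec A c (cinv c x) w"
  by (rule inv_into_f_eq[OF inj_on_tchart[OF A c]])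
    (use mkvec_in_tbundle[OF A c x] snd_mkvec[OF A chart_around_cinv[OF c x]] cinv_in[OF x] chart_cinv[OF x] in auto)

text \<open>A change of charts acts on base points by the transition map and on fibres by its
  derivative; \<open>smooth_on_frechet_derivative\<close> gives smoothness jointly in point and
  vector.\<close>

lemma smooth_atlas_tbundle:
  assumes A: "smooth_atlas A"
  shows "smooth_atlas (tbundle_atlas A)"
proof (rule smooth_atlasI)
  fix e assume "e \<in> tbundle_atlas A"
  then obtain c where e: "e = tchart A c" "c \<in> A" by (auto simp: tbundle_atlas_eq)
  show "inj_on (snd e) (fst e)" using inj_on_tchart[OF A e(2)] e(1) by simp
  show "open (cran e)"
    using cran_tchart[OF A e(2), of UNIV] smooth_atlas_open_cran[OF A e(2)] e(1) by (simp add: open_Times)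
next
  fix e e' assume "e \<in> tbundle_atlas A" "e' \<in> tbundle_atlas A"
  then obtain c d where e: "e = tchart A c" "c \<in> A" and d: "e' = tchart A d" "d \<in> A"
    by (auto simp: tbundle_atlas_eq)
  note t = smooth_atlas_transition[OF A e(2) d(2)]
  let ?S = "snd c ` (fst c \<inter> fst d)"
  have "fst e \<inter> fst e' = fst e \<inter> {u. fst u \<in> fst d}" by (auto simp: e d)
  then have im: "snd e ` (fst e \<inter> fst e') = ?S \<times> UNIV"
    using cran_tchart[OF A e(2), of "fst d"] e(1) by simp
  have o: "open (?S \<times> (UNIV :: 'b set))" using t(1) open_UNIV by (rule open_Times)
  then show "open (snd e ` (fst e \<inter> fst e'))" by (simp add: im)
  have "smooth_on (?S \<times> UNIV) (\<lambda>x. (snd d (cinv c (fst x)),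
      frechet_derivative (\<lambda>x. snd d (cinv c x)) (at (fst x)) (snd x)))"
    by (intro smooth_on_Pair[OF o] smooth_on_compose[OF o t(1) smooth_on_fst[OF o] t(2)]
        smooth_on_frechet_derivative[OF t(1) t(2) o] smooth_on_fst[OF o] smooth_on_snd[OF o]) auto
  then show "smooth_on (snd e ` (fst e \<inter> fst e')) (\<lambda>x. snd e' (cinv e x))"
    unfolding im
  proof (rule smooth_on_eq[OF o])
    fix y :: "'b \<times> 'b" assume y: "y \<in> ?S \<times> UNIV"
    then have y1: "fst y \<in> cran c" "cinv c (fst y) \<in> fst d"
      using cinv_chart[OF A e(2)] by auto
    have "chart_around A (cinv c (fst y)) d" using y1(2) d(2) by (simp add: chart_around_def)
    then show "snd e' (cinv e y) = (snd d (cinv c (fst y)),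
      frechet_derivative (\<lambda>x. snd d (cinv c x)) (at (fst y)) (snd y))"
      using cinv_tchart[OF A e(2) y1(1), of "snd y"] chart_cinv[OF y1(1)]
      by (simp add: e(1) d(1)) (simp add: mkvec_def)
  qed
qed

lemma smooth_at_tbundle_fst:
  assumes A: "smooth_atlas A" and u: "u \<in> tbundle A"
  shows "smooth_at (tbundle_atlas A) A fst u"
proof -
  have "fst u \<in> mcarrier A" using u by (simp add: tbundle_iff)
  then obtain c where c: "chart_around A (fst u) c" by (rule obtain_chart)
  note cA = chart_aroundD[OF c] and uc = chart_around_tchart[OF u c]
  have ran: "cran (tchart A c) = cran c \<times> UNIV" using cran_tchart[OF A cA(1), of UNIV] by simp
  have o: "open (cran (tchart A c))"
    by (rule smooth_atlas_open_cran[OF smooth_atlas_tbundle[OF A] chart_aroundD(1)[OF uc]])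
  have eq: "fst (cinv (tchart A c) y) = cinv c (fst y)" if "y \<in> cran (tchart A c)" for y
    using that cinv_tchart[OF A cA(1), of "fst y" "snd y"] by (auto simp: ran)
  show ?thesis
  proof (rule smooth_atI[OF uc c o])
    show "smooth_on (cran (tchart A c)) (\<lambda>y. snd c (fst (cinv (tchart A c) y)))"
      by (rule smooth_on_eq[OF o smooth_on_fst[OF o]]) (auto simp: eq ran chart_cinv)
  qed (use chart_aroundD(3)[OF uc] eq ran cinv_in[of _ c] in auto)
qed

lemma smooth_at_tbundle_snd:
  assumes A: "smooth_atlas A" and u: "u \<in> tbundle A" and c: "chart_around A (fst u) c"
  shows "smooth_at (tbundle_atlas A) vspace_atlas (\<lambda>u. snd u c) u"
proof -
  note cA = chart_aroundD[OF c] and uc = chart_around_tchart[OF u c]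
  have o: "open (cran (tchart A c))"
    by (rule smooth_atlas_open_cran[OF smooth_atlas_tbundle[OF A] chart_aroundD(1)[OF uc]])
  show ?thesis
  proof (rule smooth_at_vspaceI[OF uc o])
    show "smooth_on (cran (tchart A c)) (\<lambda>y. snd (cinv (tchart A c) y) c)"
    proof (rule smooth_on_eq[OF o smooth_on_snd[OF o]])
      fix y assume "y \<in> cran (tchart A c)"
      from chart_cinv[OF this] show "snd (cinv (tchart A c) y) c = snd y" by (metis snd_conv snd_tchart)
    qed
  qed (use chart_aroundD(3)[OF uc] in auto)
qed

lemma smooth_at_tbundleI:
  assumes A: "smooth_atlas A" and B: "smooth_atlas B"
    and f: "\<And>x. x \<in> mcarrier B \<Longrightarrow> f x \<in> tbundle A"
    and f1: "smooth_at B A (\<lambda>x. fst (f x)) q" and c: "chart_around A (fst (f q)) c"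
    and f2: "smooth_at B vspace_atlas (\<lambda>x. snd (f x) c) q"
  shows "smooth_at B (tbundle_atlas A) f q"
proof -
  note q = smooth_at_mcarrier(1)[OF f1]
  obtain e where e: "chart_around B q e" using q by (rule obtain_chart)
  note eB = chart_aroundD[OF e]
  obtain W where W: "open W" "snd e q \<in> W" "W \<subseteq> cran e" "\<And>x. x \<in> W \<Longrightarrow> fst (f (cinv e x)) \<in> fst c"
    "smooth_on W (\<lambda>x. snd c (fst (f (cinv e x))))"
    using smooth_at_charts[OF B A f1 e c] by blast
  obtain V where V: "open V" "snd e q \<in> V" "V \<subseteq> cran e" "smooth_on V (\<lambda>x. snd (f (cinv e x)) c)"
    using smooth_at_vspace_charts[OF B f2 e] by blast
  have o: "open (W \<inter> V)" using W(1) V(1) by (rule open_Int)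
  show ?thesis
  proof (rule smooth_atI[OF e chart_around_tchart[OF f[OF q] c] o])
    show "f (cinv e x) \<in> fst (tchart A c)" if "x \<in> W \<inter> V" for x
      using f[OF chart_aroundD(4)[OF chart_around_cinv[OF eB(1)]]] that W(3,4) by auto
    show "smooth_on (W \<inter> V) (\<lambda>x. snd (tchart A c) (f (cinv e x)))"
      using smooth_on_Pair[OF o smooth_on_subset[OF W(5)] smooth_on_subset[OF V(4)]] by simp
  qed (use W V in auto)
qed

lemma smooth_at_tmap:
  assumes A: "smooth_atlas A" and B: "smooth_atlas B"
    and f: "\<And>p. p \<in> mcarrier A \<Longrightarrow> smooth_at A B f p" and u: "u \<in> tbundle A"
  shows "smooth_at (tbundle_atlas A) (tbundle_atlas B) (tmap A B f) u"
proof -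
  have p: "fst u \<in> mcarrier A" using u by (simp add: tbundle_iff)
  note TA = smooth_atlas_tbundle[OF A]
  obtain c where c: "chart_around A (fst u) c" using p by (rule obtain_chart)
  obtain d where d: "chart_around B (f (fst u)) d"
    using smooth_at_mcarrier(2)[OF f[OF p]] by (rule obtain_chart)
  note cA = chart_aroundD[OF c] chart_aroundD[OF d] and uc = chart_around_tchart[OF u c]
  obtain W where W: "open W" "snd c (fst u) \<in> W" "W \<subseteq> cran c" "\<And>x. x \<in> W \<Longrightarrow> f (cinv c x) \<in> fst d"
    "smooth_on W (\<lambda>x. snd d (f (cinv c x)))"
    using smooth_at_charts[OF A B f[OF p] c d] by blast
  have ran: "cran (tchart A c) = cran c \<times> UNIV" using cran_tchart[OF A cA(1), of UNIV] by simp
  have o: "open (W \<times> (UNIV :: 'b set))" using W(1) open_UNIV by (rule open_Times)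
  show ?thesis
  proof (rule smooth_at_tbundleI[OF B TA])
    fix v assume "v \<in> mcarrier (tbundle_atlas A)"
    then have v: "v \<in> tspace A (fst v)" "fst v \<in> mcarrier A" by (simp_all add: tbundle_iff)
    show "tmap A B f v \<in> tbundle B"
      using tspace_tbundle[OF tmap_in_tspace[OF A B f[OF v(2)] v(1)] smooth_at_mcarrier(2)[OF f[OF v(2)]]] .
  next
    show "smooth_at (tbundle_atlas A) B (\<lambda>x. fst (tmap A B f x)) u"
      using smooth_at_compose[OF TA A B smooth_at_tbundle_fst[OF A u] f[OF p]] by simp
    show "chart_around B (fst (tmap A B f u)) d" using d by simp
    show "smooth_at (tbundle_atlas A) vspace_atlas (\<lambda>x. snd (tmap A B f x) d) u"
    proof (rule smooth_at_vspaceI[OF uc o])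
      have "smooth_on (W \<times> UNIV) (\<lambda>y. frechet_derivative (\<lambda>x. snd d (f (cinv c x))) (at (fst y)) (snd y))"
        by (rule smooth_on_frechet_derivative[OF W(1,5) o smooth_on_fst[OF o] smooth_on_snd[OF o]]) auto
      then show "smooth_on (W \<times> UNIV) (\<lambda>y. snd (tmap A B f (cinv (tchart A c) y)) d)"
      proof (rule smooth_on_eq[OF o])
        fix y :: "'b \<times> 'b" assume y: "y \<in> W \<times> UNIV"
        then have y1: "fst y \<in> cran c" and fy: "f (cinv c (fst y)) \<in> fst d" using W(3,4) by auto
        note cy = chart_around_cinv[OF cA(1) y1]
        have dy: "chart_around B (f (cinv c (fst y))) d" using fy cA(5) by (simp add: chart_around_def)
        show "snd (tmap A B f (cinv (tchart A c) y)) d =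
            frechet_derivative (\<lambda>x. snd d (f (cinv c x))) (at (fst y)) (snd y)"
          using cinv_tchart[OF A cA(1) y1, of "snd y"]
            snd_tmap[OF A B f[OF chart_aroundD(4)[OF cy]] mkvec_in_tspace[OF A cy] cy dy]
          by (simp add: snd_mkvec[OF A cy] chart_cinv[OF y1])
      qed
    qed (use W ran in auto)
  qed
qed

section \<open>Vector fields\<close>

lemma vfieldsD:
  assumes "smooth_atlas A" "X \<in> vfields A"
  shows "X \<in> extensional (mcarrier A)"
    and "p \<in> mcarrier A \<Longrightarrow> X p \<in> tspace A p"
    and "p \<in> mcarrier A \<Longrightarrow> X p \<in> tbundle A"
    and "p \<in> mcarrier A \<Longrightarrow> fst (X p) = p"
    and "p \<in> mcarrier A \<Longrightarrow> smooth_at A (tbundle_atlas A) X p"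
  using assms tspace_tbundle[of "X p" A p] tspaceD(1)[of "X p" A p]
    smooth_map_imp_smooth_at[OF assms(1) smooth_atlas_tbundle[OF assms(1)]]
  by (auto simp: vfields_def)

lemma smooth_at_vf_component:
  assumes A: "smooth_atlas A" and X: "X \<in> vfields A" and c: "chart_around A p c"
  shows "smooth_at A vspace_atlas (\<lambda>q. snd (X q) c) p"
proof -
  note p = chart_aroundD(4)[OF c]
  have "chart_around A (fst (X p)) c" using c vfieldsD(4)[OF A X p] by simp
  from smooth_at_tbundle_snd[OF A vfieldsD(3)[OF A X p] this] show ?thesis
    by (rule smooth_at_compose[OF A smooth_atlas_tbundle[OF A] smooth_atlas_vspace vfieldsD(5)[OF A X p]])
qed

lemma vfieldsI:
  assumes A: "smooth_atlas A" and X: "X \<in> extensional (mcarrier A)"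
    and t: "\<And>p. p \<in> mcarrier A \<Longrightarrow> X p \<in> tspace A p"
    and s: "\<And>p. p \<in> mcarrier A \<Longrightarrow> \<exists>c. chart_around A p c \<and> smooth_at A vspace_atlas (\<lambda>q. snd (X q) c) p"
  shows "X \<in> vfields A"
proof -
  have fst: "fst (X p) = p" if "p \<in> mcarrier A" for p using tspaceD(1)[OF t[OF that]] .
  have "smooth_at A (tbundle_atlas A) X p" if p: "p \<in> mcarrier A" for p
  proof -
    obtain c where c: "chart_around A p c" "smooth_at A vspace_atlas (\<lambda>q. snd (X q) c) p"
      using s[OF p] by blast
    show ?thesis
    proof (rule smooth_at_tbundleI[OF A A _ _ _ c(2)])
      show "X x \<in> tbundle A" if "x \<in> mcarrier A" for x using tspace_tbundle[OF t[OF that] that] .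
      show "smooth_at A A (\<lambda>x. fst (X x)) p" by (rule smooth_at_cong[OF fst smooth_at_id[OF A p]])
      show "chart_around A (fst (X p)) c" using c(1) fst[OF p] by simp
    qed
  qed
  then have "smooth_map A (tbundle_atlas A) X" by (rule smooth_mapI[OF A smooth_atlas_tbundle[OF A]])
  then show ?thesis using X t by (simp add: vfields_def)
qed

lemma vfieldsI_smooth:
  assumes A: "smooth_atlas A" and X: "X \<in> extensional (mcarrier A)"
    and t: "\<And>p. p \<in> mcarrier A \<Longrightarrow> X p \<in> tspace A p"
    and s: "\<And>p. p \<in> mcarrier A \<Longrightarrow> smooth_at A (tbundle_atlas A) X p"
  shows "X \<in> vfields A"
  unfolding vfields_def using X t smooth_mapI[OF A smooth_atlas_tbundle[OF A] s] by simp

lemma smooth_fun_iff: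
  assumes A: "smooth_atlas A"
  shows "smooth_fun A f \<longleftrightarrow> (\<forall>p\<in>mcarrier A. smooth_at A vspace_atlas f p)"
  unfolding smooth_fun_def real_atlas_def
  using smooth_mapI[OF A smooth_atlas_vspace] smooth_map_imp_smooth_at[OF A smooth_atlas_vspace] by blast

lemma smooth_fun_const: "smooth_atlas A \<Longrightarrow> smooth_fun A (\<lambda>_. r)"
  by (simp add: smooth_fun_iff smooth_at_const)

lemma vf_add_apply [simp]: "p \<in> mcarrier A \<Longrightarrow> vf_add A X Y p = tadd (X p) (Y p)"
  and vf_scale_apply [simp]: "p \<in> mcarrier A \<Longrightarrow> vf_scale A f X p = tscale (f p) (X p)"
  and vf_zero_apply [simp]: "p \<in> mcarrier A \<Longrightarrow> vf_zero A p = tzero p"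
  and vf_apply_apply [simp]: "p \<in> mcarrier A \<Longrightarrow> vf_apply A J X p = J (X p)"
  by (simp_all add: vf_add_def vf_scale_def vf_zero_def vf_apply_def)

lemma vf_extensional [simp]: "vf_add A X Y \<in> extensional (mcarrier A)"
  "vf_scale A f X \<in> extensional (mcarrier A)" "vf_zero A \<in> extensional (mcarrier A)"
  "vf_apply A J X \<in> extensional (mcarrier A)" "push B A F Z \<in> extensional (mcarrier A)"
  by (simp_all add: vf_add_def vf_scale_def vf_zero_def vf_apply_def push_def)

lemma vf_add_in_vfields:
  assumes A: "smooth_atlas A" and X: "X \<in> vfields A" and Y: "Y \<in> vfields A"
  shows "vf_add A X Y \<in> vfields A"
proof (rule vfieldsI[OF A])
  fix p assume p: "p \<in> mcarrier A"
  then show "vf_add A X Y p \<in> tspace A p"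
    by (simp add: tadd_in_tspace[OF A vfieldsD(2)[OF A X p] vfieldsD(2)[OF A Y p]])
  obtain c where c: "chart_around A p c" using p by (rule obtain_chart)
  have "smooth_at A vspace_atlas (\<lambda>q. snd (vf_add A X Y q) c) p"
    by (rule smooth_at_cong[OF _ smooth_at_add[OF A smooth_at_vf_component[OF A X c]
          smooth_at_vf_component[OF A Y c]]]) simp
  then show "\<exists>c. chart_around A p c \<and> smooth_at A vspace_atlas (\<lambda>q. snd (vf_add A X Y q) c) p"
    using c by blast
qed simp

lemma vf_scale_in_vfields:
  assumes A: "smooth_atlas A" and f: "smooth_fun A f" and X: "X \<in> vfields A"
  shows "vf_scale A f X \<in> vfields A"
proof (rule vfieldsI[OF A])
  fix p assume p: "p \<in> mcarrier A"
  then show "vf_scale A f X p \<in> tspace A p"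
    by (simp add: tscale_in_tspace[OF A vfieldsD(2)[OF A X p]])
  obtain c where c: "chart_around A p c" using p by (rule obtain_chart)
  have "smooth_at A vspace_atlas f p" using f p smooth_fun_iff[OF A] by blast
  from smooth_at_bilinear[OF A this smooth_at_vf_component[OF A X c] bounded_bilinear_scaleR]
  have "smooth_at A vspace_atlas (\<lambda>q. snd (vf_scale A f X q) c) p"
    by (rule smooth_at_cong[rotated]) simp
  then show "\<exists>c. chart_around A p c \<and> smooth_at A vspace_atlas (\<lambda>q. snd (vf_scale A f X q) c) p"
    using c by blast
qed simp

lemma vf_deriv_eq:
  assumes A: "smooth_atlas A" and X: "X \<in> vfields A" and f: "smooth_at A vspace_atlas f p"
    and c: "chart_around A p c"
  shows "vf_deriv A X f p = frechet_derivative (\<lambda>x. f (cinv c x)) (at (snd c p)) (snd (X p) c)"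
  unfolding vf_deriv_def real_atlas_def
  using snd_tmap[OF A smooth_atlas_vspace f vfieldsD(2)[OF A X chart_aroundD(4)[OF c]] c, of "(UNIV, id)"]
  by simp

subsection \<open>Push-forward\<close>

text \<open>The inverse \<open>H\<close> is carried explicitly, so that the \<open>inv_into\<close>
  in \<open>push\<close> can be replaced by a map known to be smooth.\<close>

definition diffeo ::
  "('a, 'e::euclidean_space) atlas \<Rightarrow> ('b, 'f::euclidean_space) atlas \<Rightarrow> ('a \<Rightarrow> 'b) \<Rightarrow> ('b \<Rightarrow> 'a) \<Rightarrow> bool" where
  "diffeo A B F H \<longleftrightarrow>
     (\<forall>x\<in>mcarrier A. smooth_at A B F x \<and> H (F x) = x) \<and>
     (\<forall>y\<in>mcarrier B. smooth_at B A H y \<and> F (H y) = y)"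

lemma diffeoD:
  assumes "diffeo A B F H"
  shows "x \<in> mcarrier A \<Longrightarrow> smooth_at A B F x" "x \<in> mcarrier A \<Longrightarrow> H (F x) = x"
    "x \<in> mcarrier A \<Longrightarrow> F x \<in> mcarrier B"
    "y \<in> mcarrier B \<Longrightarrow> smooth_at B A H y" "y \<in> mcarrier B \<Longrightarrow> F (H y) = y"
    "y \<in> mcarrier B \<Longrightarrow> H y \<in> mcarrier A"
  using assms smooth_at_mcarrier(2)[of A B F x] smooth_at_mcarrier(2)[of B A H y]
  by (auto simp: diffeo_def)

lemma push_apply:
  assumes d: "diffeo A B F H" and y: "y \<in> mcarrier B"
  shows "push A B F X y = tmap A B F (X (H y))"
proof -
  have "inj_on F (mcarrier A)" using diffeoD(2)[OF d] by (rule inj_on_inverseI)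
  then have "inv_into (mcarrier A) F y = H y"
    by (rule inv_into_f_eq) (rule diffeoD(6,5)[OF d y])+
  then show ?thesis using y by (simp add: push_def)
qed

lemma push_in_vfields:
  assumes A: "smooth_atlas A" and B: "smooth_atlas B" and d: "diffeo A B F H" and X: "X \<in> vfields A"
  shows "push A B F X \<in> vfields B"
proof (rule vfieldsI_smooth[OF B])
  note TA = smooth_atlas_tbundle[OF A] and TB = smooth_atlas_tbundle[OF B]
  fix y assume y: "y \<in> mcarrier B"
  note H = diffeoD(6)[OF d y]
  show "push A B F X y \<in> tspace B y"
    using tmap_in_tspace[OF A B diffeoD(1)[OF d H] vfieldsD(2)[OF A X H]] diffeoD(5)[OF d y]
    by (simp add: push_apply[OF d y])
  have "smooth_at B (tbundle_atlas B) (\<lambda>y. tmap A B F (X (H y))) y"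
    by (rule smooth_at_compose[OF B TA TB smooth_at_compose[OF B A TA diffeoD(4)[OF d y] vfieldsD(5)[OF A X H]]
          smooth_at_tmap[OF A B diffeoD(1)[OF d] vfieldsD(3)[OF A X H]]])
  then show "smooth_at B (tbundle_atlas B) (push A B F X) y"
    by (rule smooth_at_cong[rotated]) (rule push_apply[OF d])
qed simp

lemma push_add:
  assumes A: "smooth_atlas A" and B: "smooth_atlas B" and d: "diffeo A B F H"
    and X: "X \<in> vfields A" and Y: "Y \<in> vfields A"
  shows "push A B F (vf_add A X Y) = vf_add B (push A B F X) (push A B F Y)"
proof (rule extensionalityI)
  fix y assume y: "y \<in> mcarrier B"
  note H = diffeoD(6)[OF d y]
  show "push A B F (vf_add A X Y) y = vf_add B (push A B F X) (push A B F Y) y"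
    using y H by (simp add: push_apply[OF d y]
        tmap_tadd[OF A B diffeoD(1)[OF d H] vfieldsD(2)[OF A X H] vfieldsD(2)[OF A Y H]])
qed simp_all

lemma push_scale:
  assumes A: "smooth_atlas A" and B: "smooth_atlas B" and d: "diffeo A B F H" and X: "X \<in> vfields A"
  shows "push A B F (vf_scale A f X) = vf_scale B (\<lambda>y. f (H y)) (push A B F X)"
proof (rule extensionalityI)
  fix y assume y: "y \<in> mcarrier B"
  note H = diffeoD(6)[OF d y]
  show "push A B F (vf_scale A f X) y = vf_scale B (\<lambda>y. f (H y)) (push A B F X) y"
    using y H by (simp add: push_apply[OF d y]
        tmap_tscale[OF A B diffeoD(1)[OF d H] vfieldsD(2)[OF A X H]])
qed simp_all

lemma smooth_fun_push:
  assumes A: "smooth_atlas A" and B: "smooth_atlas B" and d: "diffeo A B F H" and f: "smooth_fun A f"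
  shows "smooth_fun B (\<lambda>y. f (H y))"
  unfolding smooth_fun_iff[OF B]
proof
  fix y assume y: "y \<in> mcarrier B"
  have "smooth_at A vspace_atlas f (H y)"
    using f smooth_fun_iff[OF A] diffeoD(6)[OF d y] by blast
  then show "smooth_at B vspace_atlas (\<lambda>y. f (H y)) y"
    by (rule smooth_at_compose[OF B A smooth_atlas_vspace diffeoD(4)[OF d y]])
qed

text \<open>Functoriality of tangent maps: applying the tangent map of f after H to the image of a
  vector under that of F gives the tangent map of f, since H undoes F. This is the term needed for
  the Leibniz rule after push-forward.\<close>

lemma vf_deriv_push:
  assumes A: "smooth_atlas A" and B: "smooth_atlas B" and d: "diffeo A B F H" and f: "smooth_fun A f"
    and X: "X \<in> vfields A" and y: "y \<in> mcarrier B"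
  shows "vf_deriv B (push A B F X) (\<lambda>y. f (H y)) y = vf_deriv A X f (H y)"
proof -
  note H = diffeoD(6)[OF d y]
  have f': "smooth_at A vspace_atlas f (H y)" using f smooth_fun_iff[OF A] H by blast
  have fH: "smooth_at B vspace_atlas (\<lambda>y. f (H y)) (F (H y))"
    using smooth_at_compose[OF B A smooth_atlas_vspace diffeoD(4)[OF d y] f'] diffeoD(5)[OF d y] by simp
  have "tmap B vspace_atlas (\<lambda>y. f (H y)) (push A B F X y) =
      tmap A vspace_atlas (\<lambda>x. f (H (F x))) (X (H y))"
    unfolding push_apply[OF d y]
    by (rule tmap_compose[OF A B smooth_atlas_vspace diffeoD(1)[OF d H] fH vfieldsD(2)[OF A X H]])
  also have "\<dots> = tmap A vspace_atlas f (X (H y))"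
    by (rule tmap_cong[OF A smooth_atlas_vspace f' _ vfieldsD(2)[OF A X H]]) (simp add: diffeoD(2)[OF d])
  finally show ?thesis by (simp add: vf_deriv_def real_atlas_def)
qed

subsection \<open>Frames\<close>

text \<open>A frame is given as a linear map from the model space to global fields instead of an
  indexed family. Only surjectivity at each point is required; injectivity follows from the
  dimension.\<close>

definition frame :: "('a, 'e::euclidean_space) atlas \<Rightarrow> ('e \<Rightarrow> ('a, 'e) vfield) \<Rightarrow> bool" where
  "frame A E \<longleftrightarrow>
     (\<forall>v. E v \<in> vfields A) \<and>
     (\<forall>v w. E (v + w) = vf_add A (E v) (E w)) \<and>
     (\<forall>r v. E (r *\<^sub>R v) = vf_scale A (\<lambda>_. r) (E v)) \<and>
     (\<forall>p\<in>mcarrier A. \<forall>\<xi>\<in>tspace A p. \<exists>v. E v p = \<xi>)"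

lemma frameD:
  assumes "frame A E"
  shows "E v \<in> vfields A" "E (v + w) = vf_add A (E v) (E w)" "E (r *\<^sub>R v) = vf_scale A (\<lambda>_. r) (E v)"
    "p \<in> mcarrier A \<Longrightarrow> \<xi> \<in> tspace A p \<Longrightarrow> \<exists>v. E v p = \<xi>"
  using assms by (auto simp: frame_def)

lemma frame_linear:
  assumes "frame A E" "p \<in> mcarrier A"
  shows "linear (\<lambda>v. snd (E v p) c)"
  by (rule linearI) (simp_all add: frameD[OF assms(1)] assms(2))

text \<open>Evaluation at \<open>p\<close> followed by the component in a chart is a linear
  surjection of \<open>'e\<close> onto itself, hence injective.\<close>

lemma frame_inj:
  fixes A :: "('a, 'e::euclidean_space) atlas"
  assumes A: "smooth_atlas A" and E: "frame A E" and p: "p \<in> mcarrier A" and eq: "E v p = E w p"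
  shows "v = w"
proof -
  obtain c where c: "chart_around A p c" using p by (rule obtain_chart)
  have "surj (\<lambda>v. snd (E v p) c)"
  proof (rule surjI[of _ "\<lambda>x. SOME v. E v p = mkvec A c p x"])
    fix x
    have "E (SOME v. E v p = mkvec A c p x) p = mkvec A c p x"
      by (rule someI_ex[OF frameD(4)[OF E p mkvec_in_tspace[OF A c]]])
    then show "snd (E (SOME v. E v p = mkvec A c p x) p) c = x" by (simp add: snd_mkvec[OF A c])
  qed
  then have "inj (\<lambda>v. snd (E v p) c)"
    by (rule linear_surjective_imp_injective[OF frame_linear[OF E p]]) simp
  then show ?thesis by (rule injD) (simp add: eq)
qed

definition const_frame_metric ::
  "('a, 'e::euclidean_space) atlas \<Rightarrow> ('e \<Rightarrow> ('a, 'e) vfield) \<Rightarrow> (('a, 'e) tvec \<Rightarrow> ('a, 'e) tvec \<Rightarrow> real) \<Rightarrow> bool" where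
  "const_frame_metric A E g \<longleftrightarrow>
     riemannian_metric A g \<and>
     (\<forall>v w. \<forall>p\<in>mcarrier A. \<forall>q\<in>mcarrier A. g (E v p) (E w p) = g (E v q) (E w q))"

lemma riemannian_metricD:
  assumes "riemannian_metric A g" "p \<in> mcarrier A"
  shows "u \<in> tspace A p \<Longrightarrow> v \<in> tspace A p \<Longrightarrow> w \<in> tspace A p \<Longrightarrow> g (tadd u v) w = g u w + g v w"
    "v \<in> tspace A p \<Longrightarrow> w \<in> tspace A p \<Longrightarrow> g (tscale r v) w = r * g v w"
    "v \<in> tspace A p \<Longrightarrow> w \<in> tspace A p \<Longrightarrow> g v w = g w v"
    "v \<in> tspace A p \<Longrightarrow> v \<noteq> tzero p \<Longrightarrow> g v v > 0"
  using assms unfolding riemannian_metric_def by blast+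

text \<open>The coefficients of a vector field in a frame with constant Gram matrix are constant linear
  combinations of its inner products with the frame, hence smooth: no matrix of functions has to
  be inverted.\<close>

lemma frame_expansion:
  fixes A :: "('a, 'e::euclidean_space) atlas"
  assumes A: "smooth_atlas A" and E: "frame A E" and g: "const_frame_metric A E g"
  shows "\<exists>S. \<forall>p\<in>mcarrier A. \<forall>\<xi>\<in>tspace A p. \<forall>c.
    snd \<xi> c = (\<Sum>b\<in>Basis. g \<xi> (E b p) *\<^sub>R snd (E (S b) p) c)"
proof (cases "mcarrier A = {}")
  case False
  then obtain q where q: "q \<in> mcarrier A" by blast
  have rm: "riemannian_metric A g" using g by (simp add: const_frame_metric_def)
  note gD = riemannian_metricD[OF rm q] and Et = vfieldsD(2)[OF A frameD(1)[OF E] q]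
  define \<beta> where "\<beta> v w = g (E v q) (E w q)" for v w
  have \<beta>1: "linear (\<lambda>v. \<beta> v w)" for w
    by (rule linearI) (simp_all add: \<beta>_def frameD[OF E] q gD Et)
  have sym: "\<beta> v w = \<beta> w v" for v w by (simp add: \<beta>_def gD(3)[OF Et Et])
  \<comment> \<open>\<open>T\<close> is the Gram operator at the reference point \<open>q\<close>.
    Positive definiteness makes it injective, and its left inverse \<open>S\<close> gives the fields
    \<open>E (S b)\<close> dual to \<open>E b\<close>, from which a vector is rebuilt by its inner
    products.\<close>
  define T where "T v = (\<Sum>b\<in>Basis. \<beta> v b *\<^sub>R b)" for v
  have lT: "linear T" unfolding T_def
    by (rule linear_compose_sum) (auto intro!: linear_compose[OF \<beta>1, unfolded comp_def] linear_scaleR_left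
        simp: linear_iff linear_add[OF \<beta>1] linear_cmul[OF \<beta>1] scaleR_left_distrib)
  have "v = 0" if "T v = 0" for v
  proof -
    have "\<beta> v b = 0" if "b \<in> Basis" for b
      using arg_cong[OF \<open>T v = 0\<close>, of "\<lambda>x. x \<bullet> b"] that by (simp add: T_def inner_sum_left_Basis)
    then have "\<beta> v v = 0"
      using linear_Basis_expansion[OF \<beta>1, of v v] sym by simp
    then have "E v q = tzero q" using gD(4)[OF Et] by (fastforce simp: \<beta>_def)
    \<comment> \<open>Vanishing of \<open>v\<close> is read off from \<open>E v q = E 0 q\<close> by
      injectivity of the frame.\<close>
    also have "\<dots> = E 0 q"
      by (rule tvec_eqI) (simp_all add: linear_0[OF frame_linear[OF E q]] vfieldsD(4)[OF A frameD(1)[OF E] q])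
    finally show "v = 0" by (rule frame_inj[OF A E q])
  qed
  then have "inj T" by (simp add: linear_injective_0[OF lT])
  then obtain S where S: "linear S" "S \<circ> T = id" using linear_injective_left_inverse[OF lT] by blast
  have "snd \<xi> c = (\<Sum>b\<in>Basis. g \<xi> (E b p) *\<^sub>R snd (E (S b) p) c)"
    if p: "p \<in> mcarrier A" and \<xi>: "\<xi> \<in> tspace A p" for p \<xi> c
  proof -
    obtain v where v: "E v p = \<xi>" using frameD(4)[OF E p \<xi>] by blast
    have \<beta>: "\<beta> v b = g \<xi> (E b p)" for b
      using g p q v unfolding const_frame_metric_def \<beta>_def by blast
    have "v = S (T v)" using S(2) by (metis comp_apply id_apply)
    also have "\<dots> = (\<Sum>b\<in>Basis. \<beta> v b *\<^sub>R S b)"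
      by (simp add: T_def linear_sum[OF S(1)] linear_cmul[OF S(1)])
    finally have "snd (E v p) c = snd (E (\<Sum>b\<in>Basis. \<beta> v b *\<^sub>R S b) p) c" by simp
    also have "\<dots> = (\<Sum>b\<in>Basis. \<beta> v b *\<^sub>R snd (E (S b) p) c)"
      by (simp add: linear_sum[OF frame_linear[OF E p]] linear_cmul[OF frame_linear[OF E p]])
    finally show ?thesis by (simp add: v \<beta>)
  qed
  then show ?thesis by blast
qed simp

text \<open>Every field is a finite sum of smooth multiples of frame fields, so a property that
  holds on the frame and survives sums and smooth multiples holds everywhere.\<close>

lemma frame_induct:
  fixes A :: "('a, 'e::euclidean_space) atlas"
  assumes A: "smooth_atlas A" and E: "frame A E" and g: "const_frame_metric A E g"
    and X: "X \<in> vfields A"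
    and base: "\<And>v. P (E v)"
    and add: "\<And>X Y. X \<in> vfields A \<Longrightarrow> Y \<in> vfields A \<Longrightarrow> P X \<Longrightarrow> P Y \<Longrightarrow> P (vf_add A X Y)"
    and scale: "\<And>f X. smooth_fun A f \<Longrightarrow> X \<in> vfields A \<Longrightarrow> P X \<Longrightarrow> P (vf_scale A f X)"
  shows "P X"
proof -
  obtain S where S: "\<And>p \<xi> c. p \<in> mcarrier A \<Longrightarrow> \<xi> \<in> tspace A p \<Longrightarrow>
      snd \<xi> c = (\<Sum>b\<in>Basis. g \<xi> (E b p) *\<^sub>R snd (E (S b) p) c)"
    using frame_expansion[OF A E g] by blast
  define f where "f b p = g (X p) (E b p)" for b p
  have f: "smooth_fun A (f b)" for b
    using g X frameD(1)[OF E] unfolding f_def const_frame_metric_def riemannian_metric_def by blast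
  \<comment> \<open>Partial sums of the expansion of \<open>X\<close>. The empty sum is the frame
    field \<open>E 0\<close>, so the induction starts from \<open>base\<close>.\<close>
  define Z where "Z F = (\<lambda>p\<in>mcarrier A. (p, \<lambda>c. \<Sum>b\<in>F. f b p *\<^sub>R snd (E (S b) p) c))" for F
  have ES: "fst (E v p) = p" if "p \<in> mcarrier A" for v p using vfieldsD(4)[OF A frameD(1)[OF E] that] .
  have Z: "Z F \<in> vfields A \<and> P (Z F)" if "finite F" for F
    using that
  proof (induction F rule: finite_induct)
    case empty
    have "Z {} = E 0"
    proof (rule extensionalityI)
      show "Z {} \<in> extensional (mcarrier A)" by (simp add: Z_def)
      show "E 0 \<in> extensional (mcarrier A)" by (rule vfieldsD(1)[OF A frameD(1)[OF E]])
      fix p assume p: "p \<in> mcarrier A"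
      show "Z {} p = E 0 p"
        by (rule tvec_eqI) (simp_all add: Z_def p ES linear_0[OF frame_linear[OF E p]])
    qed
    then show ?case using base frameD(1)[OF E] by simp
  next
    case (insert b F)
    have "Z (insert b F) = vf_add A (vf_scale A (f b) (E (S b))) (Z F)"
    proof (rule extensionalityI)
      show "Z (insert b F) \<in> extensional (mcarrier A)" by (simp add: Z_def)
      fix p assume p: "p \<in> mcarrier A"
      show "Z (insert b F) p = vf_add A (vf_scale A (f b) (E (S b))) (Z F) p"
        by (rule tvec_eqI) (simp_all add: Z_def p ES insert)
    qed simp
    moreover have "vf_scale A (f b) (E (S b)) \<in> vfields A"
      by (rule vf_scale_in_vfields[OF A f frameD(1)[OF E]])
    ultimately show ?case
      using add scale[OF f frameD(1)[OF E] base] insert.IH vf_add_in_vfields[OF A] by simp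
  qed
  have "X = Z Basis"
  proof (rule extensionalityI)
    show "X \<in> extensional (mcarrier A)" by (rule vfieldsD(1)[OF A X])
    show "Z Basis \<in> extensional (mcarrier A)" by (simp add: Z_def)
    fix p assume p: "p \<in> mcarrier A"
    show "X p = Z Basis p"
      by (rule tvec_eqI) (simp_all add: Z_def p f_def vfieldsD(4)[OF A X p] S[OF p vfieldsD(2)[OF A X p]])
  qed
  then show ?thesis using Z[OF finite_Basis] by simp
qed

subsection \<open>Affine connections\<close>

lemma affine_connectionD:
  assumes "affine_connection A D" "X \<in> vfields A" "Y \<in> vfields A"
  shows "D X Y \<in> vfields A"
    "X' \<in> vfields A \<Longrightarrow> D (vf_add A X X') Y = vf_add A (D X Y) (D X' Y)"
    "smooth_fun A f \<Longrightarrow> D (vf_scale A f X) Y = vf_scale A f (D X Y)"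
    "Y' \<in> vfields A \<Longrightarrow> D X (vf_add A Y Y') = vf_add A (D X Y) (D X Y')"
    "smooth_fun A f \<Longrightarrow>
       D X (vf_scale A f Y) = vf_add A (vf_scale A (vf_deriv A X f) Y) (vf_scale A f (D X Y))"
  using assms unfolding affine_connection_def by blast+

text \<open>Locality without bump functions: \<open>T X\<close> equals \<open>T\<close> of the frame
  field with the same value at \<open>p\<close>. In the induction a coefficient function
  \<open>f\<close> is frozen at the constant \<open>f p\<close>, which \<open>scale\<close> permits
  because it reads \<open>f\<close> only at \<open>p\<close>.\<close>

lemma frame_tensorial:
  fixes T :: "('a, 'e::euclidean_space) vfield \<Rightarrow> 'f::real_vector"
  assumes A: "smooth_atlas A" and E: "frame A E" and g: "const_frame_metric A E g" and p: "p \<in> mcarrier A"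
    and add: "\<And>X Y. X \<in> vfields A \<Longrightarrow> Y \<in> vfields A \<Longrightarrow> T (vf_add A X Y) = T X + T Y"
    and scale: "\<And>f X. smooth_fun A f \<Longrightarrow> X \<in> vfields A \<Longrightarrow> T (vf_scale A f X) = f p *\<^sub>R T X"
    and X: "X \<in> vfields A" and X': "X' \<in> vfields A" and eq: "X p = X' p"
  shows "T X = T X'"
proof -
  note EV = frameD(1)[OF E]
  \<comment> \<open>The field \<open>E v\<close> has the value of \<open>X\<close> at
    \<open>p\<close> and the same image under \<open>T\<close>; by injectivity of the frame,
    \<open>v\<close> depends on that value alone.\<close>
  have frame: "\<exists>v. E v p = X p \<and> T (E v) = T X" if X: "X \<in> vfields A" for X
  proof (rule frame_induct[OF A E g X])
    fix X Y assume XY: "X \<in> vfields A" "Y \<in> vfields A"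
      and "\<exists>v. E v p = X p \<and> T (E v) = T X" "\<exists>v. E v p = Y p \<and> T (E v) = T Y"
    then obtain v w where "E v p = X p" "T (E v) = T X" "E w p = Y p" "T (E w) = T Y" by blast
    then have "E (v + w) p = vf_add A X Y p \<and> T (E (v + w)) = T (vf_add A X Y)"
      by (simp add: p frameD(2)[OF E] add XY EV)
    then show "\<exists>v. E v p = vf_add A X Y p \<and> T (E v) = T (vf_add A X Y)" by blast
  next
    fix f X assume f: "smooth_fun A f" and X: "X \<in> vfields A"
      and "\<exists>v. E v p = X p \<and> T (E v) = T X"
    then obtain v where "E v p = X p" "T (E v) = T X" by blast
    then have "E (f p *\<^sub>R v) p = vf_scale A f X p \<and> T (E (f p *\<^sub>R v)) = T (vf_scale A f X)"
      by (simp add: p frameD(3)[OF E] scale f X EV smooth_fun_const[OF A])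
    then show "\<exists>v. E v p = vf_scale A f X p \<and> T (E v) = T (vf_scale A f X)" by blast
  qed blast
  obtain v w where "E v p = X p" "T (E v) = T X" "E w p = X' p" "T (E w) = T X'"
    using frame[OF X] frame[OF X'] by blast
  then show ?thesis using frame_inj[OF A E p, of v w] eq by simp
qed

section \<open>The Christoffel symbol as the tensorial defect of a connection\<close>

lemma has_derivative_vf_local:
  assumes A: "smooth_atlas A" and Y: "Y \<in> vfields A" and c: "chart_around A p c"
  shows "(vf_local c Y has_derivative frechet_derivative (vf_local c Y) (at (snd c p))) (at (snd c p))"
proof -
  note p = chart_aroundD(4)[OF c]
  have "smooth_at vspace_atlas vspace_atlas (vf_local c Y) (snd c p)"
    using smooth_at_local_rep[OF A A smooth_atlas_vspace smooth_at_id[OF A p] c smooth_at_vf_component[OF A Y c]]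
    by (simp add: vf_local_def[abs_def])
  then show ?thesis by (rule smooth_at_has_derivative)
qed

text \<open>The failure of a connection to be differentiation in a chart is tensorial: this is the
  Christoffel symbol, up to sign.\<close>

definition christoffel where
  "christoffel D c X Y p =
     frechet_derivative (vf_local c Y) (at (snd c p)) (snd (X p) c) - snd (D X Y p) c"

lemma christoffel_add:
  assumes A: "smooth_atlas A" and D: "affine_connection A D" and c: "chart_around A p c"
    and X: "X \<in> vfields A" and Y: "Y \<in> vfields A" and Y': "Y' \<in> vfields A"
  shows "christoffel D c X (vf_add A Y Y') p = christoffel D c X Y p + christoffel D c X Y' p"
proof -
  note cA = chart_aroundD[OF c]
  have "frechet_derivative (vf_local c (vf_add A Y Y')) (at (snd c p)) =
      frechet_derivative (\<lambda>x. vf_local c Y x + vf_local c Y' x) (at (snd c p))"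
    by (rule frechet_derivative_cong_open[OF smooth_atlas_open_cran[OF A cA(1)] cA(3)])
      (simp add: vf_local_def chart_aroundD(4)[OF chart_around_cinv[OF cA(1)]])
  also have "\<dots> = (\<lambda>v. frechet_derivative (vf_local c Y) (at (snd c p)) v + frechet_derivative (vf_local c Y') (at (snd c p)) v)"
    by (rule frechet_derivative_at[symmetric])
      (rule has_derivative_add[OF has_derivative_vf_local[OF A Y c] has_derivative_vf_local[OF A Y' c]])
  finally show ?thesis
    using affine_connectionD(4)[OF D X Y Y'] cA(4) by (simp add: christoffel_def)
qed

text \<open>Differentiation in the chart and the Leibniz rule of \<open>D\<close> both produce the
  term X(f) Y, which cancels in the difference.\<close>

lemma christoffel_scale:
  assumes A: "smooth_atlas A" and D: "affine_connection A D" and c: "chart_around A p c"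
    and X: "X \<in> vfields A" and Y: "Y \<in> vfields A" and f: "smooth_fun A f"
  shows "christoffel D c X (vf_scale A f Y) p = f p *\<^sub>R christoffel D c X Y p"
proof -
  note cA = chart_aroundD[OF c]
  have pc: "cinv c (snd c p) = p" by (rule cinv_chart[OF A cA(1,2)])
  have fp: "smooth_at A vspace_atlas f p" using f smooth_fun_iff[OF A] cA(4) by blast
  have df: "((\<lambda>x. f (cinv c x)) has_derivative frechet_derivative (\<lambda>x. f (cinv c x)) (at (snd c p))) (at (snd c p))"
    by (rule smooth_at_has_derivative)
      (rule smooth_at_local_rep[OF A A smooth_atlas_vspace smooth_at_id[OF A cA(4)] c fp])
  have "frechet_derivative (vf_local c (vf_scale A f Y)) (at (snd c p)) =
      frechet_derivative (\<lambda>x. f (cinv c x) *\<^sub>R vf_local c Y x) (at (snd c p))"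
    by (rule frechet_derivative_cong_open[OF smooth_atlas_open_cran[OF A cA(1)] cA(3)])
      (simp add: vf_local_def chart_aroundD(4)[OF chart_around_cinv[OF cA(1)]])
  also have "\<dots> = (\<lambda>v. f (cinv c (snd c p)) *\<^sub>R frechet_derivative (vf_local c Y) (at (snd c p)) v +
      frechet_derivative (\<lambda>x. f (cinv c x)) (at (snd c p)) v *\<^sub>R vf_local c Y (snd c p))"
    by (rule frechet_derivative_at[symmetric])
      (rule has_derivative_scaleR[OF df has_derivative_vf_local[OF A Y c]])
  finally show ?thesis
    using affine_connectionD(5)[OF D X Y f] cA(4)
    by (simp add: christoffel_def vf_deriv_eq[OF A X fp c] pc vf_local_def scaleR_right_diff_distrib)
qed

lemma christoffel_add_left:
  assumes A: "smooth_atlas A" and D: "affine_connection A D" and c: "chart_around A p c"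
    and X: "X \<in> vfields A" and X': "X' \<in> vfields A" and Y: "Y \<in> vfields A"
  shows "christoffel D c (vf_add A X X') Y p = christoffel D c X Y p + christoffel D c X' Y p"
  using linear_add[OF has_derivative_linear[OF has_derivative_vf_local[OF A Y c]]] chart_aroundD(4)[OF c]
  by (simp add: christoffel_def affine_connectionD(2)[OF D X Y X'])

lemma christoffel_scale_left:
  assumes A: "smooth_atlas A" and D: "affine_connection A D" and c: "chart_around A p c"
    and X: "X \<in> vfields A" and f: "smooth_fun A f" and Y: "Y \<in> vfields A"
  shows "christoffel D c (vf_scale A f X) Y p = f p *\<^sub>R christoffel D c X Y p"
  using linear_cmul[OF has_derivative_linear[OF has_derivative_vf_local[OF A Y c]]] chart_aroundD(4)[OF c]
  by (simp add: christoffel_def affine_connectionD(3)[OF D X Y f] scaleR_right_diff_distrib)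

text \<open>Tensoriality is applied to the first argument and then to the second. This makes the
  test in \<open>horizontal\<close> independent of the fields chosen through the given
  values.\<close>

lemma christoffel_pointwise:
  assumes A: "smooth_atlas A" and E: "frame A E" and g: "const_frame_metric A E g"
    and D: "affine_connection A D" and c: "chart_around A p c"
    and X: "X \<in> vfields A" "X' \<in> vfields A" "X p = X' p"
    and Y: "Y \<in> vfields A" "Y' \<in> vfields A" "Y p = Y' p"
  shows "christoffel D c X Y p = christoffel D c X' Y' p"
proof -
  note p = chart_aroundD(4)[OF c]
  have "christoffel D c X Y p = christoffel D c X' Y p"
    by (rule frame_tensorial[OF A E g p _ _ X, of "\<lambda>X. christoffel D c X Y p"])
      (simp_all add: christoffel_add_left[OF A D c _ _ Y(1)] christoffel_scale_left[OF A D c _ _ Y(1)])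
  also have "\<dots> = christoffel D c X' Y' p"
    by (rule frame_tensorial[OF A E g p _ _ Y, of "\<lambda>Y. christoffel D c X' Y p"])
      (simp_all add: christoffel_add[OF A D c X(2)] christoffel_scale[OF A D c X(2)])
  finally show ?thesis .
qed

section \<open>Vertical and horizontal lifts\<close>

lemma smooth_at_linear:
  fixes f :: "'a \<Rightarrow> 'f::euclidean_space" and L :: "'f \<Rightarrow> 'h::euclidean_space"
  assumes A: "smooth_atlas A" and f: "smooth_at A vspace_atlas f p" and L: "linear L"
  shows "smooth_at A vspace_atlas (\<lambda>x. L (f x)) p"
proof (rule smooth_at_compose[OF A smooth_atlas_vspace smooth_atlas_vspace f])
  show "smooth_at vspace_atlas vspace_atlas L (f p)"
    unfolding smooth_at_euclidean
    using smooth_on_bounded_linear[OF open_UNIV] L by (auto simp: linear_conv_bounded_linear)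
qed

lemma smooth_at_affine_curve:
  fixes a b :: "'f::euclidean_space"
  shows "smooth_at vspace_atlas vspace_atlas (\<lambda>t::real. a + t *\<^sub>R b) t"
  by (intro smooth_at_add smooth_at_bilinear[OF _ _ _ bounded_bilinear_scaleR] smooth_at_const smooth_at_id
      smooth_atlas_vspace) simp_all

lemma vector_derivative_affine_curve: "vector_derivative (\<lambda>t. a + t *\<^sub>R b) (at 0) = b"
  by (rule vector_derivative_at) (auto intro!: derivative_eq_intros)

lemma smooth_at_vert_curve:
  assumes A: "smooth_atlas A" and p: "p \<in> mcarrier A" and u: "u \<in> tspace A p" and w: "w \<in> tspace A p"
  shows "smooth_at vspace_atlas (tbundle_atlas A) (\<lambda>t. tadd u (tscale t w)) 0"
proof -
  obtain c where c: "chart_around A p c" using p by (rule obtain_chart)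
  have fu: "fst u = p" by (rule tspaceD(1)[OF u])
  show ?thesis
  proof (rule smooth_at_tbundleI[OF A smooth_atlas_vspace, where c = c])
    show "tadd u (tscale t w) \<in> tbundle A" for t
      by (rule tspace_tbundle[OF tadd_in_tspace[OF A u tscale_in_tspace[OF A w]] p])
    show "smooth_at vspace_atlas A (\<lambda>t. fst (tadd u (tscale t w))) 0"
      using smooth_at_const[OF smooth_atlas_vspace _ p] by (simp add: fu)
    show "chart_around A (fst (tadd u (tscale 0 w))) c" using c by (simp add: fu)
    show "smooth_at vspace_atlas vspace_atlas (\<lambda>t. snd (tadd u (tscale t w)) c) 0"
      using smooth_at_affine_curve by simp
  qed
qed

lemma tadd_tscale_0: "tadd u (tscale 0 w) = u"
  by (rule tvec_eqI) simp_all

lemma vert_in_tspace: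
  assumes A: "smooth_atlas A" and p: "p \<in> mcarrier A" and u: "u \<in> tspace A p" and w: "w \<in> tspace A p"
  shows "vert A u w \<in> tspace (tbundle_atlas A) u"
  unfolding vert_def
  using velocity_in_tspace[OF smooth_atlas_tbundle[OF A] smooth_at_vert_curve[OF assms]]
  by (simp add: tadd_tscale_0)

lemma vector_derivative_Pair_const:
  assumes "(f has_vector_derivative f') (at t)"
  shows "vector_derivative (\<lambda>t. (a, f t)) (at t) = (0, f')"
  by (rule vector_derivative_at) (rule has_vector_derivative_Pair[OF has_vector_derivative_const assms])

lemma snd_vert:
  assumes A: "smooth_atlas A" and u: "u \<in> tspace A p" and c: "chart_around A p c"
  shows "snd (vert A u w) (tchart A c) = (0, snd w c)"
proof -
  have fu: "fst u = p" by (rule tspaceD(1)[OF u])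
  have "u \<in> tbundle A" by (rule tspace_tbundle[OF u chart_aroundD(4)[OF c]])
  then have "chart_around (tbundle_atlas A) (tadd u (tscale 0 w)) (tchart A c)"
    using chart_around_tchart[of u A c] c by (simp add: fu tadd_tscale_0)
  moreover have "((\<lambda>t. snd u c + t *\<^sub>R snd w c) has_vector_derivative snd w c) (at 0)"
    by (auto intro!: derivative_eq_intros)
  ultimately show ?thesis
    unfolding vert_def by (subst snd_velocity) (simp_all add: vector_derivative_Pair_const)
qed

text \<open>In bundle coordinates a field is the section x \<mapsto> (x, Y(x)), which explains the
  identity in the first component.\<close>

lemma snd_tmap_vf:
  assumes A: "smooth_atlas A" and Y: "Y \<in> vfields A" and v: "v \<in> tspace A p" and c: "chart_around A p c"
  shows "snd (tmap A (tbundle_atlas A) Y v) (tchart A c) =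
    (snd v c, frechet_derivative (vf_local c Y) (at (snd c p)) (snd v c))"
proof -
  note cA = chart_aroundD[OF c]
  have d: "chart_around (tbundle_atlas A) (Y p) (tchart A c)"
    using chart_around_tchart[OF vfieldsD(3)[OF A Y cA(4)]] c vfieldsD(4)[OF A Y cA(4)] by simp
  have "frechet_derivative (\<lambda>x. snd (tchart A c) (Y (cinv c x))) (at (snd c p)) =
      frechet_derivative (\<lambda>x. (x, vf_local c Y x)) (at (snd c p))"
    by (rule frechet_derivative_cong_open[OF smooth_atlas_open_cran[OF A cA(1)] cA(3)])
      (simp add: vf_local_def chart_cinv vfieldsD(4)[OF A Y chart_aroundD(4)[OF chart_around_cinv[OF cA(1)]]])
  also have "\<dots> = (\<lambda>v. (v, frechet_derivative (vf_local c Y) (at (snd c p)) v))"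
    by (rule frechet_derivative_at[symmetric])
      (rule has_derivative_Pair[OF has_derivative_ident has_derivative_vf_local[OF A Y c]])
  finally show ?thesis
    using snd_tmap[OF A smooth_atlas_tbundle[OF A] vfieldsD(5)[OF A Y cA(4)] v c d] by simp
qed

lemma snd_tmap_fst:
  assumes A: "smooth_atlas A" and u: "u \<in> tspace A p" and c: "chart_around A p c"
    and x: "\<xi> \<in> tspace (tbundle_atlas A) u"
  shows "snd (tmap (tbundle_atlas A) A fst \<xi>) c = fst (snd \<xi> (tchart A c))"
proof -
  note cA = chart_aroundD[OF c] and TA = smooth_atlas_tbundle[OF A]
  have fu: "fst u = p" by (rule tspaceD(1)[OF u])
  have ub: "u \<in> tbundle A" by (rule tspace_tbundle[OF u cA(4)])
  have uc: "chart_around (tbundle_atlas A) u (tchart A c)" using chart_around_tchart[OF ub] c fu by simp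
  have ran: "cran (tchart A c) = cran c \<times> UNIV" using cran_tchart[OF A cA(1), of UNIV] by simp
  have "frechet_derivative (\<lambda>y. snd c (fst (cinv (tchart A c) y))) (at (snd (tchart A c) u)) =
      frechet_derivative fst (at (snd (tchart A c) u))"
  proof (rule frechet_derivative_cong_open[OF smooth_atlas_open_cran[OF TA chart_aroundD(1)[OF uc]] chart_aroundD(3)[OF uc]])
    fix y assume "y \<in> cran (tchart A c)"
    from chart_cinv[OF this] show "snd c (fst (cinv (tchart A c) y)) = fst y" by (metis fst_conv snd_tchart)
  qed
  also have "\<dots> = fst"
    by (rule frechet_derivative_at[symmetric])
      (rule bounded_linear_imp_has_derivative[OF bounded_linear_fst])
  finally show ?thesis
    using snd_tmap[OF TA A smooth_at_tbundle_fst[OF A ub] x uc, of c] c by (simp add: fu)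
qed

lemma vlift_apply: "u \<in> tbundle A \<Longrightarrow> vlift A X u = vert A u (X (fst u))"
  by (simp add: vlift_def)

lemma vlift_in_vfields:
  assumes A: "smooth_atlas A" and X: "X \<in> vfields A"
  shows "vlift A X \<in> vfields (tbundle_atlas A)"
proof (rule vfieldsI[OF smooth_atlas_tbundle[OF A]])
  note TA = smooth_atlas_tbundle[OF A]
  show "vlift A X \<in> extensional (mcarrier (tbundle_atlas A))" by (simp add: vlift_def)
  fix u assume "u \<in> mcarrier (tbundle_atlas A)"
  then have u: "u \<in> tbundle A" and p: "fst u \<in> mcarrier A" and ut: "u \<in> tspace A (fst u)"
    by (simp_all add: tbundle_iff)
  show "vlift A X u \<in> tspace (tbundle_atlas A) u"
    unfolding vlift_apply[OF u] by (rule vert_in_tspace[OF A p ut vfieldsD(2)[OF A X p]])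
  obtain c where c: "chart_around A (fst u) c" using p by (rule obtain_chart)
  \<comment> \<open>The formula has to hold on the whole bundle for \<open>smooth_at_cong\<close>.
    Over points outside the domain of \<open>c\<close> both sides are 0 by the convention on
    components.\<close>
  have eq: "snd (vlift A X v) (tchart A c) = (0, snd (X (fst v)) c)" if "v \<in> mcarrier (tbundle_atlas A)" for v
  proof -
    from that have v: "v \<in> tbundle A" "fst v \<in> mcarrier A" "v \<in> tspace A (fst v)"
      by (simp_all add: tbundle_iff)
    show ?thesis
    proof (cases "fst v \<in> fst c")
      case True
      then have "chart_around A (fst v) c" using chart_aroundD(1)[OF c] by (simp add: chart_around_def)
      then show ?thesis using snd_vert[OF A v(3)] by (simp add: vlift_apply[OF v(1)])
    next
      case False
      then have "\<not> chart_around A (fst v) c" by (simp add: chart_around_def)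
      then have "snd (X (fst v)) c = 0" by (rule tspaceD(3)[OF vfieldsD(2)[OF A X v(2)]])
      moreover have "\<not> chart_around (tbundle_atlas A) v (tchart A c)"
        using False by (simp add: chart_around_def)
      ultimately show ?thesis
        using tspaceD(3)[OF vert_in_tspace[OF A v(2,3) vfieldsD(2)[OF A X v(2)]]]
        by (simp add: vlift_apply[OF v(1)] zero_prod_def)
    qed
  qed
  have "smooth_at (tbundle_atlas A) vspace_atlas (\<lambda>v. (0, snd (X (fst v)) c)) u"
    by (rule smooth_at_linear[OF TA smooth_at_compose[OF TA A smooth_atlas_vspace
          smooth_at_tbundle_fst[OF A u] smooth_at_vf_component[OF A X c]]])
      (auto intro: linearI)
  then have "smooth_at (tbundle_atlas A) vspace_atlas (\<lambda>v. snd (vlift A X v) (tchart A c)) u"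
    by (rule smooth_at_cong[OF eq, rotated])
  then show "\<exists>e. chart_around (tbundle_atlas A) u e \<and>
      smooth_at (tbundle_atlas A) vspace_atlas (\<lambda>v. snd (vlift A X v) e) u"
    using chart_around_tchart[OF u c] by blast
qed

text \<open>The vector that the condition in \<open>horizontal\<close> prescribes for the single
  pair of test fields \<open>X\<close>, \<open>Y\<close>.\<close>

definition hvec where
  "hvec A D X Y u = tminus (tmap A (tbundle_atlas A) Y (X (fst u))) (vert A u (D X Y (fst u)))"

lemma hvec_in_tspace:
  assumes A: "smooth_atlas A" and D: "affine_connection A D" and X: "X \<in> vfields A" and Y: "Y \<in> vfields A"
    and p: "p \<in> mcarrier A" and u: "Y p = u"
  shows "hvec A D X Y u \<in> tspace (tbundle_atlas A) u"
proof -
  have ut: "u \<in> tspace A p" and fu: "fst u = p"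
    using vfieldsD(2)[OF A Y p] vfieldsD(4)[OF A Y p] u by auto
  show ?thesis
    unfolding hvec_def fu
    using tminus_in_tspace[OF smooth_atlas_tbundle[OF A] _
        vert_in_tspace[OF A p ut vfieldsD(2)[OF A affine_connectionD(1)[OF D X Y] p]]]
      tmap_in_tspace[OF A smooth_atlas_tbundle[OF A] vfieldsD(5)[OF A Y p] vfieldsD(2)[OF A X p]] u
    by simp
qed

text \<open>The fibre coordinate is the chart derivative of \<open>Y\<close> minus
  \<open>D X Y\<close>, which is \<open>christoffel\<close>; so the vector depends on
  \<open>X\<close> and \<open>Y\<close> only through their values at \<open>p\<close>.\<close>

lemma snd_hvec:
  assumes A: "smooth_atlas A" and D: "affine_connection A D" and X: "X \<in> vfields A" and Y: "Y \<in> vfields A"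
    and c: "chart_around A p c" and u: "Y p = u"
  shows "snd (hvec A D X Y u) (tchart A c) = (snd (X p) c, christoffel D c X Y p)"
proof -
  note p = chart_aroundD(4)[OF c]
  have ut: "u \<in> tspace A p" and fu: "fst u = p"
    using vfieldsD(2)[OF A Y p] vfieldsD(4)[OF A Y p] u by auto
  show ?thesis
    by (simp add: hvec_def fu snd_tmap_vf[OF A Y vfieldsD(2)[OF A X p] c] snd_vert[OF A ut c] christoffel_def)
qed

text \<open>Resolves the definite description in \<open>hlift\<close>. \<open>hvec\<close> passes
  the test against every other pair of fields because its coordinates are pointwise; any competitor
  equals it on being tested against \<open>X\<close> and \<open>Y\<close> themselves.\<close>

lemma hlift_eq:
  assumes A: "smooth_atlas A" and E: "frame A E" and g: "const_frame_metric A E g"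
    and D: "affine_connection A D" and X: "X \<in> vfields A" and Y: "Y \<in> vfields A"
    and p: "p \<in> mcarrier A" and u: "Y p = u"
  shows "hlift A D X u = hvec A D X Y u"
proof -
  have ut: "u \<in> tspace A p" and fu: "fst u = p" and ub: "u \<in> tbundle A"
    using vfieldsD(2,3,4)[OF A Y p] u by auto
  obtain c where c: "chart_around A p c" using p by (rule obtain_chart)
  note TA = smooth_atlas_tbundle[OF A]
  have uc: "chart_around (tbundle_atlas A) u (tchart A c)" using chart_around_tchart[OF ub] c fu by simp
  note H = hvec_in_tspace[OF A D X Y p u]
  have pr: "tmap (tbundle_atlas A) A fst (hvec A D X Y u) = X p"
  proof (rule tspace_eqI[OF _ vfieldsD(2)[OF A X p] c])
    show "tmap (tbundle_atlas A) A fst (hvec A D X Y u) \<in> tspace A p"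
      using tmap_in_tspace[OF TA A smooth_at_tbundle_fst[OF A ub] H] by (simp add: fu)
    show "snd (tmap (tbundle_atlas A) A fst (hvec A D X Y u)) c = snd (X p) c"
      by (simp add: snd_tmap_fst[OF A ut c H] snd_hvec[OF A D X Y c u])
  qed
  have "(THE \<xi>. \<xi> \<in> tspace (tbundle_atlas A) u \<and> horizontal A D \<xi> \<and>
      tmap (tbundle_atlas A) A fst \<xi> = X (fst u)) = hvec A D X Y u"
  proof (rule the_equality, intro conjI)
    show "horizontal A D (hvec A D X Y u)"
      unfolding horizontal_def Let_def tspaceD(1)[OF H] fu pr
    proof (intro ballI impI, elim conjE)
      fix X' Y' assume X': "X' \<in> vfields A" "X' p = X p" and Y': "Y' \<in> vfields A" "Y' p = u"
      have "hvec A D X Y u = hvec A D X' Y' u"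
      proof (rule tspace_eqI[OF H hvec_in_tspace[OF A D X'(1) Y'(1) p Y'(2)] uc])
        show "snd (hvec A D X Y u) (tchart A c) = snd (hvec A D X' Y' u) (tchart A c)"
          using christoffel_pointwise[OF A E g D c X X'(1) _ Y Y'(1)] X'(2) Y'(2) u
          by (simp add: snd_hvec[OF A D X Y c u] snd_hvec[OF A D X'(1) Y'(1) c Y'(2)])
      qed
      then show "hvec A D X Y u = tminus (tmap A (tbundle_atlas A) Y' (X' p)) (vert A u (D X' Y' p))"
        by (simp add: hvec_def fu)
    qed
    show "tmap (tbundle_atlas A) A fst (hvec A D X Y u) = X (fst u)" using pr fu by simp
  next
    fix \<xi> assume xi: "\<xi> \<in> tspace (tbundle_atlas A) u \<and> horizontal A D \<xi> \<and>
      tmap (tbundle_atlas A) A fst \<xi> = X (fst u)"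
    then have "fst \<xi> = u" by (meson tspaceD(1))
    then show "\<xi> = hvec A D X Y u"
      using xi X Y u fu unfolding horizontal_def Let_def hvec_def by auto
  qed (rule H)
  then show ?thesis using ub by (simp add: hlift_def)
qed

section \<open>A tangent space as a manifold\<close>

lemma tspace_iso_component:
  assumes A: "smooth_atlas A" and c: "chart_around A p c"
  shows "tspace_iso A p (\<lambda>v. snd v c)"
proof -
  have "bij_betw (\<lambda>v. snd v c) (tspace A p) UNIV"
    by (rule bij_betw_byWitness[where f' = "mkvec A c p"])
      (use mkvec_snd[OF A _ c] snd_mkvec[OF A c] mkvec_in_tspace[OF A c] in auto)
  then show ?thesis by (simp add: tspace_iso_def)
qed

text \<open>The inverse of a linear chart is linear by injectivity. Hence changes between the charts
  of \<open>tspace_atlas\<close> are linear and therefore smooth.\<close>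

lemma linear_tspace_iso_inv:
  assumes A: "smooth_atlas A" and f: "tspace_iso A p \<phi>" and h: "tspace_iso A p \<psi>"
  shows "linear (\<lambda>w. \<psi> (inv_into (tspace A p) \<phi> w))"
proof (rule linearI)
  have bij: "bij_betw \<phi> (tspace A p) UNIV" using f by (simp add: tspace_iso_def)
  let ?i = "inv_into (tspace A p) \<phi>"
  have i: "?i w \<in> tspace A p" "\<phi> (?i w) = w" for w
    using bij by (auto simp: bij_betw_def intro: inv_into_into f_inv_into_f)
  have inj: "v = w" if "v \<in> tspace A p" "w \<in> tspace A p" "\<phi> v = \<phi> w" for v w
    using bij that by (auto simp: bij_betw_def dest: inj_onD)
  have "?i (v + w) = tadd (?i v) (?i w)" for v w
    by (rule inj) (use i f in \<open>simp_all add: tadd_in_tspace[OF A] tspace_iso_def\<close>)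
  then show "\<psi> (?i (v + w)) = \<psi> (?i v) + \<psi> (?i w)" for v w
    using h i by (simp add: tspace_iso_def)
  have "?i (r *\<^sub>R v) = tscale r (?i v)" for r v
    by (rule inj) (use i f in \<open>simp_all add: tscale_in_tspace[OF A] tspace_iso_def\<close>)
  then show "\<psi> (?i (r *\<^sub>R v)) = r *\<^sub>R \<psi> (?i v)" for r v
    using h i by (simp add: tspace_iso_def)
qed

lemma tspace_atlasE:
  assumes "e \<in> tspace_atlas A p"
  obtains \<phi> where "e = (tspace A p, \<phi>)" "tspace_iso A p \<phi>" "inj_on \<phi> (tspace A p)" "\<phi> ` tspace A p = UNIV"
  using assms by (auto simp: tspace_atlas_def tspace_iso_def bij_betw_def)

lemma smooth_atlas_tspace:
  assumes A: "smooth_atlas A"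
  shows "smooth_atlas (tspace_atlas A p)"
proof (rule smooth_atlasI)
  fix e e' assume e: "e \<in> tspace_atlas A p" and e': "e' \<in> tspace_atlas A p"
  obtain \<phi> where f: "e = (tspace A p, \<phi>)" "tspace_iso A p \<phi>" "inj_on \<phi> (tspace A p)" "\<phi> ` tspace A p = UNIV"
    using e by (rule tspace_atlasE)
  obtain \<psi> where h: "e' = (tspace A p, \<psi>)" "tspace_iso A p \<psi>"
    using e' by (rule tspace_atlasE)
  show "open (snd e ` (fst e \<inter> fst e'))" by (simp add: f h)
  show "smooth_on (snd e ` (fst e \<inter> fst e')) (\<lambda>x. snd e' (cinv e x))"
    using linear_tspace_iso_inv[OF A f(2) h(2)]
    by (simp add: f h smooth_on_bounded_linear linear_conv_bounded_linear)
qed (auto elim!: tspace_atlasE)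

lemma chart_around_tspace_atlas:
  "smooth_atlas A \<Longrightarrow> chart_around A p c \<Longrightarrow> v \<in> tspace A p \<Longrightarrow>
    chart_around (tspace_atlas A p) v (tspace A p, \<lambda>v. snd v c)"
  by (auto simp: chart_around_def tspace_atlas_def intro: tspace_iso_component[unfolded chart_around_def])

lemma mcarrier_tspace_atlas:
  assumes A: "smooth_atlas A" and p: "p \<in> mcarrier A"
  shows "mcarrier (tspace_atlas A p) = tspace A p"
proof -
  obtain c where c: "chart_around A p c" using p by (rule obtain_chart)
  have "v \<in> mcarrier (tspace_atlas A p)" if "v \<in> tspace A p" for v
    using chart_aroundD(4)[OF chart_around_tspace_atlas[OF A c that]] .
  moreover have "v \<in> tspace A p" if "v \<in> mcarrier (tspace_atlas A p)" for v
    using that by (auto simp: mcarrier_def elim!: tspace_atlasE)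
  ultimately show ?thesis by blast
qed

lemma smooth_at_tspace_atlasI:
  assumes A: "smooth_atlas A" and B: "smooth_atlas B"
    and f: "\<And>x. x \<in> mcarrier B \<Longrightarrow> f x \<in> tspace A p" and c: "chart_around A p c"
    and s: "smooth_at B vspace_atlas (\<lambda>x. snd (f x) c) q"
  shows "smooth_at B (tspace_atlas A p) f q"
proof -
  note q = smooth_at_mcarrier(1)[OF s]
  obtain e where e: "chart_around B q e" using q by (rule obtain_chart)
  obtain W where W: "open W" "snd e q \<in> W" "W \<subseteq> cran e" "smooth_on W (\<lambda>x. snd (f (cinv e x)) c)"
    using smooth_at_vspace_charts[OF B s e] by blast
  show ?thesis
    by (rule smooth_atI[OF e chart_around_tspace_atlas[OF A c f[OF q]] W(1,2,3)])
      (use W(3,4) f chart_aroundD(4)[OF chart_around_cinv[OF chart_aroundD(1)[OF e]]] in auto)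
qed

lemma smooth_at_tspace_component:
  assumes A: "smooth_atlas A" and c: "chart_around A p c" and v: "v \<in> tspace A p"
  shows "smooth_at (tspace_atlas A p) vspace_atlas (\<lambda>v. snd v c) v"
  using smooth_at_chart[OF smooth_atlas_tspace[OF A] chart_around_tspace_atlas[OF A c v]] by simp

lemma smooth_at_tspace_inclusion:
  assumes A: "smooth_atlas A" and p: "p \<in> mcarrier A" and v: "v \<in> tspace A p"
  shows "smooth_at (tspace_atlas A p) (tbundle_atlas A) (\<lambda>v. v) v"
proof -
  obtain c where c: "chart_around A p c" using p by (rule obtain_chart)
  note T = smooth_atlas_tspace[OF A, of p] and car = mcarrier_tspace_atlas[OF A p]
  show ?thesis
  proof (rule smooth_at_tbundleI[OF A T, where c = c])
    show "v \<in> tbundle A" if "v \<in> mcarrier (tspace_atlas A p)" for v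
      using that tspace_tbundle[OF _ p] car by blast
    show "smooth_at (tspace_atlas A p) A fst v"
      by (rule smooth_at_cong[OF _ smooth_at_const[OF T _ p]]) (use v tspaceD(1) car in auto)
    show "chart_around A (fst v) c" using c tspaceD(1)[OF v] by simp
    show "smooth_at (tspace_atlas A p) vspace_atlas (\<lambda>v. snd v c) v"
      by (rule smooth_at_tspace_component[OF A c v])
  qed
qed

text \<open>Isolates what horizontal lifts rely on: a connection on a manifold with a global frame
  of constant Gram matrix. On the group this is interpreted with the left invariant frame.\<close>

locale framed_connection =
  fixes A :: "('a, 'e::euclidean_space) atlas" and E :: "'e \<Rightarrow> ('a, 'e) vfield"
    and g :: "('a, 'e) tvec \<Rightarrow> ('a, 'e) tvec \<Rightarrow> real"
    and D :: "('a, 'e) vfield \<Rightarrow> ('a, 'e) vfield \<Rightarrow> ('a, 'e) vfield"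
  assumes smooth_A: "smooth_atlas A" and frame: "frame A E" and metric: "const_frame_metric A E g"
    and connection: "affine_connection A D"
begin

lemma obtain_vfield:
  assumes "u \<in> tbundle A"
  obtains Y where "Y \<in> vfields A" "Y (fst u) = u"
  using assms frameD(4)[OF frame] frameD(1)[OF frame] by (metis tbundle_iff)

lemma hlift_in_tspace:
  assumes X: "X \<in> vfields A" and u: "u \<in> tbundle A"
  shows "hlift A D X u \<in> tspace (tbundle_atlas A) u"
proof -
  obtain Y where Y: "Y \<in> vfields A" "Y (fst u) = u" using u by (rule obtain_vfield)
  have p: "fst u \<in> mcarrier A" using u by (simp add: tbundle_iff)
  show ?thesis
    unfolding hlift_eq[OF smooth_A frame metric connection X Y(1) p Y(2)]
    by (rule hvec_in_tspace[OF smooth_A connection X Y(1) p Y(2)])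
qed

lemma snd_hlift:
  assumes X: "X \<in> vfields A" and Y: "Y \<in> vfields A" and u: "Y (fst u) = u" and c: "chart_around A (fst u) c"
  shows "snd (hlift A D X u) (tchart A c) = (snd (X (fst u)) c, christoffel D c X Y (fst u))"
  unfolding hlift_eq[OF smooth_A frame metric connection X Y chart_aroundD(4)[OF c] u]
  by (rule snd_hvec[OF smooth_A connection X Y c u])

lemma hlift_add:
  assumes X: "X \<in> vfields A" and X': "X' \<in> vfields A"
  shows "hlift A D (vf_add A X X') = vf_add (tbundle_atlas A) (hlift A D X) (hlift A D X')"
proof (rule extensionalityI)
  show "hlift A D (vf_add A X X') \<in> extensional (tbundle A)" by (simp add: hlift_def)
  show "vf_add (tbundle_atlas A) (hlift A D X) (hlift A D X') \<in> extensional (tbundle A)"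
    using vf_extensional(1)[of "tbundle_atlas A"] by simp
  fix u assume u: "u \<in> tbundle A"
  note XX = vf_add_in_vfields[OF smooth_A X X']
  obtain Y where Y: "Y \<in> vfields A" "Y (fst u) = u" using u by (rule obtain_vfield)
  have p: "fst u \<in> mcarrier A" using u by (simp add: tbundle_iff)
  obtain c where c: "chart_around A (fst u) c" using p by (rule obtain_chart)
  have "hlift A D (vf_add A X X') u = tadd (hlift A D X u) (hlift A D X' u)"
    by (rule tspace_eqI[OF hlift_in_tspace[OF XX u]
          tadd_in_tspace[OF smooth_atlas_tbundle[OF smooth_A] hlift_in_tspace[OF X u] hlift_in_tspace[OF X' u]]
          chart_around_tchart[OF u c]])
      (simp add: snd_hlift[OF XX Y c] snd_hlift[OF X Y c] snd_hlift[OF X' Y c] p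
        christoffel_add_left[OF smooth_A connection c X X' Y(1)])
  then show "hlift A D (vf_add A X X') u = vf_add (tbundle_atlas A) (hlift A D X) (hlift A D X') u"
    using u by simp
qed

lemma hlift_scale:
  assumes X: "X \<in> vfields A"
  shows "hlift A D (vf_scale A (\<lambda>_. r) X) = vf_scale (tbundle_atlas A) (\<lambda>_. r) (hlift A D X)"
proof (rule extensionalityI)
  show "hlift A D (vf_scale A (\<lambda>_. r) X) \<in> extensional (tbundle A)" by (simp add: hlift_def)
  show "vf_scale (tbundle_atlas A) (\<lambda>_. r) (hlift A D X) \<in> extensional (tbundle A)"
    using vf_extensional(2)[of "tbundle_atlas A"] by simp
  fix u assume u: "u \<in> tbundle A"
  note f = smooth_fun_const[OF smooth_A, of r]
  note XX = vf_scale_in_vfields[OF smooth_A f X]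
  obtain Y where Y: "Y \<in> vfields A" "Y (fst u) = u" using u by (rule obtain_vfield)
  have p: "fst u \<in> mcarrier A" using u by (simp add: tbundle_iff)
  obtain c where c: "chart_around A (fst u) c" using p by (rule obtain_chart)
  have "hlift A D (vf_scale A (\<lambda>_. r) X) u = tscale r (hlift A D X u)"
    by (rule tspace_eqI[OF hlift_in_tspace[OF XX u]
          tscale_in_tspace[OF smooth_atlas_tbundle[OF smooth_A] hlift_in_tspace[OF X u]]
          chart_around_tchart[OF u c]])
      (simp add: snd_hlift[OF XX Y c] snd_hlift[OF X Y c] p
        christoffel_scale_left[OF smooth_A connection c X f Y(1)])
  then show "hlift A D (vf_scale A (\<lambda>_. r) X) u = vf_scale (tbundle_atlas A) (\<lambda>_. r) (hlift A D X) u"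
    using u by simp
qed

text \<open>In coordinates the horizontal part is fixed by the base component of the vector. It
  contributes a Christoffel term in the fibre, so \<open>w\<close> is chosen to represent the fibre
  component minus this term.\<close>

lemma hlift_vlift_decomposition:
  assumes u: "u \<in> tbundle A" and xi: "\<xi> \<in> tspace (tbundle_atlas A) u"
  obtains v w where "\<xi> = tadd (hlift A D (E v) u) (vlift A (E w) u)"
proof -
  have p: "fst u \<in> mcarrier A" and ut: "u \<in> tspace A (fst u)" using u by (simp_all add: tbundle_iff)
  obtain c where c: "chart_around A (fst u) c" using p by (rule obtain_chart)
  note m = mkvec_in_tspace[OF smooth_A c] and EV = frameD(1)[OF frame]
  obtain Y where Y: "Y \<in> vfields A" "Y (fst u) = u" using u by (rule obtain_vfield)
  obtain v where v: "E v (fst u) = mkvec A c (fst u) (fst (snd \<xi> (tchart A c)))"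
    using frameD(4)[OF frame p m] by blast
  obtain w where w: "E w (fst u) =
      mkvec A c (fst u) (snd (snd \<xi> (tchart A c)) - christoffel D c (E v) Y (fst u))"
    using frameD(4)[OF frame p m] by blast
  have "\<xi> = tadd (hlift A D (E v) u) (vlift A (E w) u)"
  proof (rule tspace_eqI[OF xi _ chart_around_tchart[OF u c]])
    show "tadd (hlift A D (E v) u) (vlift A (E w) u) \<in> tspace (tbundle_atlas A) u"
      using tadd_in_tspace[OF smooth_atlas_tbundle[OF smooth_A] hlift_in_tspace[OF EV u]
          vert_in_tspace[OF smooth_A p ut vfieldsD(2)[OF smooth_A EV p]]]
      by (simp add: vlift_apply[OF u])
    show "snd \<xi> (tchart A c) = snd (tadd (hlift A D (E v) u) (vlift A (E w) u)) (tchart A c)"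
      by (simp add: snd_hlift[OF EV Y c] vlift_apply[OF u] snd_vert[OF smooth_A ut c] v w
          snd_mkvec[OF smooth_A c])
  qed
  then show ?thesis by (rule that)
qed

end

lemma vlift_add:
  assumes A: "smooth_atlas A" and X: "X \<in> vfields A" and X': "X' \<in> vfields A"
  shows "vlift A (vf_add A X X') = vf_add (tbundle_atlas A) (vlift A X) (vlift A X')"
proof (rule extensionalityI)
  note TA = smooth_atlas_tbundle[OF A]
  show "vlift A (vf_add A X X') \<in> extensional (tbundle A)" by (simp add: vlift_def)
  show "vf_add (tbundle_atlas A) (vlift A X) (vlift A X') \<in> extensional (tbundle A)"
    using vf_extensional(1)[of "tbundle_atlas A"] by simp
  fix u assume u: "u \<in> tbundle A"
  note in_t = vfieldsD(2)[OF TA vlift_in_vfields[OF A], of _ u, simplified, OF _ u]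
  have p: "fst u \<in> mcarrier A" and ut: "u \<in> tspace A (fst u)" using u by (simp_all add: tbundle_iff)
  obtain c where c: "chart_around A (fst u) c" using p by (rule obtain_chart)
  have "vlift A (vf_add A X X') u = tadd (vlift A X u) (vlift A X' u)"
    by (rule tspace_eqI[OF in_t[OF vf_add_in_vfields[OF A X X']] tadd_in_tspace[OF TA in_t[OF X] in_t[OF X']]
          chart_around_tchart[OF u c]])
      (simp add: vlift_apply[OF u] snd_vert[OF A ut c] p)
  then show "vlift A (vf_add A X X') u = vf_add (tbundle_atlas A) (vlift A X) (vlift A X') u"
    using u by simp
qed

lemma vlift_scale:
  assumes A: "smooth_atlas A" and X: "X \<in> vfields A"
  shows "vlift A (vf_scale A (\<lambda>_. r) X) = vf_scale (tbundle_atlas A) (\<lambda>_. r) (vlift A X)"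
proof (rule extensionalityI)
  note TA = smooth_atlas_tbundle[OF A]
  show "vlift A (vf_scale A (\<lambda>_. r) X) \<in> extensional (tbundle A)" by (simp add: vlift_def)
  show "vf_scale (tbundle_atlas A) (\<lambda>_. r) (vlift A X) \<in> extensional (tbundle A)"
    using vf_extensional(2)[of "tbundle_atlas A"] by simp
  fix u assume u: "u \<in> tbundle A"
  note in_t = vfieldsD(2)[OF TA vlift_in_vfields[OF A], of _ u, simplified, OF _ u]
  have p: "fst u \<in> mcarrier A" and ut: "u \<in> tspace A (fst u)" using u by (simp_all add: tbundle_iff)
  obtain c where c: "chart_around A (fst u) c" using p by (rule obtain_chart)
  have "vlift A (vf_scale A (\<lambda>_. r) X) u = tscale r (vlift A X u)"
    by (rule tspace_eqI[OF in_t[OF vf_scale_in_vfields[OF A smooth_fun_const[OF A] X]]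
          tscale_in_tspace[OF TA in_t[OF X]] chart_around_tchart[OF u c]])
      (simp add: vlift_apply[OF u] snd_vert[OF A ut c] p)
  then show "vlift A (vf_scale A (\<lambda>_. r) X) u = vf_scale (tbundle_atlas A) (\<lambda>_. r) (vlift A X) u"
    using u by simp
qed

section \<open>Lie groups\<close>

locale lie_group_atlas =
  fixes G :: "('a, 'm) monoid_scheme" (structure) and A :: "('a, 'e::euclidean_space) atlas"
  assumes lie_group: "lie_group G A"
begin

sublocale group G
  using lie_group by (simp add: lie_group_def)

lemma smooth_A: "smooth_atlas A"
  and carrier_eq [simp]: "carrier G = mcarrier A"
  using lie_group by (simp_all add: lie_group_def smooth_manifold_def)

text \<open>\<open>carrier_eq\<close> rewrites \<open>carrier G\<close> to
  \<open>mcarrier A\<close>, so the simplification rules of the group need premises in the rewritten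
  form.\<close>

lemmas group_closed [simp] = m_closed[unfolded carrier_eq] inv_closed[unfolded carrier_eq]
  one_closed[unfolded carrier_eq]

lemmas group_simps [simp] = r_inv[unfolded carrier_eq] l_inv[unfolded carrier_eq]
  l_one[unfolded carrier_eq] r_one[unfolded carrier_eq]

lemma smooth_at_mult:
  assumes B: "smooth_atlas B" and f: "smooth_at B A f x" and h: "smooth_at B A h x"
  shows "smooth_at B A (\<lambda>x. f x \<otimes> h x) x"
proof -
  note P = smooth_atlas_prod[OF smooth_A smooth_A]
  have "smooth_map (prod_atlas A A) A (\<lambda>(p, q). p \<otimes> q)" using lie_group by (simp add: lie_group_def)
  then have "smooth_at (prod_atlas A A) A (\<lambda>(p, q). p \<otimes> q) (f x, h x)"
    by (rule smooth_map_imp_smooth_at[OF P smooth_A])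
      (simp add: mcarrier_prod smooth_at_mcarrier(2)[OF f] smooth_at_mcarrier(2)[OF h])
  from smooth_at_compose[OF B P smooth_A smooth_at_Pair[OF B smooth_A smooth_A f h] this]
  show ?thesis by simp
qed

lemma smooth_at_inv: "p \<in> mcarrier A \<Longrightarrow> smooth_at A A (\<lambda>p. inv p) p"
  using lie_group smooth_map_imp_smooth_at[OF smooth_A smooth_A] by (simp add: lie_group_def)

lemma ltrans_apply [simp]: "ltrans G q p = q \<otimes> p"
  by (simp add: ltrans_def)

lemma smooth_at_ltrans: "q \<in> mcarrier A \<Longrightarrow> p \<in> mcarrier A \<Longrightarrow> smooth_at A A (ltrans G q) p"
  unfolding ltrans_def
  by (intro smooth_at_mult[OF smooth_A] smooth_at_const[OF smooth_A] smooth_at_id[OF smooth_A])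

abbreviation translate :: "'a \<Rightarrow> ('a, 'e) tvec \<Rightarrow> ('a, 'e) tvec" where
  "translate q \<equiv> tmap A A (ltrans G q)"

lemma translate_in_tspace:
  assumes q: "q \<in> mcarrier A" and p: "p \<in> mcarrier A" and v: "v \<in> tspace A p"
  shows "translate q v \<in> tspace A (q \<otimes> p)"
  using tmap_in_tspace[OF smooth_A smooth_A smooth_at_ltrans[OF q p] v] by (simp add: ltrans_def)

lemma translate_translate:
  assumes q: "q \<in> mcarrier A" and r: "r \<in> mcarrier A" and p: "p \<in> mcarrier A" and v: "v \<in> tspace A p"
  shows "translate q (translate r v) = translate (q \<otimes> r) v"
proof -
  have rp: "ltrans G r p \<in> mcarrier A" using r p by (simp add: ltrans_def)
  have "translate q (translate r v) = tmap A A (\<lambda>x. ltrans G q (ltrans G r x)) v"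
    by (rule tmap_compose[OF smooth_A smooth_A smooth_A smooth_at_ltrans[OF r p] smooth_at_ltrans[OF q rp] v])
  also have "\<dots> = translate (q \<otimes> r) v"
    by (rule tmap_cong[OF smooth_A smooth_A smooth_at_ltrans[of "q \<otimes> r" p] _ v])
      (use q r p m_assoc[of q r] in \<open>simp_all add: ltrans_def\<close>)
  finally show ?thesis .
qed

lemma translate_one:
  assumes p: "p \<in> mcarrier A" and v: "v \<in> tspace A p"
  shows "translate \<one> v = v"
proof -
  have "translate \<one> v = tmap A A (\<lambda>x. x) v"
    by (rule tmap_cong[OF smooth_A smooth_A smooth_at_id[OF smooth_A p] _ v]) (simp add: ltrans_def)
  then show ?thesis using tmap_id[OF smooth_A p v] by simp
qed

lemma translate_inv:
  assumes q: "q \<in> mcarrier A" and p: "p \<in> mcarrier A" and v: "v \<in> tspace A p"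
  shows "translate (inv q) (translate q v) = v" "translate q (translate (inv q) v) = v"
  using assms by (simp_all add: translate_translate[OF _ _ p v] translate_one[OF p v])

text \<open>In charts, \<open>(q, v) \<mapsto> T L\<^sub>q v\<close> is the partial derivative of the multiplication in its second
  argument.\<close>

lemma smooth_at_translate_prod:
  assumes q: "q \<in> mcarrier A" and v: "v \<in> tbundle A"
  shows "smooth_at (prod_atlas A (tbundle_atlas A)) (tbundle_atlas A) (\<lambda>x. translate (fst x) (snd x)) (q, v)"
proof -
  note TA = smooth_atlas_tbundle[OF smooth_A]
  note B = smooth_atlas_prod[OF smooth_A TA] and P = smooth_atlas_prod[OF smooth_A smooth_A]
  have p: "fst v \<in> mcarrier A" using v by (simp add: tbundle_iff)
  have v': "v \<in> mcarrier (tbundle_atlas A)" using v by simp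
  obtain c0 where c0: "chart_around A q c0" using q by (rule obtain_chart)
  obtain c where c: "chart_around A (fst v) c" using p by (rule obtain_chart)
  have qp: "q \<otimes> fst v \<in> mcarrier A" using q p by simp
  obtain d where d: "chart_around A (q \<otimes> fst v) d" using qp by (rule obtain_chart)
  note cA = chart_aroundD[OF c0] chart_aroundD[OF c] chart_aroundD[OF d]
  have sm: "smooth_at (prod_atlas A A) A (\<lambda>x. fst x \<otimes> snd x) (q, fst v)"
    by (intro smooth_at_mult[OF P] smooth_at_fst smooth_A q p)
  obtain W where W: "open W" "snd (chart_prod c0 c) (q, fst v) \<in> W" "W \<subseteq> cran (chart_prod c0 c)"
    "\<And>x. x \<in> W \<Longrightarrow> fst (cinv (chart_prod c0 c) x) \<otimes> snd (cinv (chart_prod c0 c) x) \<in> fst d"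
    "smooth_on W (\<lambda>x. snd d (fst (cinv (chart_prod c0 c) x) \<otimes> snd (cinv (chart_prod c0 c) x)))"
    using smooth_at_charts[OF P smooth_A sm chart_around_prod[OF c0 c], of d] d by auto
  define M where "M z = snd d (cinv c0 (fst z) \<otimes> cinv c (snd z))" for z
  have inv: "cinv (chart_prod c0 c) z = (cinv c0 (fst z), cinv c (snd z))" if "z \<in> W" for z
    using cinv_chart_prod[OF smooth_A smooth_A cA(1,5), of "fst z" "snd z"] that W(3)
    by (auto simp: cran_chart_prod)
  have M: "smooth_on W M"
    by (rule smooth_on_eq[OF W(1,5)]) (simp add: M_def inv)
  have Wc: "fst z \<in> cran c0" "snd z \<in> cran c" if "z \<in> W" for z
    using that W(3) by (auto simp: cran_chart_prod)
  \<comment> \<open>\<open>j\<close> drops the fibre coordinate: of (x, z, w), the part (x, z) is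
    where the local multiplication \<open>M\<close> is differentiated, and (0, w) is the
    direction.\<close>
  define j where "j y = (fst y, fst (snd y))" for y :: "'e \<times> 'e \<times> 'e"
  have j: "linear j" by (rule linearI) (simp_all add: j_def)
  define W' where "W' = j -` W"
  have oW': "open W'" unfolding W'_def
    by (rule open_vimage[OF W(1)]) (use j in \<open>simp add: linear_continuous_on linear_conv_bounded_linear\<close>)
  show ?thesis
  proof (rule smooth_at_tbundleI[OF smooth_A B, where c = d])
    fix x assume "x \<in> mcarrier (prod_atlas A (tbundle_atlas A))"
    then have "fst x \<in> mcarrier A" "fst (snd x) \<in> mcarrier A" "snd x \<in> tspace A (fst (snd x))"
      by (auto simp: mcarrier_prod tbundle_iff)
    then show "translate (fst x) (snd x) \<in> tbundle A"
      using tspace_tbundle[OF translate_in_tspace] by simp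
  next
    have "smooth_at (prod_atlas A (tbundle_atlas A)) A (\<lambda>x. fst (snd x)) (q, v)"
      by (rule smooth_at_compose[OF B TA smooth_A smooth_at_fst(2)[OF smooth_A TA q v'], of fst])
        (simp add: smooth_at_tbundle_fst[OF smooth_A v])
    then show "smooth_at (prod_atlas A (tbundle_atlas A)) A (\<lambda>x. fst (translate (fst x) (snd x))) (q, v)"
      using smooth_at_mult[OF B smooth_at_fst(1)[OF smooth_A TA q v']] by simp
    show "chart_around A (fst (translate (fst (q, v)) (snd (q, v)))) d" using d by simp
    note cc = chart_around_prod[OF c0 chart_around_tchart[OF v c]]
    have ran: "cran (chart_prod c0 (tchart A c)) = cran c0 \<times> cran c \<times> UNIV"
      using cran_tchart[OF smooth_A cA(5), of UNIV] by (simp add: cran_chart_prod)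
    show "smooth_at (prod_atlas A (tbundle_atlas A)) vspace_atlas (\<lambda>x. snd (translate (fst x) (snd x)) d) (q, v)"
    proof (rule smooth_at_vspaceI[OF cc oW'])
      show "snd (chart_prod c0 (tchart A c)) (q, v) \<in> W'"
        using W(2) by (simp add: W'_def j_def chart_prod_def)
      show "W' \<subseteq> cran (chart_prod c0 (tchart A c))"
        unfolding ran using Wc by (fastforce simp: W'_def j_def)
      have "linear (\<lambda>y :: 'e \<times> 'e \<times> 'e. (0 :: 'e, snd (snd y)))"
        by (rule linearI) simp_all
      then have "smooth_on W' (\<lambda>y. frechet_derivative M (at (j y)) (0, snd (snd y)))"
        using j by (intro smooth_on_frechet_derivative[OF W(1) M oW'] smooth_on_bounded_linear[OF oW'])
          (auto simp: W'_def linear_conv_bounded_linear)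
      then show "smooth_on W' (\<lambda>y. snd (translate (fst (cinv (chart_prod c0 (tchart A c)) y))
          (snd (cinv (chart_prod c0 (tchart A c)) y))) d)"
      proof (rule smooth_on_eq[OF oW'])
        fix y assume "y \<in> W'"
        then have jy: "j y \<in> W" by (simp add: W'_def)
        obtain x z w where y: "y = (x, z, w)" by (metis prod.collapse)
        have xz: "(x, z) \<in> W" using jy by (simp add: y j_def)
        have x: "x \<in> cran c0" and z: "z \<in> cran c" using Wc[OF xz] by simp_all
        have zw: "(z, w) \<in> cran (tchart A c)" using z cran_tchart[OF smooth_A cA(5), of UNIV] by simp
        have tc: "tchart A c \<in> tbundle_atlas A" using cA(5) by (simp add: tbundle_atlas_eq)
        have eq: "cinv (chart_prod c0 (tchart A c)) y = (cinv c0 x, mkvec A c (cinv c z) w)"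
          using cinv_chart_prod[OF smooth_A TA cA(1) tc x zw] cinv_tchart[OF smooth_A cA(5) z] by (simp add: y)
        note qx = chart_aroundD(4)[OF chart_around_cinv[OF cA(1) x]] and cz = chart_around_cinv[OF cA(5) z]
        note pz = chart_aroundD(4)[OF cz]
        have dz: "chart_around A (ltrans G (cinv c0 x) (cinv c z)) d"
          using W(4)[OF xz] cA(9) inv[OF xz] by (simp add: chart_around_def ltrans_def)
        have "snd (translate (cinv c0 x) (mkvec A c (cinv c z) w)) d =
            frechet_derivative (\<lambda>y. snd d (ltrans G (cinv c0 x) (cinv c y))) (at z) w"
          using snd_tmap[OF smooth_A smooth_A smooth_at_ltrans[OF qx pz] mkvec_in_tspace[OF smooth_A cz] cz dz]
          by (simp add: snd_mkvec[OF smooth_A cz] chart_cinv[OF z] ltrans_def)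
        also have "\<dots> = frechet_derivative (\<lambda>y. M (x, y)) (at z) w"
          by (simp add: M_def ltrans_def)
        \<comment> \<open>The partial derivative is rewritten as a derivative of \<open>M\<close>
          itself, because smooth dependence on all coordinates is available for the derivative of
          the joint map.\<close>
        also have "\<dots> = frechet_derivative M (at (x, z)) (0, w)"
        proof -
          have "((\<lambda>y. (x, y)) has_derivative (\<lambda>w. (0, w))) (at z)"
            by (intro has_derivative_Pair has_derivative_const has_derivative_ident)
          from has_derivative_compose[OF this smooth_on_has_derivative[OF M xz]]
          have "(\<lambda>w. frechet_derivative M (at (x, z)) (0, w)) = frechet_derivative (\<lambda>y. M (x, y)) (at z)"
            by (rule frechet_derivative_at)
          then show ?thesis by metis
        qed
        finally show "snd (translate (fst (cinv (chart_prod c0 (tchart A c)) y))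
            (snd (cinv (chart_prod c0 (tchart A c)) y))) d =
            frechet_derivative M (at (j y)) (0, snd (snd y))"
          by (simp add: eq) (simp add: y j_def)
      qed
    qed
  qed
qed

lemma smooth_at_translate:
  assumes B: "smooth_atlas B" and f: "smooth_at B A f x" and h: "smooth_at B (tbundle_atlas A) h x"
  shows "smooth_at B (tbundle_atlas A) (\<lambda>x. translate (f x) (h x)) x"
proof -
  note TA = smooth_atlas_tbundle[OF smooth_A]
  have "h x \<in> tbundle A" using smooth_at_mcarrier(2)[OF h] by simp
  from smooth_at_translate_prod[OF smooth_at_mcarrier(2)[OF f] this]
  have "smooth_at (prod_atlas A (tbundle_atlas A)) (tbundle_atlas A) (\<lambda>x. translate (fst x) (snd x)) (f x, h x)" .
  from smooth_at_compose[OF B smooth_atlas_prod[OF smooth_A TA] TA smooth_at_Pair[OF B smooth_A TA f h] this]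
  show ?thesis by simp
qed

subsection \<open>Left invariant vector fields\<close>

abbreviation linv :: "('a, 'e) tvec \<Rightarrow> ('a, 'e) vfield" where
  "linv \<equiv> linv_field G A"

lemma linv_apply [simp]: "p \<in> mcarrier A \<Longrightarrow> linv a p = translate p a"
  by (simp add: linv_field_def)

lemma lie_algD: "a \<in> lie_alg G A \<Longrightarrow> a \<in> tspace A \<one>" "a \<in> lie_alg G A \<Longrightarrow> fst a = \<one>"
  "a \<in> lie_alg G A \<Longrightarrow> a \<in> tbundle A"
  using tspaceD(1)[of a A \<one>] tspace_tbundle[of a A \<one>] by (simp_all add: lie_alg_def)

lemma linv_in_tspace: "a \<in> lie_alg G A \<Longrightarrow> p \<in> mcarrier A \<Longrightarrow> linv a p \<in> tspace A p"
  using translate_in_tspace[of p \<one> a] lie_algD(1) by simp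

lemma linv_in_vfields:
  assumes a: "a \<in> lie_alg G A"
  shows "linv a \<in> vfields A"
proof (rule vfieldsI_smooth[OF smooth_A])
  show "linv a \<in> extensional (mcarrier A)" by (simp add: linv_field_def)
  fix p assume p: "p \<in> mcarrier A"
  show "linv a p \<in> tspace A p" by (rule linv_in_tspace[OF a p])
  have "smooth_at A (tbundle_atlas A) (\<lambda>p. translate p a) p"
    by (rule smooth_at_translate[OF smooth_A smooth_at_id[OF smooth_A p] smooth_at_const[OF smooth_A p]])
      (simp add: lie_algD(3)[OF a])
  then show "smooth_at A (tbundle_atlas A) (linv a) p"
    by (rule smooth_at_cong[rotated]) simp
qed

lemma linv_add:
  assumes a: "a \<in> lie_alg G A" and b: "b \<in> lie_alg G A"
  shows "linv (tadd a b) = vf_add A (linv a) (linv b)"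
proof (rule extensionalityI)
  show "linv (tadd a b) \<in> extensional (mcarrier A)" by (simp add: linv_field_def)
  fix p assume p: "p \<in> mcarrier A"
  show "linv (tadd a b) p = vf_add A (linv a) (linv b) p"
    using p tmap_tadd[OF smooth_A smooth_A smooth_at_ltrans[of p \<one>] lie_algD(1)[OF a] lie_algD(1)[OF b]]
    by simp
qed simp

lemma linv_scale:
  assumes a: "a \<in> lie_alg G A"
  shows "linv (tscale r a) = vf_scale A (\<lambda>_. r) (linv a)"
proof (rule extensionalityI)
  show "linv (tscale r a) \<in> extensional (mcarrier A)" by (simp add: linv_field_def)
  fix p assume p: "p \<in> mcarrier A"
  show "linv (tscale r a) p = vf_scale A (\<lambda>_. r) (linv a) p"
    using p tmap_tscale[OF smooth_A smooth_A smooth_at_ltrans[of p \<one>] lie_algD(1)[OF a]]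
    by simp
qed simp

lemma lie_alg_tadd: "a \<in> lie_alg G A \<Longrightarrow> b \<in> lie_alg G A \<Longrightarrow> tadd a b \<in> lie_alg G A"
  and lie_alg_tscale: "a \<in> lie_alg G A \<Longrightarrow> tscale r a \<in> lie_alg G A"
  by (simp_all add: lie_alg_def tadd_in_tspace[OF smooth_A] tscale_in_tspace[OF smooth_A])

lemma translate_inv_in_lie_alg:
  assumes "u \<in> tbundle A"
  shows "translate (inv (fst u)) u \<in> lie_alg G A"
  using assms translate_in_tspace[of "inv (fst u)" "fst u" u] by (simp add: tbundle_iff lie_alg_def)

text \<open>Chosen by the same expression as the chart inside \<open>tmap\<close>. For a vector
  based at the neutral element, unfolding \<open>tmap\<close> thus yields a derivative in exactly
  this chart, which is used for the differential of \<rho>.\<close>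

definition unit_chart :: "('a, 'e) chart" where
  "unit_chart = (SOME c. chart_around A \<one> c)"

lemma unit_chart: "chart_around A \<one> unit_chart"
  unfolding unit_chart_def using obtain_chart[OF group_closed(3)] by (metis someI)

definition lie_vec :: "'e \<Rightarrow> ('a, 'e) tvec" where
  "lie_vec = mkvec A unit_chart \<one>"

lemma lie_vec_in: "lie_vec v \<in> lie_alg G A"
  by (simp add: lie_vec_def lie_alg_def mkvec_in_tspace[OF smooth_A unit_chart])

lemma snd_lie_vec: "snd (lie_vec v) unit_chart = v"
  by (simp add: lie_vec_def snd_mkvec[OF smooth_A unit_chart])

lemma lie_alg_eqI:
  "a \<in> lie_alg G A \<Longrightarrow> b \<in> lie_alg G A \<Longrightarrow> snd a unit_chart = snd b unit_chart \<Longrightarrow> a = b"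
  unfolding lie_alg_def by (rule tspace_eqI[OF _ _ unit_chart])

lemma lie_vec_snd: "a \<in> lie_alg G A \<Longrightarrow> lie_vec (snd a unit_chart) = a"
  by (rule lie_alg_eqI) (simp_all add: lie_vec_in snd_lie_vec)

lemma lie_vec_add: "lie_vec (v + w) = tadd (lie_vec v) (lie_vec w)"
  and lie_vec_scale: "lie_vec (r *\<^sub>R v) = tscale r (lie_vec v)"
  by (rule lie_alg_eqI; simp add: lie_vec_in lie_alg_tadd lie_alg_tscale snd_lie_vec)+

text \<open>A vector at \<open>p\<close> is translated back to the neutral element; its coordinates
  there parametrise the left invariant field through it.\<close>

lemma frame_linv: "frame A (\<lambda>v. linv (lie_vec v))"
  unfolding frame_def
proof (intro conjI allI ballI)
  fix p \<xi> assume p: "p \<in> mcarrier A" and xi: "\<xi> \<in> tspace A p"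
  have "translate (inv p) \<xi> \<in> lie_alg G A"
    using translate_in_tspace[of "inv p" p \<xi>] p xi by (simp add: lie_alg_def)
  then have "linv (lie_vec (snd (translate (inv p) \<xi>) unit_chart)) p = \<xi>"
    using p translate_inv(2)[OF p p xi] by (simp add: lie_vec_snd)
  then show "\<exists>v. linv (lie_vec v) p = \<xi>" by blast
qed (simp_all add: linv_in_vfields lie_vec_in lie_vec_add lie_vec_scale linv_add linv_scale)

lemma metric_linv:
  assumes g: "left_invariant_metric G A g" and p: "p \<in> mcarrier A"
    and a: "a \<in> lie_alg G A" and b: "b \<in> lie_alg G A"
  shows "g (linv a p) (linv b p) = g a b"
  using g p a b group_closed(3) linv_apply[OF p]
  unfolding left_invariant_metric_def lie_alg_def carrier_eq by metis

lemma const_frame_metric_linv: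
  assumes "riemannian_metric A g" "left_invariant_metric G A g"
  shows "const_frame_metric A (\<lambda>v. linv (lie_vec v)) g"
  using assms(1) metric_linv[OF assms(2) _ lie_vec_in lie_vec_in] by (simp add: const_frame_metric_def del: linv_apply)

subsection \<open>The trivialisation of the tangent bundle\<close>

lemma smooth_semi: "smooth_atlas (semi_atlas G A)"
  unfolding semi_atlas_def by (rule smooth_atlas_prod[OF smooth_A smooth_atlas_tspace[OF smooth_A]])

lemma mcarrier_semi: "mcarrier (semi_atlas G A) = mcarrier A \<times> lie_alg G A"
  by (simp add: semi_atlas_def mcarrier_prod lie_alg_def mcarrier_tspace_atlas[OF smooth_A])

lemma Theta_apply: "Theta G A u = (fst u, translate (inv (fst u)) u)"
  by (simp add: Theta_def)

lemma Theta_translate: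
  assumes "p \<in> mcarrier A" "a \<in> lie_alg G A"
  shows "Theta G A (translate p a) = (p, a)"
  using assms translate_inv(1)[of p \<one> a] by (simp add: Theta_apply lie_algD)

text \<open>Both directions are instances of the joint smoothness of (q, v) \<mapsto> T L_q v:
  \<open>Theta\<close> translates a vector by the inverse of its base point, and the inverse map
  translates an element of the Lie algebra by the group component.\<close>

lemma diffeo_Theta:
  "diffeo (tbundle_atlas A) (semi_atlas G A) (Theta G A) (\<lambda>x. translate (fst x) (snd x))"
  unfolding diffeo_def
proof (intro conjI ballI)
  note TA = smooth_atlas_tbundle[OF smooth_A] and T = smooth_atlas_tspace[OF smooth_A, of \<one>]
  {
    fix u assume "u \<in> mcarrier (tbundle_atlas A)"
    then have u: "u \<in> tbundle A" and p: "fst u \<in> mcarrier A" and ut: "u \<in> tspace A (fst u)"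
      by (simp_all add: tbundle_iff)
    note s1 = smooth_at_tbundle_fst[OF smooth_A u]
    have s2: "smooth_at (tbundle_atlas A) (tbundle_atlas A) (\<lambda>u. translate (inv (fst u)) u) u"
      by (rule smooth_at_translate[OF TA smooth_at_compose[OF TA smooth_A smooth_A s1 smooth_at_inv[OF p]]
            smooth_at_id[OF TA]]) (simp add: u)
    have c: "chart_around A (fst (translate (inv (fst u)) u)) unit_chart"
      using unit_chart p by simp
    have s3: "smooth_at (tbundle_atlas A) vspace_atlas (\<lambda>u. snd (translate (inv (fst u)) u) unit_chart) u"
      by (rule smooth_at_compose[OF TA TA smooth_atlas_vspace s2 smooth_at_tbundle_snd[OF smooth_A _ c]])
        (rule lie_algD(3)[OF translate_inv_in_lie_alg[OF u]])
    have "smooth_at (tbundle_atlas A) (tspace_atlas A \<one>) (\<lambda>u. translate (inv (fst u)) u) u"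
      by (rule smooth_at_tspace_atlasI[OF smooth_A TA _ unit_chart s3])
        (simp add: translate_inv_in_lie_alg[unfolded lie_alg_def])
    from smooth_at_Pair[OF TA smooth_A T s1 this]
    show "smooth_at (tbundle_atlas A) (semi_atlas G A) (Theta G A) u"
      by (simp add: semi_atlas_def Theta_def[abs_def])
    show "translate (fst (Theta G A u)) (snd (Theta G A u)) = u"
      by (simp add: Theta_apply translate_inv(2)[OF p p ut])
  }
  fix x assume x: "x \<in> mcarrier (semi_atlas G A)"
  then have x1: "fst x \<in> mcarrier A" and x2: "snd x \<in> lie_alg G A" by (auto simp: mcarrier_semi)
  note pr = smooth_at_fst[OF smooth_A T x1, of "snd x", folded semi_atlas_def]
  have x2': "snd x \<in> mcarrier (tspace_atlas A \<one>)"
    using x2 by (simp add: mcarrier_tspace_atlas[OF smooth_A] lie_alg_def)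
  have "smooth_at (semi_atlas G A) (tbundle_atlas A) snd x"
    using smooth_at_compose[OF smooth_semi T TA pr(2)[OF x2'], of "\<lambda>v. v"]
      smooth_at_tspace_inclusion[OF smooth_A group_closed(3) lie_algD(1)[OF x2]] by simp
  then show "smooth_at (semi_atlas G A) (tbundle_atlas A) (\<lambda>x. translate (fst x) (snd x)) x"
    using smooth_at_translate[OF smooth_semi] pr(1)[OF x2'] by simp
  show "Theta G A (translate (fst x) (snd x)) = x"
    using Theta_translate[OF x1 x2] by simp
qed

end

section \<open>Components of tangent maps into products\<close>

lemma snd_tmap_Pair:
  assumes A: "smooth_atlas A" and B: "smooth_atlas B" and C: "smooth_atlas C"
    and f: "smooth_at A B f p" and h: "smooth_at A C h p" and v: "v \<in> tspace A p"
    and d: "chart_around B (f p) d" and e: "chart_around C (h p) e"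
  shows "snd (tmap A (prod_atlas B C) (\<lambda>x. (f x, h x)) v) (chart_prod d e) =
    (snd (tmap A B f v) d, snd (tmap A C h v) e)"
proof -
  obtain c where c: "chart_around A p c" using smooth_at_mcarrier(1)[OF f] by (rule obtain_chart)
  have "((\<lambda>x. (snd d (f (cinv c x)), snd e (h (cinv c x)))) has_derivative
      (\<lambda>w. (frechet_derivative (\<lambda>x. snd d (f (cinv c x))) (at (snd c p)) w,
        frechet_derivative (\<lambda>x. snd e (h (cinv c x))) (at (snd c p)) w))) (at (snd c p))"
    by (intro has_derivative_Pair smooth_at_has_derivative smooth_at_rep[OF A B f c d] smooth_at_rep[OF A C h c e])
  from frechet_derivative_at[OF this, symmetric] show ?thesis
    using snd_tmap[OF A smooth_atlas_prod[OF B C] smooth_at_Pair[OF A B C f h] v c chart_around_prod[OF d e]]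
    by (simp add: snd_tmap[OF A B f v c d] snd_tmap[OF A C h v c e] chart_prod_def)
qed

lemma snd_tmap_const:
  assumes A: "smooth_atlas A" and B: "smooth_atlas B" and p: "p \<in> mcarrier A" and v: "v \<in> tspace A p"
    and d: "chart_around B q d"
  shows "snd (tmap A B (\<lambda>x. q) v) d = 0"
proof -
  obtain c where c: "chart_around A p c" using p by (rule obtain_chart)
  have "frechet_derivative (\<lambda>x. snd d q) (at (snd c p)) = (\<lambda>w. 0)"
    by (rule frechet_derivative_at[symmetric]) (rule has_derivative_const)
  then show ?thesis
    using snd_tmap[OF A B smooth_at_const[OF A p chart_aroundD(4)[OF d]] v c d] by simp
qed

lemma bounded_bilinear_matrix_vector: "bounded_bilinear ((*v) :: real^'n^'m \<Rightarrow> real^'n \<Rightarrow> real^'m)"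
  unfolding bilinear_conv_bounded_bilinear[symmetric] bilinear_def
  by (auto intro!: linearI simp: matrix_vector_right_distrib matrix_vector_mult_add_rdistrib
      matrix_vector_mult_scaleR scaleR_matrix_vector_assoc)

section \<open>Left invariant connections\<close>

locale invariant_connection = lie_group_atlas G A
  for G :: "('a, 'm) monoid_scheme" (structure) and A :: "('a, real^'n) atlas" +
  fixes D :: "('a, real^'n) vfield \<Rightarrow> ('a, real^'n) vfield \<Rightarrow> ('a, real^'n) vfield"
    and g :: "('a, real^'n) tvec \<Rightarrow> ('a, real^'n) tvec \<Rightarrow> real"
    and \<rho> :: "'a \<Rightarrow> ('a, real^'n) tvec \<Rightarrow> ('a, real^'n) tvec"
  assumes connection: "affine_connection A D" and invariant: "left_invariant_connection G A D"
    and metric: "riemannian_metric A g" and invariant_metric: "left_invariant_metric G A g"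
    and rho: "integrates_left_mult G A D \<rho>"
begin

sublocale fc: framed_connection A "\<lambda>v. linv (lie_vec v)" g D
  by unfold_locales (rule smooth_A frame_linv const_frame_metric_linv[OF metric invariant_metric] connection)+

abbreviation bullet :: "('a, real^'n) tvec \<Rightarrow> ('a, real^'n) tvec \<Rightarrow> ('a, real^'n) tvec" (infixl \<open>\<bullet>\<^sub>g\<close> 70) where
  "a \<bullet>\<^sub>g b \<equiv> lie_prod G A D a b"

lemma diffeo_ltrans: "q \<in> mcarrier A \<Longrightarrow> diffeo A A (ltrans G q) (ltrans G (inv q))"
  unfolding diffeo_def
  using m_assoc[of q "inv q"] m_assoc[of "inv q" q] by (simp add: smooth_at_ltrans flip: m_assoc)

lemma push_linv:
  assumes q: "q \<in> mcarrier A" and a: "a \<in> lie_alg G A"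
  shows "push A A (ltrans G q) (linv a) = linv a"
proof (rule extensionalityI)
  show "linv a \<in> extensional (mcarrier A)" by (simp add: linv_field_def)
  fix p assume p: "p \<in> mcarrier A"
  have "push A A (ltrans G q) (linv a) p = translate q (translate (inv q \<otimes> p) a)"
    using push_apply[OF diffeo_ltrans[OF q] p] p q by simp
  also have "\<dots> = translate p a"
    using translate_translate[OF q _ _ lie_algD(1)[OF a], of "inv q \<otimes> p"] p q m_assoc[of q "inv q" p] by simp
  finally show "push A A (ltrans G q) (linv a) p = linv a p" using p by simp
qed simp

lemma bullet_in: "a \<in> lie_alg G A \<Longrightarrow> b \<in> lie_alg G A \<Longrightarrow> a \<bullet>\<^sub>g b \<in> lie_alg G A"
  unfolding lie_prod_def lie_alg_def[of G A]
  by (rule vfieldsD(2)[OF smooth_A affine_connectionD(1)[OF connection]])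
    (simp_all add: linv_in_vfields lie_alg_def)

text \<open>By invariance of \<open>D\<close> and of the two fields, the covariant derivative is
  fixed by all left translations, hence is determined by its value at the neutral element.\<close>

lemma connection_linv:
  assumes a: "a \<in> lie_alg G A" and b: "b \<in> lie_alg G A"
  shows "D (linv a) (linv b) = linv (a \<bullet>\<^sub>g b)"
proof (rule extensionalityI)
  note ab = linv_in_vfields[OF a] linv_in_vfields[OF b]
  show "D (linv a) (linv b) \<in> extensional (mcarrier A)"
    by (rule vfieldsD(1)[OF smooth_A affine_connectionD(1)[OF connection ab]])
  show "linv (a \<bullet>\<^sub>g b) \<in> extensional (mcarrier A)" by (simp add: linv_field_def)
  fix p assume p: "p \<in> mcarrier A"
  have "push A A (ltrans G p) (D (linv a) (linv b)) = D (linv a) (linv b)"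
    using invariant ab p by (simp add: left_invariant_connection_def push_linv[OF p a] push_linv[OF p b])
  moreover have "push A A (ltrans G p) (D (linv a) (linv b)) p = translate p (D (linv a) (linv b) \<one>)"
    using push_apply[OF diffeo_ltrans[OF p] p] p by simp
  ultimately show "D (linv a) (linv b) p = linv (a \<bullet>\<^sub>g b) p"
    using p by (simp add: lie_prod_def)
qed

text \<open>The extra term of the Leibniz rule vanishes because constants have derivative 0.\<close>

lemma connection_const_scale:
  assumes X: "X \<in> vfields A" and Y: "Y \<in> vfields A" and p: "p \<in> mcarrier A"
  shows "D X (vf_scale A (\<lambda>_. r) Y) p = tscale r (D X Y p)"
proof -
  note c = smooth_fun_const[OF smooth_A, of r]
  obtain e where e: "chart_around A p e" using p by (rule obtain_chart)
  have "frechet_derivative (\<lambda>x. r) (at (snd e p)) = (\<lambda>w. 0)"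
    by (rule frechet_derivative_at[symmetric]) (rule has_derivative_const)
  then have "vf_deriv A X (\<lambda>_. r) p = 0"
    using vf_deriv_eq[OF smooth_A X smooth_at_const[OF smooth_A p] e, of r] by simp
  then show ?thesis
    using p affine_connectionD(5)[OF connection X Y c]
      vfieldsD(4)[OF smooth_A Y p] vfieldsD(4)[OF smooth_A affine_connectionD(1)[OF connection X Y] p]
    by (auto intro!: tvec_eqI)
qed

lemma bullet_linear:
  assumes a: "a \<in> lie_alg G A"
  shows "linear (\<lambda>w. snd (a \<bullet>\<^sub>g lie_vec w) unit_chart)"
  by (rule linearI)
    (simp_all add: lie_prod_def lie_vec_add lie_vec_scale linv_add linv_scale lie_vec_in
      affine_connectionD(4)[OF connection linv_in_vfields[OF a] linv_in_vfields[OF lie_vec_in] linv_in_vfields[OF lie_vec_in]]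
      connection_const_scale[OF linv_in_vfields[OF a] linv_in_vfields[OF lie_vec_in]])

subsection \<open>The integrated representation\<close>

lemma rho_in_GL: "q \<in> mcarrier A \<Longrightarrow> \<rho> q \<in> carrier (GL_tspace A \<one>)"
  using rho unfolding integrates_left_mult_def hom_def by auto

lemma rho_in: "q \<in> mcarrier A \<Longrightarrow> x \<in> lie_alg G A \<Longrightarrow> \<rho> q x \<in> lie_alg G A"
  using rho_in_GL[of q] by (auto simp: GL_tspace_def lie_alg_def bij_betw_def)

lemma rho_mult:
  assumes "q \<in> mcarrier A" "r \<in> mcarrier A" "x \<in> lie_alg G A"
  shows "\<rho> (q \<otimes> r) x = \<rho> q (\<rho> r x)"
proof -
  have "\<rho> (q \<otimes> r) = compose (tspace A \<one>) (\<rho> q) (\<rho> r)"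
    using rho assms(1,2) by (simp add: integrates_left_mult_def hom_def GL_tspace_def)
  then show ?thesis using assms(3) by (simp add: compose_eq lie_alg_def)
qed

text \<open>Multiplicativity gives \<rho>(1) \<rho>(1) = \<rho>(1), and \<rho>(1) is
  injective.\<close>

lemma rho_one:
  assumes x: "x \<in> lie_alg G A"
  shows "\<rho> \<one> x = x"
proof -
  have "inj_on (\<rho> \<one>) (lie_alg G A)"
    using rho_in_GL[of \<one>] by (simp add: GL_tspace_def bij_betw_def lie_alg_def)
  moreover have "\<rho> \<one> (\<rho> \<one> x) = \<rho> \<one> x" using rho_mult[of \<one> \<one> x] x by simp
  ultimately show ?thesis using x rho_in[of \<one> x] by (auto dest: inj_onD)
qed

text \<open>The chart of \<open>GL_atlas A \<one>\<close> induced by the component isomorphism of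
  \<open>unit_chart\<close>; \<open>lie_vec\<close> is the inverse of that isomorphism.\<close>

definition mat_of :: "(('a, real^'n) tvec \<Rightarrow> ('a, real^'n) tvec) \<Rightarrow> real^'n^'n" where
  "mat_of F = matrix (\<lambda>w. snd (F (lie_vec w)) unit_chart)"

lemma GL_atlas_chart: "(carrier (GL_tspace A \<one>), mat_of) \<in> GL_atlas A \<one>"
proof -
  have iso: "tspace_iso A \<one> (\<lambda>v. snd v unit_chart)" by (rule tspace_iso_component[OF smooth_A unit_chart])
  then have inj: "inj_on (\<lambda>v. snd v unit_chart) (tspace A \<one>)" by (simp add: tspace_iso_def bij_betw_def)
  have "inv_into (tspace A \<one>) (\<lambda>v. snd v unit_chart) w = lie_vec w" for w
    by (rule inv_into_f_eq[OF inj]) (use lie_vec_in snd_lie_vec in \<open>simp_all add: lie_alg_def\<close>)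
  then have "mat_of = (\<lambda>F. matrix ((\<lambda>v. snd v unit_chart) \<circ> F \<circ> inv_into (tspace A \<one>) (\<lambda>v. snd v unit_chart)))"
    by (simp add: mat_of_def[abs_def] comp_def)
  then show ?thesis unfolding GL_atlas_def using iso by blast
qed

lemma mat_of_rho:
  assumes q: "q \<in> mcarrier A" and x: "x \<in> lie_alg G A"
  shows "mat_of (\<rho> q) *v snd x unit_chart = snd (\<rho> q x) unit_chart"
proof -
  have lin: "linear_on_tspace A \<one> (\<rho> q)" using rho_in_GL[OF q] by (simp add: GL_tspace_def)
  have "linear (\<lambda>w. snd (\<rho> q (lie_vec w)) unit_chart)"
    by (rule linearI)
      (use lin lie_vec_in in \<open>simp_all add: linear_on_tspace_def lie_alg_def lie_vec_add lie_vec_scale\<close>)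
  then show ?thesis by (simp add: mat_of_def matrix_works lie_vec_snd[OF x])
qed

text \<open>Smoothness of \<rho> is used in the single target chart \<open>mat_of\<close>. Since
  \<rho> takes values in its domain everywhere, the local expression is smooth on all of the source
  chart.\<close>

lemma smooth_at_mat_of_rho:
  assumes q: "q \<in> mcarrier A"
  shows "smooth_at A vspace_atlas (\<lambda>q. mat_of (\<rho> q)) q"
proof -
  obtain c where c: "chart_around A q c" using q by (rule obtain_chart)
  note cA = chart_aroundD[OF c]
  have "fst c \<inter> \<rho> -` carrier (GL_tspace A \<one>) = fst c"
    using rho_in_GL cA(1) by (auto simp: mcarrier_def)
  moreover have "smooth_on (snd c ` (fst c \<inter> \<rho> -` carrier (GL_tspace A \<one>))) (mat_of \<circ> \<rho> \<circ> cinv c)"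
    using rho cA(1) GL_atlas_chart unfolding integrates_left_mult_def smooth_map_def
    by (cases c) fastforce
  ultimately show ?thesis
    by (intro smooth_at_vspaceI[OF c smooth_atlas_open_cran[OF smooth_A cA(1)] cA(3)])
      (simp_all add: comp_def)
qed

lemma mat_of_rho_has_derivative:
  "((\<lambda>y. mat_of (\<rho> (cinv unit_chart y))) has_derivative
    frechet_derivative (\<lambda>y. mat_of (\<rho> (cinv unit_chart y))) (at (snd unit_chart \<one>))) (at (snd unit_chart \<one>))"
  using smooth_at_local_rep[OF smooth_A smooth_A smooth_atlas_vspace smooth_at_id[OF smooth_A] unit_chart
      smooth_at_mat_of_rho]
  by (intro smooth_at_has_derivative) simp

text \<open>The hypothesis on the differential of \<rho> equates a tangent map with a velocity. Read
  in the chart \<open>mat_of\<close> it becomes an equation of matrices, which is then applied to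
  the coordinates of \<open>x\<close>.\<close>

lemma frechet_derivative_mat_of_rho:
  assumes a: "a \<in> lie_alg G A" and x: "x \<in> lie_alg G A"
  shows "frechet_derivative (\<lambda>y. mat_of (\<rho> (cinv unit_chart y))) (at (snd unit_chart \<one>)) (snd a unit_chart)
    *v snd x unit_chart = snd (a \<bullet>\<^sub>g x) unit_chart"
proof -
  let ?d = "(carrier (GL_tspace A \<one>), mat_of)"
  let ?c = "\<lambda>t. \<lambda>b\<in>lie_alg G A. tadd b (tscale t (a \<bullet>\<^sub>g b))"
  have eq: "tmap A (GL_atlas A \<one>) \<rho> a = velocity (GL_atlas A \<one>) ?c"
    using rho a by (simp add: integrates_left_mult_def)
  \<comment> \<open>Tangent vectors contain their base point, so the equation also identifies the
    start of the curve with \<rho>(1). This puts the start into the domain of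
    \<open>mat_of\<close>.\<close>
  have "\<rho> \<one> = ?c 0"
    using arg_cong[OF eq, of fst] lie_algD(2)[OF a] by (simp add: velocity_def)
  then have c0: "chart_around (GL_atlas A \<one>) (?c 0) ?d"
    using GL_atlas_chart rho_in_GL[of \<one>] by (simp add: chart_around_def)
  have r1: "chart_around (GL_atlas A \<one>) (\<rho> \<one>) ?d"
    using GL_atlas_chart rho_in_GL[of \<one>] by (simp add: chart_around_def)
  define N where "N w = snd (a \<bullet>\<^sub>g lie_vec w) unit_chart" for w
  \<comment> \<open>In matrix coordinates the curve t \<mapsto> Id + t F, with F the left
    multiplication by \<open>a\<close>, is affine, so its velocity is the matrix of F.\<close>
  have "mat_of (?c t) = mat 1 + t *\<^sub>R matrix N" for t
  proof -
    have "(\<lambda>w. snd (?c t (lie_vec w)) unit_chart) = (\<lambda>w. w + t *\<^sub>R N w)"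
      by (simp add: lie_vec_in snd_lie_vec N_def)
    then show ?thesis
      by (simp add: mat_of_def matrix_def mat_def vec_eq_iff axis_def)
  qed
  then have "vector_derivative (\<lambda>t. mat_of (?c t)) (at 0) = matrix N"
    using vector_derivative_affine_curve[of "mat 1" "matrix N"] by simp
  then have "snd (tmap A (GL_atlas A \<one>) \<rho> a) ?d = matrix N"
    using snd_velocity[of "GL_atlas A \<one>" ?c ?d] c0 by (simp add: eq)
  moreover have "snd (tmap A (GL_atlas A \<one>) \<rho> a) ?d =
      frechet_derivative (\<lambda>y. mat_of (\<rho> (cinv unit_chart y))) (at (snd unit_chart \<one>)) (snd a unit_chart)"
    using r1 lie_algD(2)[OF a] by (simp add: tmap_def Let_def unit_chart_def comp_def)
  moreover have "matrix N *v snd x unit_chart = snd (a \<bullet>\<^sub>g x) unit_chart"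
    using matrix_works[of N "snd x unit_chart"] bullet_linear[OF a] by (simp add: N_def[abs_def] lie_vec_snd[OF x])
  ultimately show ?thesis by simp
qed

lemma smooth_at_rho_inv:
  assumes q: "q \<in> mcarrier A" and x: "x \<in> lie_alg G A"
  shows "smooth_at A vspace_atlas (\<lambda>q. snd (\<rho> (inv q) x) unit_chart) q"
proof (rule smooth_at_cong)
  have q': "inv q \<in> mcarrier A" using q by simp
  show "smooth_at A vspace_atlas (\<lambda>q. mat_of (\<rho> (inv q)) *v snd x unit_chart) q"
    by (rule smooth_at_bilinear[OF smooth_A
          smooth_at_compose[OF smooth_A smooth_A smooth_atlas_vspace smooth_at_inv[OF q] smooth_at_mat_of_rho[OF q']]
          smooth_at_const[OF smooth_A q] bounded_bilinear_matrix_vector]) simp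
qed (simp add: mat_of_rho x)

text \<open>Obtained by differentiating \<open>\<rho>(q) \<rho>(q\<inverse>) x = x\<close> at the neutral element.\<close>

lemma frechet_derivative_rho_inv:
  assumes a: "a \<in> lie_alg G A" and x: "x \<in> lie_alg G A"
  shows "frechet_derivative (\<lambda>y. snd (\<rho> (inv (cinv unit_chart y)) x) unit_chart)
    (at (snd unit_chart \<one>)) (snd a unit_chart) = - snd (a \<bullet>\<^sub>g x) unit_chart"
proof -
  let ?y = "snd unit_chart \<one>"
  let ?f = "\<lambda>y. mat_of (\<rho> (cinv unit_chart y))" and ?h = "\<lambda>y. snd (\<rho> (inv (cinv unit_chart y)) x) unit_chart"
  note uA = chart_aroundD[OF unit_chart]
  have one: "cinv unit_chart ?y = \<one>" by (rule cinv_chart[OF smooth_A uA(1,2)])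
  have "smooth_at vspace_atlas vspace_atlas ?h ?y"
    using smooth_at_local_rep[OF smooth_A smooth_A smooth_atlas_vspace smooth_at_id[OF smooth_A] unit_chart
        smooth_at_rho_inv[OF _ x]] by simp
  then have h: "(?h has_derivative frechet_derivative ?h (at ?y)) (at ?y)"
    by (rule smooth_at_has_derivative)
  have "?f y *v ?h y = snd x unit_chart" if "y \<in> cran unit_chart" for y
  proof -
    have q: "cinv unit_chart y \<in> mcarrier A"
      by (rule chart_aroundD(4)[OF chart_around_cinv[OF uA(1) that]])
    have "\<rho> (cinv unit_chart y) (\<rho> (inv (cinv unit_chart y)) x) = x"
      using rho_mult[OF q, of "inv (cinv unit_chart y)" x] q x rho_one[OF x] by simp
    then show ?thesis using mat_of_rho[OF q rho_in[OF _ x]] q by simp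
  qed
  then have "frechet_derivative (\<lambda>y. ?f y *v ?h y) (at ?y) = frechet_derivative (\<lambda>y. snd x unit_chart) (at ?y)"
    by (rule frechet_derivative_cong_open[OF smooth_atlas_open_cran[OF smooth_A uA(1)] uA(3)])
  also have "\<dots> = (\<lambda>w. 0)"
    by (rule frechet_derivative_at[symmetric]) (rule has_derivative_const)
  finally have "(\<lambda>w. ?f ?y *v frechet_derivative ?h (at ?y) w + frechet_derivative ?f (at ?y) w *v ?h ?y) = (\<lambda>w. 0)"
    using frechet_derivative_at[OF bounded_bilinear.FDERIV[OF bounded_bilinear_matrix_vector
        mat_of_rho_has_derivative h]] by simp
  \<comment> \<open>At the neutral element the undifferentiated factors are trivial: the matrix of
    \<rho>(1) acts as the identity, and \<rho>(inv 1) x is \<open>x\<close>.\<close>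
  then have "mat_of (\<rho> \<one>) *v frechet_derivative ?h (at ?y) (snd a unit_chart) +
      frechet_derivative ?f (at ?y) (snd a unit_chart) *v snd (\<rho> (inv \<one>) x) unit_chart = 0"
    unfolding one by metis
  moreover have "mat_of (\<rho> \<one>) *v w = w" for w
    using mat_of_rho[of \<one> "lie_vec w"] by (simp add: rho_one lie_vec_in snd_lie_vec)
  moreover have "\<rho> (inv \<one>) x = x" using rho_one[OF x] by simp
  ultimately show ?thesis
    by (simp add: frechet_derivative_mat_of_rho[OF a x] eq_neg_iff_add_eq_0)
qed

subsection \<open>Left invariant fields on the semidirect product\<close>

abbreviation SG where "SG \<equiv> semi_group G A \<rho>"
abbreviation SA where "SA \<equiv> semi_atlas G A"

definition alg_chart :: "(('a, real^'n) tvec, real^'n) chart" where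
  "alg_chart = (tspace A \<one>, \<lambda>v. snd v unit_chart)"

lemma snd_alg_chart [simp]: "snd alg_chart v = snd v unit_chart"
  by (simp add: alg_chart_def)

lemma chart_around_alg: "x \<in> lie_alg G A \<Longrightarrow> chart_around (tspace_atlas A \<one>) x alg_chart"
  unfolding alg_chart_def by (rule chart_around_tspace_atlas[OF smooth_A unit_chart lie_algD(1)])

lemma chart_around_semi:
  "chart_around A p c \<Longrightarrow> x \<in> lie_alg G A \<Longrightarrow> chart_around SA (p, x) (chart_prod c alg_chart)"
  unfolding semi_atlas_def by (rule chart_around_prod[OF _ chart_around_alg])

lemmas T1 = smooth_atlas_tspace[OF smooth_A, of \<one>]

lemma mcarrier_T1: "mcarrier (tspace_atlas A \<one>) = lie_alg G A"
  by (simp add: mcarrier_tspace_atlas[OF smooth_A] lie_alg_def)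

lemma smooth_at_alg:
  assumes B: "smooth_atlas B" and f: "\<And>x. x \<in> mcarrier B \<Longrightarrow> f x \<in> lie_alg G A"
    and s: "smooth_at B vspace_atlas (\<lambda>x. snd (f x) unit_chart) q"
  shows "smooth_at B (tspace_atlas A \<one>) f q"
  by (rule smooth_at_tspace_atlasI[OF smooth_A B _ unit_chart s]) (use f in \<open>simp add: lie_alg_def\<close>)

lemma ltrans_SG: "ltrans SG (p, x) = (\<lambda>z. (p \<otimes> fst z, tadd (snd z) (\<rho> (inv (fst z)) x)))"
  by (rule ext) (simp add: ltrans_def semi_group_def split: prod.split)

lemma smooth_at_ltrans_SG:
  assumes p: "p \<in> mcarrier A" and x: "x \<in> lie_alg G A" and q: "q \<in> mcarrier A" and b: "b \<in> lie_alg G A"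
  shows "smooth_at SA SA (ltrans SG (p, x)) (q, b)"
proof -
  have b': "b \<in> mcarrier (tspace_atlas A \<one>)" using b by (simp add: mcarrier_T1)
  note pr = smooth_at_fst[OF smooth_A T1 q b', folded semi_atlas_def]
  have s1: "smooth_at SA A (\<lambda>z. p \<otimes> fst z) (q, b)"
    by (rule smooth_at_mult[OF smooth_semi smooth_at_const[OF smooth_semi smooth_at_mcarrier(1)[OF pr(1)] p] pr(1)])
  have "smooth_at SA vspace_atlas (\<lambda>z. snd (snd z) unit_chart) (q, b)"
    by (rule smooth_at_compose[OF smooth_semi T1 smooth_atlas_vspace pr(2)])
      (simp add: smooth_at_tspace_component[OF smooth_A unit_chart lie_algD(1)[OF b]])
  moreover have "smooth_at SA vspace_atlas (\<lambda>z. snd (\<rho> (inv (fst z)) x) unit_chart) (q, b)"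
    by (rule smooth_at_compose[OF smooth_semi smooth_A smooth_atlas_vspace pr(1)])
      (simp add: smooth_at_rho_inv[OF q x])
  ultimately have s2: "smooth_at SA vspace_atlas (\<lambda>z. snd (tadd (snd z) (\<rho> (inv (fst z)) x)) unit_chart) (q, b)"
    using smooth_at_add[OF smooth_semi] by simp
  have "smooth_at SA (tspace_atlas A \<one>) (\<lambda>z. tadd (snd z) (\<rho> (inv (fst z)) x)) (q, b)"
    by (rule smooth_at_alg[OF smooth_semi _ s2]) (auto simp: mcarrier_semi lie_alg_tadd rho_in x)
  from smooth_at_Pair[OF smooth_semi smooth_A T1 s1 this]
  show ?thesis by (simp add: ltrans_SG semi_atlas_def)
qed

lemma lie_alg_tzero: "tzero \<one> \<in> lie_alg G A"
  by (simp add: lie_alg_def tzero_in_tspace[OF smooth_A])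

lemma smooth_at_alg_curve:
  assumes p: "p \<in> mcarrier A" and x: "x \<in> lie_alg G A" and y: "y \<in> lie_alg G A"
  shows "smooth_at vspace_atlas SA (\<lambda>t. (p, tadd x (tscale t y))) 0"
  unfolding semi_atlas_def
  by (intro smooth_at_Pair[OF smooth_atlas_vspace smooth_A T1] smooth_at_const[OF smooth_atlas_vspace _ p]
      smooth_at_alg[OF smooth_atlas_vspace])
    (simp_all add: lie_alg_tadd lie_alg_tscale x y smooth_at_affine_curve)

lemma snd_alg_curve:
  assumes c: "chart_around A p c" and x: "x \<in> lie_alg G A"
  shows "snd (velocity SA (\<lambda>t. (p, tadd x (tscale t y)))) (chart_prod c alg_chart) = (0, snd y unit_chart)"
proof -
  have "chart_around SA (p, tadd x (tscale 0 y)) (chart_prod c alg_chart)"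
    using chart_around_semi[OF c x] by (simp add: tadd_tscale_0)
  moreover have "((\<lambda>t. snd x unit_chart + t *\<^sub>R snd y unit_chart) has_vector_derivative snd y unit_chart) (at 0)"
    by (auto intro!: derivative_eq_intros)
  ultimately show ?thesis
    by (subst snd_velocity) (simp_all add: vector_derivative_Pair_const chart_prod_def)
qed

text \<open>By linearity the two summands of \<open>phi_vec\<close> are translated separately: q
  \<mapsto> (q, 0) becomes q \<mapsto> (p q, \<rho>(inv q) x), and t \<mapsto> (1, t b) becomes t
  \<mapsto> (p, x + t b). The smoothness claim is kept for placing the sum in the right tangent
  space.\<close>

lemma phi_field_apply:
  assumes p: "p \<in> mcarrier A" and x: "x \<in> lie_alg G A" and a: "a \<in> lie_alg G A" and b: "b \<in> lie_alg G A"
  shows "phi_field G A \<rho> a b (p, x) =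
    tadd (tmap A SA (\<lambda>q. (p \<otimes> q, \<rho> (inv q) x)) a) (velocity SA (\<lambda>t. (p, tadd x (tscale t b))))"
    (is "_ = tadd ?u ?v")
    and "smooth_at A SA (\<lambda>q. (p \<otimes> q, \<rho> (inv q) x)) \<one>"
proof -
  note one = group_closed(3)
  note a1 = lie_algD(1)[OF a]
  have z: "tzero \<one> = tadd (tzero \<one>) (tscale 0 b)" by (simp add: tadd_tscale_0)
  have s1: "smooth_at A SA (\<lambda>q. (q, tzero \<one>)) \<one>"
    unfolding semi_atlas_def
    by (rule smooth_at_Pair[OF smooth_A smooth_A T1 smooth_at_id[OF smooth_A one] smooth_at_const[OF smooth_A one]])
      (simp add: mcarrier_T1 lie_alg_tzero)
  note L = smooth_at_ltrans_SG[OF p x one lie_alg_tzero]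
  \<comment> \<open>Writing t b as 0 + t b makes the curve an instance of the affine curves treated
    before.\<close>
  have b0: "(\<lambda>t. (\<one>, tscale t b)) = (\<lambda>t. (\<one>, tadd (tzero \<one>) (tscale t b)))"
    by (rule ext) (auto intro!: tvec_eqI simp: lie_algD(2)[OF b])
  have s2: "smooth_at vspace_atlas SA (\<lambda>t. (\<one>, tscale t b)) 0"
    unfolding b0 by (rule smooth_at_alg_curve[OF one lie_alg_tzero b])
  have L': "smooth_at SA SA (ltrans SG (p, x)) (\<one>, tscale 0 b)"
    using L lie_algD(2)[OF b] by (simp add: tscale_0)
  have t1: "tmap A SA (\<lambda>q. (q, tzero \<one>)) a \<in> tspace SA (\<one>, tzero \<one>)"
    by (rule tmap_in_tspace[OF smooth_A smooth_semi s1 a1])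
  have t2: "velocity SA (\<lambda>t. (\<one>, tscale t b)) \<in> tspace SA (\<one>, tzero \<one>)"
    using velocity_in_tspace[OF smooth_semi s2] lie_algD(2)[OF b] by (simp add: tscale_0)
  have px: "(p, x) \<in> mcarrier SA" using p x by (simp add: mcarrier_semi)
  \<comment> \<open>\<open>tadd\<close> takes its base point from the left summand, so the identity
    rests on \<rho>(inv q) x being based at the neutral element.\<close>
  have r: "tadd (tzero \<one>) (\<rho> (inv q) x) = \<rho> (inv q) x" if "q \<in> mcarrier A" for q
    using lie_algD(2)[OF rho_in[of "inv q" x]] that x by (intro tvec_eqI) simp_all
  have s3: "smooth_at A SA (\<lambda>q. ltrans SG (p, x) (q, tzero \<one>)) \<one>"
    by (rule smooth_at_compose[OF smooth_A smooth_semi smooth_semi s1 L])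
  then show s4: "smooth_at A SA (\<lambda>q. (p \<otimes> q, \<rho> (inv q) x)) \<one>"
    by (rule smooth_at_cong[rotated]) (simp add: ltrans_SG r)
  have "phi_field G A \<rho> a b (p, x) = tmap SA SA (ltrans SG (p, x)) (phi_vec G A a b)"
    using px by (simp add: phi_field_def linv_field_def)
  also have "\<dots> = tadd (tmap SA SA (ltrans SG (p, x)) (tmap A SA (\<lambda>q. (q, tzero \<one>)) a))
      (tmap SA SA (ltrans SG (p, x)) (velocity SA (\<lambda>t. (\<one>, tscale t b))))"
    unfolding phi_vec_def by (rule tmap_tadd[OF smooth_semi smooth_semi L t1 t2])
  also have "tmap SA SA (ltrans SG (p, x)) (tmap A SA (\<lambda>q. (q, tzero \<one>)) a) =
      tmap A SA (\<lambda>q. ltrans SG (p, x) (q, tzero \<one>)) a"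
    by (rule tmap_compose[OF smooth_A smooth_semi smooth_semi s1 L a1])
  also have "\<dots> = ?u"
    by (rule tmap_cong[OF smooth_A smooth_semi s4 _ a1]) (simp add: ltrans_SG r)
  also have "tmap SA SA (ltrans SG (p, x)) (velocity SA (\<lambda>t. (\<one>, tscale t b))) =
      velocity SA (\<lambda>t. ltrans SG (p, x) (\<one>, tscale t b))"
    by (rule tmap_velocity[OF smooth_semi smooth_semi s2 L'])
  also have "(\<lambda>t. ltrans SG (p, x) (\<one>, tscale t b)) = (\<lambda>t. (p, tadd x (tscale t b)))"
    using p x lie_algD(2)[OF x] lie_algD(2)[OF b]
    by (auto simp: ltrans_SG rho_one intro!: tvec_eqI)
  finally show "phi_field G A \<rho> a b (p, x) = tadd ?u ?v" .
qed

lemma phi_field_in_tspace: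
  assumes p: "p \<in> mcarrier A" and x: "x \<in> lie_alg G A" and a: "a \<in> lie_alg G A" and b: "b \<in> lie_alg G A"
  shows "phi_field G A \<rho> a b (p, x) \<in> tspace SA (p, x)"
  unfolding phi_field_apply(1)[OF assms]
  using tadd_in_tspace[OF smooth_semi, of _ "(p, x)"]
    tmap_in_tspace[OF smooth_A smooth_semi phi_field_apply(2)[OF assms] lie_algD(1)[OF a]]
    velocity_in_tspace[OF smooth_semi smooth_at_alg_curve[OF p x b]] p
  by (simp add: tadd_tscale_0 rho_one[OF x])

lemma snd_phi_field:
  assumes c: "chart_around A p c" and x: "x \<in> lie_alg G A" and a: "a \<in> lie_alg G A" and b: "b \<in> lie_alg G A"
  shows "snd (phi_field G A \<rho> a b (p, x)) (chart_prod c alg_chart) =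
    (snd (linv a p) c, snd b unit_chart - snd (a \<bullet>\<^sub>g x) unit_chart)"
proof -
  note p = chart_aroundD(4)[OF c] and one = group_closed(3) and a1 = lie_algD(1)[OF a]
  have s1: "smooth_at A A (\<lambda>q. p \<otimes> q) \<one>" using smooth_at_ltrans[OF p one] by (simp add: ltrans_def)
  have s2: "smooth_at A (tspace_atlas A \<one>) (\<lambda>q. \<rho> (inv q) x) \<one>"
    by (rule smooth_at_alg[OF smooth_A _ smooth_at_rho_inv[OF one x]]) (simp add: rho_in x)
  have c': "chart_around A (p \<otimes> \<one>) c" using c p by simp
  have e: "chart_around (tspace_atlas A \<one>) (\<rho> (inv \<one>) x) alg_chart"
    using chart_around_alg[OF x] rho_one[OF x] by simp
  have "snd (tmap A SA (\<lambda>q. (p \<otimes> q, \<rho> (inv q) x)) a) (chart_prod c alg_chart) =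
      (snd (linv a p) c, - snd (a \<bullet>\<^sub>g x) unit_chart)"
    using snd_tmap_Pair[OF smooth_A smooth_A T1 s1 s2 a1 c' e]
      snd_tmap[OF smooth_A T1 s2 a1 unit_chart e] frechet_derivative_rho_inv[OF a x] p
    by (simp add: semi_atlas_def ltrans_def)
  then show ?thesis
    by (simp add: phi_field_apply(1)[OF p x a b] snd_alg_curve[OF c x])
qed

section \<open>The trivialisation on horizontal and vertical lifts\<close>

definition lift_field :: "('a, real^'n) tvec \<Rightarrow> ('a, real^'n) tvec \<Rightarrow> (('a, real^'n) tvec, (real^'n) \<times> (real^'n)) vfield" where
  "lift_field a b = vf_add (tbundle_atlas A) (hlift A D (linv a)) (vlift A (linv b))"

text \<open>Left translation is linear on fibres, so the straight line in the fibre that defines a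
  vertical vector is carried to a straight line in the Lie algebra.\<close>

lemma Theta_vert:
  assumes p: "p \<in> mcarrier A" and x: "x \<in> lie_alg G A" and y: "y \<in> lie_alg G A"
  shows "tmap (tbundle_atlas A) SA (Theta G A) (vert A (translate p x) (translate p y)) =
    velocity SA (\<lambda>t. (p, tadd x (tscale t y)))"
proof -
  note TA = smooth_atlas_tbundle[OF smooth_A]
  note px = linv_in_tspace[OF x p, unfolded linv_apply[OF p]] and py = linv_in_tspace[OF y p, unfolded linv_apply[OF p]]
  note s = smooth_at_vert_curve[OF smooth_A p px py]
  have "translate p x \<in> mcarrier (tbundle_atlas A)" using tspace_tbundle[OF px p] by simp
  from diffeoD(1)[OF diffeo_Theta this]
  have T: "smooth_at (tbundle_atlas A) SA (Theta G A) (tadd (translate p x) (tscale 0 (translate p y)))"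
    by (simp add: tadd_tscale_0)
  have "Theta G A (tadd (translate p x) (tscale t (translate p y))) = (p, tadd x (tscale t y))" for t
  proof -
    note sm = smooth_at_ltrans[OF p group_closed(3)] and x1 = lie_algD(1)[OF x] and y1 = lie_algD(1)[OF y]
    have "tadd (translate p x) (tscale t (translate p y)) = translate p (tadd x (tscale t y))"
      by (simp add: tmap_tadd[OF smooth_A smooth_A sm x1 tscale_in_tspace[OF smooth_A y1]]
          tmap_tscale[OF smooth_A smooth_A sm y1])
    then show ?thesis by (simp add: Theta_translate[OF p] lie_alg_tadd lie_alg_tscale x y)
  qed
  then show ?thesis
    unfolding vert_def using tmap_velocity[OF TA smooth_semi s T] by (simp add: ltrans_def)
qed

lemma Theta_section:
  assumes c: "chart_around A p c" and x: "x \<in> lie_alg G A" and v: "v \<in> tspace A p"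
  shows "snd (tmap (tbundle_atlas A) SA (Theta G A) (tmap A (tbundle_atlas A) (linv x) v)) (chart_prod c alg_chart) =
    (snd v c, 0)"
proof -
  note TA = smooth_atlas_tbundle[OF smooth_A] and p = chart_aroundD(4)[OF c] and X = linv_in_vfields[OF x]
  have xm: "x \<in> mcarrier (tspace_atlas A \<one>)" using x by (simp add: mcarrier_T1)
  note s = vfieldsD(5)[OF smooth_A X p] and id = smooth_at_id[OF smooth_A p]
  note k = smooth_at_const[OF smooth_A p xm]
  have sp: "smooth_at A SA (\<lambda>q. (q, x)) p"
    unfolding semi_atlas_def by (rule smooth_at_Pair[OF smooth_A smooth_A T1 id k])
  have "linv x p \<in> mcarrier (tbundle_atlas A)" using vfieldsD(3)[OF smooth_A X p] by simp
  note T = diffeoD(1)[OF diffeo_Theta this]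
  have "tmap (tbundle_atlas A) SA (Theta G A) (tmap A (tbundle_atlas A) (linv x) v) =
      tmap A SA (\<lambda>q. Theta G A (linv x q)) v"
    by (rule tmap_compose[OF smooth_A TA smooth_semi s T v])
  also have "\<dots> = tmap A SA (\<lambda>q. (q, x)) v"
    by (rule tmap_cong[OF smooth_A smooth_semi sp _ v]) (simp add: Theta_translate x)
  finally show ?thesis
    using snd_tmap_Pair[OF smooth_A smooth_A T1 id k v c chart_around_alg[OF x]]
      snd_tmap_const[OF smooth_A T1 p v chart_around_alg[OF x]]
    by (simp add: semi_atlas_def tmap_id[OF smooth_A p v])
qed

lemma Theta_lift_field:
  assumes u: "u \<in> tbundle A" and a: "a \<in> lie_alg G A" and b: "b \<in> lie_alg G A"
  shows "tmap (tbundle_atlas A) SA (Theta G A) (lift_field a b u) = phi_field G A \<rho> a b (Theta G A u)"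
proof -
  note TA = smooth_atlas_tbundle[OF smooth_A]
  define p x where "p = fst u" and "x = translate (inv p) u"
  have p: "p \<in> mcarrier A" and ut: "u \<in> tspace A p" using u by (simp_all add: tbundle_iff p_def)
  have x: "x \<in> lie_alg G A" unfolding x_def p_def by (rule translate_inv_in_lie_alg[OF u])
  have ux: "translate p x = u" unfolding x_def by (rule translate_inv(2)[OF p p ut])
  have Tu: "Theta G A u = (p, x)" by (simp add: Theta_apply p_def x_def)
  obtain c where c: "chart_around A p c" using p by (rule obtain_chart)
  note av = linv_in_vfields[OF a] and bv = linv_in_vfields[OF b] and xv = linv_in_vfields[OF x]
  have lx: "linv x p = u" using p ux by simp
  have um: "u \<in> mcarrier (tbundle_atlas A)" using u by simp
  note T = diffeoD(1)[OF diffeo_Theta um]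
  note ax = bullet_in[OF a x]
  \<comment> \<open>Any test field through \<open>u\<close> computes the horizontal lift;
    \<open>linv x\<close> is the one whose covariant derivative along \<open>linv a\<close> is
    explicit.\<close>
  have h: "hlift A D (linv a) u = tminus (tmap A (tbundle_atlas A) (linv x) (linv a p)) (vert A u (translate p (a \<bullet>\<^sub>g x)))"
    using hlift_eq[OF smooth_A fc.frame fc.metric connection av xv p lx] p
    by (simp add: hvec_def connection_linv[OF a x] flip: p_def)
  have t1: "tmap A (tbundle_atlas A) (linv x) (linv a p) \<in> tspace (tbundle_atlas A) u"
    using tmap_in_tspace[OF smooth_A TA vfieldsD(5)[OF smooth_A xv p] linv_in_tspace[OF a p]] lx by simp
  have t: "vert A u (translate p y) \<in> tspace (tbundle_atlas A) u" if "y \<in> lie_alg G A" for y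
    using vert_in_tspace[OF smooth_A p ut linv_in_tspace[OF that p]] p by simp
  have f: "lift_field a b u = tadd (tminus (tmap A (tbundle_atlas A) (linv x) (linv a p)) (vert A u (translate p (a \<bullet>\<^sub>g x))))
      (vert A u (translate p b))"
    using um p by (simp add: lift_field_def h vlift_apply[OF u] flip: p_def)
  have ft: "lift_field a b u \<in> tspace (tbundle_atlas A) u"
    unfolding f by (intro tadd_in_tspace[OF TA] tminus_in_tspace[OF TA] t1 t ax b)
  have "tmap (tbundle_atlas A) SA (Theta G A) (lift_field a b u) =
      tadd (tminus (tmap (tbundle_atlas A) SA (Theta G A) (tmap A (tbundle_atlas A) (linv x) (linv a p)))
        (velocity SA (\<lambda>t. (p, tadd x (tscale t (a \<bullet>\<^sub>g x)))))) (velocity SA (\<lambda>t. (p, tadd x (tscale t b))))"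
    unfolding f
    by (simp add: tmap_tadd[OF TA smooth_semi T tminus_in_tspace[OF TA t1 t[OF ax]] t[OF b]]
        tmap_tminus[OF TA smooth_semi T t1 t[OF ax]]
        Theta_vert[OF p x ax, unfolded ux] Theta_vert[OF p x b, unfolded ux])
  then have "snd (tmap (tbundle_atlas A) SA (Theta G A) (lift_field a b u)) (chart_prod c alg_chart) =
      (snd (linv a p) c, snd b unit_chart - snd (a \<bullet>\<^sub>g x) unit_chart)"
    using Theta_section[OF c x linv_in_tspace[OF a p]]
    by (simp add: snd_alg_curve[OF c x])
  then show ?thesis
    unfolding Tu
    by (intro tspace_eqI[OF tmap_in_tspace[OF TA smooth_semi T ft, unfolded Tu]
          phi_field_in_tspace[OF p x a b] chart_around_semi[OF c x]])
      (simp add: snd_phi_field[OF c x a b])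
qed

end

section \<open>Comparison of the structures\<close>

locale canonical_structures = invariant_connection G A D g \<rho>
  for G :: "('a, 'm) monoid_scheme" (structure) and A :: "('a, real^'n) atlas" and D g \<rho> +
  fixes J1 g1 D1 J0 g0 D0
  assumes complex1: "canonical_complex_structure A D J1"
    and metric1: "canonical_metric A D g g1"
    and connection1: "canonical_connection A D D1"
    and complex0: "left_invariant_J0 G A \<rho> J0"
    and metric0: "left_invariant_g0 G A \<rho> g g0"
    and connection0: "left_invariant_D0 G A \<rho> D D0"
begin

abbreviation TA where "TA \<equiv> tbundle_atlas A"

lemmas smooth_TA = smooth_atlas_tbundle[OF smooth_A]

text \<open>Horizontal lifts of smooth fields are smooth because vertical lifts are and \<open>J\<^sub>1\<close> is a smooth
  tensor exchanging the two.\<close>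

lemma hlift_in_vfields:
  assumes X: "X \<in> vfields A"
  shows "hlift A D X \<in> vfields TA"
proof -
  let ?V = "vf_apply TA J1 (vlift A X)"
  have V: "?V \<in> vfields TA" and eq: "?V = vf_scale TA (\<lambda>_. -1) (hlift A D X)"
    using complex1 X vlift_in_vfields[OF smooth_A X]
    unfolding canonical_complex_structure_def endo_field_def by blast+
  \<comment> \<open>J1 applied to the vertical lift is minus the horizontal lift, so a second sign
    change recovers the latter.\<close>
  have "hlift A D X = vf_scale TA (\<lambda>_. -1) ?V"
  proof (rule extensionalityI)
    show "hlift A D X \<in> extensional (mcarrier TA)" by (simp add: hlift_def)
    fix u assume "u \<in> mcarrier TA"
    then show "hlift A D X u = vf_scale TA (\<lambda>_. -1) ?V u"
      unfolding eq by (intro tvec_eqI) simp_all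
  qed (rule vf_extensional)
  then show ?thesis using vf_scale_in_vfields[OF smooth_TA smooth_fun_const[OF smooth_TA] V] by simp
qed

lemma lift_field_in_vfields:
  "a \<in> lie_alg G A \<Longrightarrow> b \<in> lie_alg G A \<Longrightarrow> lift_field a b \<in> vfields TA"
  unfolding lift_field_def
  by (intro vf_add_in_vfields[OF smooth_TA] hlift_in_vfields vlift_in_vfields[OF smooth_A] linv_in_vfields)

lemma lift_field_apply:
  "u \<in> tbundle A \<Longrightarrow> lift_field a b u = tadd (hlift A D (linv a) u) (vlift A (linv b) u)"
  by (simp add: lift_field_def)

section \<open>The frame of lifted left invariant fields on TG\<close>

abbreviation lift_frame where
  "lift_frame z \<equiv> lift_field (lie_vec (fst z)) (lie_vec (snd z))"

lemma frame_lift: "frame TA lift_frame"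
  unfolding frame_def
proof (intro conjI allI ballI)
  fix v w :: "(real^'n) \<times> (real^'n)" and r :: real
  show "lift_frame v \<in> vfields TA" by (simp add: lift_field_in_vfields lie_vec_in)
  note LV = linv_in_vfields[OF lie_vec_in]
  show "lift_frame (v + w) = vf_add TA (lift_frame v) (lift_frame w)"
  proof (rule extensionalityI)
    show "lift_frame (v + w) \<in> extensional (mcarrier TA)" unfolding lift_field_def by (rule vf_extensional)
    fix u assume u: "u \<in> mcarrier TA"
    show "lift_frame (v + w) u = vf_add TA (lift_frame v) (lift_frame w) u"
      by (rule tvec_eqI)
        (use u in \<open>simp_all add: lift_field_def lie_vec_add linv_add lie_vec_in
          fc.hlift_add[OF LV LV] vlift_add[OF smooth_A LV LV] del: mcarrier_tbundle\<close>)
  qed (rule vf_extensional)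
  show "lift_frame (r *\<^sub>R v) = vf_scale TA (\<lambda>_. r) (lift_frame v)"
  proof (rule extensionalityI)
    show "lift_frame (r *\<^sub>R v) \<in> extensional (mcarrier TA)" unfolding lift_field_def by (rule vf_extensional)
    fix u assume u: "u \<in> mcarrier TA"
    show "lift_frame (r *\<^sub>R v) u = vf_scale TA (\<lambda>_. r) (lift_frame v) u"
      by (rule tvec_eqI)
        (use u in \<open>simp_all add: lift_field_def lie_vec_scale linv_scale lie_vec_in
          fc.hlift_scale[OF LV] vlift_scale[OF smooth_A LV] scaleR_add_right del: mcarrier_tbundle\<close>)
  qed (rule vf_extensional)
next
  fix u \<xi> assume "u \<in> mcarrier TA" and xi: "\<xi> \<in> tspace TA u"
  then have u: "u \<in> tbundle A" by simp
  obtain v w where "\<xi> = tadd (hlift A D (linv (lie_vec v)) u) (vlift A (linv (lie_vec w)) u)"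
    by (rule fc.hlift_vlift_decomposition[OF u xi])
  then have "lift_frame (v, w) u = \<xi>" by (simp add: lift_field_apply[OF u])
  then show "\<exists>z. lift_frame z u = \<xi>" by blast
qed

lemma obtain_lift_field:
  assumes u: "u \<in> tbundle A" and xi: "\<xi> \<in> tspace TA u"
  obtains a b where "a \<in> lie_alg G A" "b \<in> lie_alg G A" "\<xi> = lift_field a b u"
proof -
  have "u \<in> mcarrier TA" using u by simp
  from frameD(4)[OF frame_lift this xi] that show ?thesis using lie_vec_in by blast
qed

lemma hlift_in: "a \<in> lie_alg G A \<Longrightarrow> u \<in> tbundle A \<Longrightarrow> hlift A D (linv a) u \<in> tspace TA u"
  by (rule fc.hlift_in_tspace[OF linv_in_vfields])

lemma vlift_in: "a \<in> lie_alg G A \<Longrightarrow> u \<in> tbundle A \<Longrightarrow> vlift A (linv a) u \<in> tspace TA u"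
  using vfieldsD(2)[OF smooth_TA vlift_in_vfields[OF smooth_A linv_in_vfields], of a u] by simp

lemma metric1_lift_field:
  assumes u: "u \<in> tbundle A" and a: "a \<in> lie_alg G A" and b: "b \<in> lie_alg G A"
    and c: "c \<in> lie_alg G A" and d: "d \<in> lie_alg G A"
  shows "g1 (lift_field a b u) (lift_field c d u) = g a c + g b d"
proof -
  have p: "fst u \<in> mcarrier A" using u by (simp add: tbundle_iff)
  have um: "u \<in> mcarrier TA" using u by simp
  have rm: "riemannian_metric TA g1" using metric1 by (simp add: canonical_metric_def)
  note gD = riemannian_metricD[OF rm um]
  have hh: "g1 (hlift A D (linv a) u) (hlift A D (linv c) u) = g a c"
    and vv: "g1 (vlift A (linv b) u) (vlift A (linv d) u) = g b d"
    and hv: "g1 (hlift A D (linv a) u) (vlift A (linv d) u) = 0" "g1 (hlift A D (linv c) u) (vlift A (linv b) u) = 0"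
    using metric1 linv_in_vfields[OF a] linv_in_vfields[OF b] linv_in_vfields[OF c] linv_in_vfields[OF d] u
      metric_linv[OF invariant_metric p a c] metric_linv[OF invariant_metric p b d]
    unfolding canonical_metric_def by metis+
  note h = hlift_in[OF _ u] and v = vlift_in[OF _ u]
  have hv_in: "tadd (hlift A D (linv c) u) (vlift A (linv d) u) \<in> tspace TA u"
    by (rule tadd_in_tspace[OF smooth_TA h[OF c] v[OF d]])
  \<comment> \<open>\<open>riemannian_metric\<close> states additivity in the first argument;
    symmetry carries it to the second.\<close>
  have "g1 w (tadd (hlift A D (linv c) u) (vlift A (linv d) u)) =
      g1 w (hlift A D (linv c) u) + g1 w (vlift A (linv d) u)" if w: "w \<in> tspace TA u" for w
    using gD(1)[OF h[OF c] v[OF d] w] gD(3)[OF w hv_in] gD(3)[OF w h[OF c]] gD(3)[OF w v[OF d]] by simp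
  then show ?thesis
    using h[OF a] v[OF b] gD(1)[OF h[OF a] v[OF b] hv_in] gD(3)[OF v[OF b] h[OF c]] hh vv hv
    by (simp add: lift_field_apply[OF u])
qed

text \<open>The inner products of the lifted fields do not involve the point of the bundle. This
  makes \<open>frame_induct\<close> available on TG with \<open>g1\<close> as the metric.\<close>

lemma const_frame_metric_lift: "const_frame_metric TA lift_frame g1"
  using metric1 by (simp add: const_frame_metric_def canonical_metric_def metric1_lift_field lie_vec_in)

lemma connection1_lift_field:
  assumes a: "a \<in> lie_alg G A" and b: "b \<in> lie_alg G A" and c: "c \<in> lie_alg G A" and d: "d \<in> lie_alg G A"
  shows "D1 (lift_field a b) (lift_field c d) = lift_field (a \<bullet>\<^sub>g c) (a \<bullet>\<^sub>g d)"
proof -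
  have ac: "affine_connection TA D1" using connection1 by (simp add: canonical_connection_def)
  note LV = linv_in_vfields
  note h = hlift_in_vfields[OF LV] and v = vlift_in_vfields[OF smooth_A LV]
  note hv = vf_add_in_vfields[OF smooth_TA h[OF c] v[OF d]]
  have eqs: "D1 (hlift A D (linv a)) (hlift A D (linv c)) = hlift A D (linv (a \<bullet>\<^sub>g c))"
    "D1 (hlift A D (linv a)) (vlift A (linv d)) = vlift A (linv (a \<bullet>\<^sub>g d))"
    "D1 (vlift A (linv b)) (hlift A D (linv c)) = vf_zero TA"
    "D1 (vlift A (linv b)) (vlift A (linv d)) = vf_zero TA"
    using connection1 LV[OF a] LV[OF b] LV[OF c] LV[OF d] connection_linv[OF a c] connection_linv[OF a d]
    unfolding canonical_connection_def by metis+
  have "D1 (lift_field a b) (lift_field c d) =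
      vf_add TA (vf_add TA (hlift A D (linv (a \<bullet>\<^sub>g c))) (vlift A (linv (a \<bullet>\<^sub>g d))))
        (vf_add TA (vf_zero TA) (vf_zero TA))"
    unfolding lift_field_def affine_connectionD(2)[OF ac h[OF a] hv v[OF b]]
      affine_connectionD(4)[OF ac h[OF a] h[OF c] v[OF d]] affine_connectionD(4)[OF ac v[OF b] h[OF c] v[OF d]] eqs ..
  also have "\<dots> = lift_field (a \<bullet>\<^sub>g c) (a \<bullet>\<^sub>g d)"
    unfolding lift_field_def
  proof (rule extensionalityI[OF vf_extensional(1) vf_extensional(1)])
    fix u assume "u \<in> mcarrier TA"
    then show "vf_add TA (vf_add TA (hlift A D (linv (a \<bullet>\<^sub>g c))) (vlift A (linv (a \<bullet>\<^sub>g d))))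
        (vf_add TA (vf_zero TA) (vf_zero TA)) u = vf_add TA (hlift A D (linv (a \<bullet>\<^sub>g c))) (vlift A (linv (a \<bullet>\<^sub>g d))) u"
      by (intro tvec_eqI) simp_all
  qed
  finally show ?thesis .
qed

section \<open>Push-forward by the trivialisation\<close>

abbreviation Tinv :: "'a \<times> ('a, real^'n) tvec \<Rightarrow> ('a, real^'n) tvec" where
  "Tinv y \<equiv> translate (fst y) (snd y)"

lemma Theta_push_apply: "y \<in> mcarrier SA \<Longrightarrow> Theta_push G A X y = tmap TA SA (Theta G A) (X (Tinv y))"
  unfolding Theta_push_def by (rule push_apply[OF diffeo_Theta])

lemma Theta_push_Theta:
  "u \<in> tbundle A \<Longrightarrow> Theta_push G A X (Theta G A u) = tmap TA SA (Theta G A) (X u)"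
  using Theta_push_apply[OF diffeoD(3)[OF diffeo_Theta]] diffeoD(2)[OF diffeo_Theta, of u] by simp

lemma Tinv_in: "y \<in> mcarrier SA \<Longrightarrow> Tinv y \<in> tbundle A" and Theta_Tinv: "y \<in> mcarrier SA \<Longrightarrow> Theta G A (Tinv y) = y"
  using diffeoD(6)[OF diffeo_Theta] diffeoD(5)[OF diffeo_Theta] by simp_all

lemma Theta_push_lift_field:
  assumes a: "a \<in> lie_alg G A" and b: "b \<in> lie_alg G A"
  shows "Theta_push G A (lift_field a b) = phi_field G A \<rho> a b"
proof (rule extensionalityI)
  show "Theta_push G A (lift_field a b) \<in> extensional (mcarrier SA)"
    unfolding Theta_push_def by (rule vf_extensional)
  show "phi_field G A \<rho> a b \<in> extensional (mcarrier SA)" by (simp add: phi_field_def linv_field_def)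
  fix y assume y: "y \<in> mcarrier SA"
  then show "Theta_push G A (lift_field a b) y = phi_field G A \<rho> a b y"
    using Theta_lift_field[OF Tinv_in[OF y] a b] by (simp add: Theta_push_apply Theta_Tinv)
qed

text \<open>The claim is pointwise, so at each \<open>u\<close> the two values may be represented by
  lifted left invariant fields, with Lie algebra elements chosen anew for that point.\<close>

lemma metric_Theta:
  assumes X: "X \<in> vfields TA" and Y: "Y \<in> vfields TA" and u: "u \<in> tbundle A"
  shows "g1 (X u) (Y u) = g0 (Theta_push G A X (Theta G A u)) (Theta_push G A Y (Theta G A u))"
proof -
  have um: "u \<in> mcarrier TA" using u by simp
  obtain a b where ab: "a \<in> lie_alg G A" "b \<in> lie_alg G A" "X u = lift_field a b u"
    by (rule obtain_lift_field[OF u vfieldsD(2)[OF smooth_TA X um]])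
  obtain c d where cd: "c \<in> lie_alg G A" "d \<in> lie_alg G A" "Y u = lift_field c d u"
    by (rule obtain_lift_field[OF u vfieldsD(2)[OF smooth_TA Y um]])
  have "g0 (phi_field G A \<rho> a b (Theta G A u)) (phi_field G A \<rho> c d (Theta G A u)) = g a c + g b d"
    using metric0 ab(1,2) cd(1,2) diffeoD(3)[OF diffeo_Theta um] unfolding left_invariant_g0_def by blast
  then show ?thesis
    using metric1_lift_field[OF u ab(1,2) cd(1,2)]
    by (simp add: Theta_push_Theta[OF u] ab(3) cd(3) Theta_lift_field[OF u ab(1,2)] Theta_lift_field[OF u cd(1,2)])
qed

text \<open>J1 turns the vertical lift of \<open>b\<close> into minus its horizontal lift, which
  linearity of the lift absorbs into \<open>tscale (-1) b\<close>. The outcome has the shape (a, b)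
  \<mapsto> (-b, a) of J0.\<close>

lemma J1_lift_field:
  assumes u: "u \<in> tbundle A" and a: "a \<in> lie_alg G A" and b: "b \<in> lie_alg G A"
  shows "J1 (lift_field a b u) = lift_field (tscale (-1) b) a u"
proof -
  have um: "u \<in> mcarrier TA" using u by simp
  note LV = linv_in_vfields
  have lin: "linear_on_tspace TA u J1"
    using complex1 um unfolding canonical_complex_structure_def endo_field_def by blast
  have "vf_apply TA J1 (hlift A D (linv a)) = vlift A (linv a)"
    "vf_apply TA J1 (vlift A (linv b)) = vf_scale TA (\<lambda>_. -1) (hlift A D (linv b))"
    using complex1 LV[OF a] LV[OF b] unfolding canonical_complex_structure_def by blast+
  then have "J1 (hlift A D (linv a) u) = vlift A (linv a) u"
    "J1 (vlift A (linv b) u) = tscale (-1) (hlift A D (linv b) u)"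
    using vf_apply_apply[OF um, of J1] vf_scale_apply[OF um] by metis+
  then have "J1 (lift_field a b u) = tadd (vlift A (linv a) u) (tscale (-1) (hlift A D (linv b) u))"
    using lin hlift_in[OF a u] vlift_in[OF b u] by (simp add: lift_field_apply[OF u] linear_on_tspace_def)
  also have "\<dots> = lift_field (tscale (-1) b) a u"
    using um tspaceD(1)[OF hlift_in[OF b u]] tspaceD(1)[OF vlift_in[OF a u]]
    by (intro tvec_eqI) (simp_all add: lift_field_apply[OF u] linv_scale[OF b] fc.hlift_scale[OF LV[OF b]])
  finally show ?thesis .
qed

lemma complex_Theta:
  assumes X: "X \<in> vfields TA"
  shows "Theta_push G A (vf_apply TA J1 X) = vf_apply SA J0 (Theta_push G A X)"
proof (rule extensionalityI)
  show "Theta_push G A (vf_apply TA J1 X) \<in> extensional (mcarrier SA)"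
    unfolding Theta_push_def by (rule vf_extensional)
  fix y assume y: "y \<in> mcarrier SA"
  define u where "u = Tinv y"
  have u: "u \<in> tbundle A" unfolding u_def by (rule Tinv_in[OF y])
  then have um: "u \<in> mcarrier TA" by simp
  have Tu: "Theta G A u = y" unfolding u_def by (rule Theta_Tinv[OF y])
  obtain a b where ab: "a \<in> lie_alg G A" "b \<in> lie_alg G A" "X u = lift_field a b u"
    by (rule obtain_lift_field[OF u vfieldsD(2)[OF smooth_TA X um]])
  have "vf_apply SA J0 (phi_field G A \<rho> a b) = phi_field G A \<rho> (tscale (-1) b) a"
    using complex0 ab(1,2) unfolding left_invariant_J0_def by blast
  then have J: "J0 (phi_field G A \<rho> a b y) = phi_field G A \<rho> (tscale (-1) b) a y"
    using vf_apply_apply[OF y, of J0] by metis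
  have "Theta_push G A (vf_apply TA J1 X) y = tmap TA SA (Theta G A) (J1 (lift_field a b u))"
    using um by (simp add: Theta_push_apply[OF y] ab(3) flip: u_def)
  also have "\<dots> = phi_field G A \<rho> (tscale (-1) b) a y"
    by (simp add: J1_lift_field[OF u ab(1,2)] Theta_lift_field[OF u lie_alg_tscale[OF ab(2)] ab(1)] Tu)
  also have "\<dots> = vf_apply SA J0 (Theta_push G A X) y"
    using y Theta_lift_field[OF u ab(1,2)] by (simp add: Theta_push_apply[OF y] ab(3) Tu J flip: u_def)
  finally show "Theta_push G A (vf_apply TA J1 X) y = vf_apply SA J0 (Theta_push G A X) y" .
qed (rule vf_extensional)

lemma Theta_push_in_vfields: "X \<in> vfields TA \<Longrightarrow> Theta_push G A X \<in> vfields SA"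
  unfolding Theta_push_def by (rule push_in_vfields[OF smooth_TA smooth_semi diffeo_Theta])

lemma Theta_push_add:
  "X \<in> vfields TA \<Longrightarrow> Y \<in> vfields TA \<Longrightarrow>
    Theta_push G A (vf_add TA X Y) = vf_add SA (Theta_push G A X) (Theta_push G A Y)"
  unfolding Theta_push_def by (rule push_add[OF smooth_TA smooth_semi diffeo_Theta])

lemma Theta_push_scale:
  "X \<in> vfields TA \<Longrightarrow>
    Theta_push G A (vf_scale TA f X) = vf_scale SA (\<lambda>y. f (Tinv y)) (Theta_push G A X)"
  unfolding Theta_push_def by (rule push_scale[OF smooth_TA smooth_semi diffeo_Theta])

text \<open>Not an instance of the two preceding lemmas, because \<open>X(f)\<close> is not known to be smooth.\<close>

lemma Theta_push_Leibniz:
  assumes X: "X \<in> vfields TA" and Y: "Y \<in> vfields TA" and Z: "Z \<in> vfields TA" and f: "smooth_fun TA f"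
  shows "Theta_push G A (vf_add TA (vf_scale TA (vf_deriv TA X f) Y) (vf_scale TA f Z)) =
    vf_add SA (vf_scale SA (vf_deriv SA (Theta_push G A X) (\<lambda>y. f (Tinv y))) (Theta_push G A Y))
      (vf_scale SA (\<lambda>y. f (Tinv y)) (Theta_push G A Z))"
proof (rule extensionalityI)
  show "Theta_push G A (vf_add TA (vf_scale TA (vf_deriv TA X f) Y) (vf_scale TA f Z)) \<in> extensional (mcarrier SA)"
    unfolding Theta_push_def by (rule vf_extensional)
  fix y assume y: "y \<in> mcarrier SA"
  have um: "Tinv y \<in> mcarrier TA" using Tinv_in[OF y] by simp
  note T = diffeoD(1)[OF diffeo_Theta um] and Yt = vfieldsD(2)[OF smooth_TA Y um] and Zt = vfieldsD(2)[OF smooth_TA Z um]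
  have "Theta_push G A (vf_add TA (vf_scale TA (vf_deriv TA X f) Y) (vf_scale TA f Z)) y =
      tadd (tscale (vf_deriv TA X f (Tinv y)) (Theta_push G A Y y)) (tscale (f (Tinv y)) (Theta_push G A Z y))"
    using um tmap_tadd[OF smooth_TA smooth_semi T tscale_in_tspace[OF smooth_TA Yt] tscale_in_tspace[OF smooth_TA Zt]]
    by (simp add: Theta_push_apply[OF y] tmap_tscale[OF smooth_TA smooth_semi T Yt] tmap_tscale[OF smooth_TA smooth_semi T Zt]
        del: mcarrier_tbundle)
  then show "Theta_push G A (vf_add TA (vf_scale TA (vf_deriv TA X f) Y) (vf_scale TA f Z)) y =
      vf_add SA (vf_scale SA (vf_deriv SA (Theta_push G A X) (\<lambda>y. f (Tinv y))) (Theta_push G A Y))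
        (vf_scale SA (\<lambda>y. f (Tinv y)) (Theta_push G A Z)) y"
    using y vf_deriv_push[OF smooth_TA smooth_semi diffeo_Theta f X y, folded Theta_push_def] by simp
qed (rule vf_extensional)

text \<open>The differentiating field is kept in the frame while the induction runs over the
  differentiated one. The base case compares the two formulas on frames; for multiples, both
  connections give Leibniz terms that correspond because push-forward is compatible with derivatives
  of functions.\<close>

lemma connection_Theta_frame:
  assumes a: "a \<in> lie_alg G A" and b: "b \<in> lie_alg G A" and Y: "Y \<in> vfields TA"
  shows "Theta_push G A (D1 (lift_field a b) Y) = D0 (Theta_push G A (lift_field a b)) (Theta_push G A Y)"
proof (rule frame_induct[OF smooth_TA frame_lift const_frame_metric_lift Y])
  have ac1: "affine_connection TA D1" using connection1 by (simp add: canonical_connection_def)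
  have ac0: "affine_connection SA D0" using connection0 by (simp add: left_invariant_D0_def)
  note L = lift_field_in_vfields[OF a b]
  note PL = Theta_push_in_vfields[OF L]
  {
    fix z
    note c = lie_vec_in[of "fst z"] and d = lie_vec_in[of "snd z"]
    have "D0 (phi_field G A \<rho> a b) (phi_field G A \<rho> (lie_vec (fst z)) (lie_vec (snd z))) =
        phi_field G A \<rho> (a \<bullet>\<^sub>g lie_vec (fst z)) (a \<bullet>\<^sub>g lie_vec (snd z))"
      using connection0 a b c d unfolding left_invariant_D0_def by blast
    then show "Theta_push G A (D1 (lift_field a b) (lift_frame z)) =
        D0 (Theta_push G A (lift_field a b)) (Theta_push G A (lift_frame z))"
      by (simp add: connection1_lift_field[OF a b c d] Theta_push_lift_field a b c d bullet_in)
  next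
    fix Y Y' assume Y: "Y \<in> vfields TA" "Y' \<in> vfields TA"
      and IH: "Theta_push G A (D1 (lift_field a b) Y) = D0 (Theta_push G A (lift_field a b)) (Theta_push G A Y)"
        "Theta_push G A (D1 (lift_field a b) Y') = D0 (Theta_push G A (lift_field a b)) (Theta_push G A Y')"
    show "Theta_push G A (D1 (lift_field a b) (vf_add TA Y Y')) =
        D0 (Theta_push G A (lift_field a b)) (Theta_push G A (vf_add TA Y Y'))"
      unfolding affine_connectionD(4)[OF ac1 L Y] Theta_push_add[OF Y]
        Theta_push_add[OF affine_connectionD(1)[OF ac1 L Y(1)] affine_connectionD(1)[OF ac1 L Y(2)]]
        affine_connectionD(4)[OF ac0 PL Theta_push_in_vfields[OF Y(1)] Theta_push_in_vfields[OF Y(2)]] IH ..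
  next
    fix f Y assume f: "smooth_fun TA f" and Y: "Y \<in> vfields TA"
      and IH: "Theta_push G A (D1 (lift_field a b) Y) = D0 (Theta_push G A (lift_field a b)) (Theta_push G A Y)"
    note f' = smooth_fun_push[OF smooth_TA smooth_semi diffeo_Theta f]
    show "Theta_push G A (D1 (lift_field a b) (vf_scale TA f Y)) =
        D0 (Theta_push G A (lift_field a b)) (Theta_push G A (vf_scale TA f Y))"
      unfolding affine_connectionD(5)[OF ac1 L Y f] Theta_push_scale[OF Y]
        Theta_push_Leibniz[OF L Y affine_connectionD(1)[OF ac1 L Y] f]
        affine_connectionD(5)[OF ac0 PL Theta_push_in_vfields[OF Y] f'] IH ..
  }
qed

text \<open>With an arbitrary differentiated field already covered for frame directions, the first
  argument is reached by linearity over smooth functions, which holds for both connections.\<close>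

lemma connection_Theta:
  assumes X: "X \<in> vfields TA" and Y: "Y \<in> vfields TA"
  shows "Theta_push G A (D1 X Y) = D0 (Theta_push G A X) (Theta_push G A Y)"
proof (rule frame_induct[OF smooth_TA frame_lift const_frame_metric_lift X])
  have ac1: "affine_connection TA D1" using connection1 by (simp add: canonical_connection_def)
  have ac0: "affine_connection SA D0" using connection0 by (simp add: left_invariant_D0_def)
  note PY = Theta_push_in_vfields[OF Y]
  {
    fix z
    show "Theta_push G A (D1 (lift_frame z) Y) = D0 (Theta_push G A (lift_frame z)) (Theta_push G A Y)"
      by (rule connection_Theta_frame[OF lie_vec_in lie_vec_in Y])
  next
    fix X X' assume X: "X \<in> vfields TA" "X' \<in> vfields TA"
      and IH: "Theta_push G A (D1 X Y) = D0 (Theta_push G A X) (Theta_push G A Y)"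
        "Theta_push G A (D1 X' Y) = D0 (Theta_push G A X') (Theta_push G A Y)"
    show "Theta_push G A (D1 (vf_add TA X X') Y) = D0 (Theta_push G A (vf_add TA X X')) (Theta_push G A Y)"
      unfolding affine_connectionD(2)[OF ac1 X(1) Y X(2)] Theta_push_add[OF X]
        Theta_push_add[OF affine_connectionD(1)[OF ac1 X(1) Y] affine_connectionD(1)[OF ac1 X(2) Y]]
        affine_connectionD(2)[OF ac0 Theta_push_in_vfields[OF X(1)] PY Theta_push_in_vfields[OF X(2)]] IH ..
  next
    fix f X assume f: "smooth_fun TA f" and X: "X \<in> vfields TA"
      and IH: "Theta_push G A (D1 X Y) = D0 (Theta_push G A X) (Theta_push G A Y)"
    show "Theta_push G A (D1 (vf_scale TA f X) Y) = D0 (Theta_push G A (vf_scale TA f X)) (Theta_push G A Y)"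
      unfolding affine_connectionD(3)[OF ac1 X Y f] Theta_push_scale[OF X]
        Theta_push_scale[OF affine_connectionD(1)[OF ac1 X Y]]
        affine_connectionD(3)[OF ac0 Theta_push_in_vfields[OF X] PY
          smooth_fun_push[OF smooth_TA smooth_semi diffeo_Theta f]] IH ..
  }
qed

end

theorem theorem2p1:
  fixes G :: "('a, 'm) monoid_scheme"
    and A :: "('a, real^'n) atlas"
    and D :: "('a, real^'n) vfield \<Rightarrow> ('a, real^'n) vfield \<Rightarrow> ('a, real^'n) vfield"
    and g :: "('a, real^'n) tvec \<Rightarrow> ('a, real^'n) tvec \<Rightarrow> real"
  assumes "lie_group G A"
    and "connected_space (mtop A)"
    and "affine_connection A D" "flat A D" "torsionless A D" "left_invariant_connection G A D"
    and "riemannian_metric A g" "left_invariant_metric G A g"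
    and "integrates_left_mult G A D \<rho>"
    and "canonical_complex_structure A D J1"
    and "canonical_metric A D g g1"
    and "canonical_connection A D D1"
    and "left_invariant_J0 G A \<rho> J0"
    and "left_invariant_g0 G A \<rho> g g0"
    and "left_invariant_D0 G A \<rho> D D0"
  shows "\<forall>X\<in>vfields (tbundle_atlas A). \<forall>Y\<in>vfields (tbundle_atlas A).
           (\<forall>u\<in>tbundle A.
              g1 (X u) (Y u) =
              g0 (Theta_push G A X (Theta G A u)) (Theta_push G A Y (Theta G A u))) \<and>
           Theta_push G A (vf_apply (tbundle_atlas A) J1 X) =
             vf_apply (semi_atlas G A) J0 (Theta_push G A X) \<and>
           Theta_push G A (D1 X Y) = D0 (Theta_push G A X) (Theta_push G A Y)"
proof -
  interpret canonical_structures G A D g \<rho> J1 g1 D1 J0 g0 D0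
    by unfold_locales (rule assms)+
  show ?thesis using metric_Theta complex_Theta connection_Theta by blast
qed

end
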